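(* Let $\gamma\in(0,1/4)$, $R>0$, $\lambda\ge0$, $\nu\in(2,\infty)$. Let $\Omega\subset\mathbb{R}^d$ be an open half space whose inner unit normal $\mathbf{n}$ satisfies $\mathbf{n}\cdot e_1\ge\cos(\gamma/2)$, and let $\hat y_0\in\partial\Omega$ be such that $$B_R^+(\hat y_0)\subset\Omega_R(\hat y_0)\subset\{(y_1,y'):-2\gamma R<y_1\}\cap B_R(\hat y_0).$$ Let $\{\bar a_{\alpha\beta}(y_1)\}_{|\alpha|=|\beta|=m}$ be infinitely differentiable coefficients satisfying the ellipticity condition in the context and $$\sup_{|\alpha|=|\beta|=m}\int_{B_R(\hat y_0)}|a_{\alpha\beta}(y)-\bar a_{\alpha\beta}(y_1)|\,dy\le\gamma|B_R|.$$ Let $f_\alpha\in L_2(\Omega_R(\hat y_0))$, $|\alpha|\le m$, and let $u\in W^m_\nu(\Omega_R(\hat y_0))$ satisfy $$(-1)^m\sum_{|\alpha|=|\beta|=m}D^\alpha(a_{\alpha\beta}D^\beta u)+\lambda u=\sum_{|\alpha|\le m}D^\alpha f_\alpha$$ in $\Omega_R(\hat y_0)$ with the conormal derivative condition on $\partial\Omega\cap B_R(\hat y_0)$. Then $u$ satisfies $$(-1)^m\mathcal{L}_0u+\lambda u=(-1)^m\sum_{|\alpha|=|\beta|=m}D^\alpha\big((\bar a_{\alpha\beta}-a_{\alpha\beta})D^\beta u\big)+\sum_{|\alpha|\le m}D^\alpha\tilde f_\alpha+\sum_{|\alpha|=m}D^\alpha g_\alpha-\lambda h$$ in $B_R^+(\hat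 y_0)$ with the conormal derivative boundary condition on $\Gamma_R(\hat y_0)$, where $\mathcal{L}_0u=\sum_{|\alpha|=|\beta|=m}D^\alpha(\bar a_{\alpha\beta}D^\beta u)$ and, with $\Omega^*=\{y_1<0\}\cap\Omega\cap B_R(\hat y_0)$, $$\tilde f_\alpha(y)=f_\alpha(y)+\sum_{k=1}^mc_{\alpha,k}f_\alpha(-ky_1,y')\,1_{(-ky_1,y')\in\Omega^*},$$ $$g_\alpha(y)=(-1)^{m+1}\sum_{|\beta|=m}\sum_{k=1}^mc_{\alpha,k}\,a_{\alpha\beta}(-ky_1,y')\,(D^\beta u)(-ky_1,y')\,1_{(-ky_1,y')\in\Omega^*},$$ $$h(y)=\sum_{k=1}^mk\,c_k\,u(-ky_1,y')\,1_{(-ky_1,y')\in\Omega^*},$$ where $c_{\alpha,k}=(-1)^{\alpha_1}c_kk^{-\alpha_1+1}$ and $\{c_1,\ldots,c_m\}$ is the solution of $\sum_{k=1}^m(-1/k)^jc_k=1$, $j=0,\ldots,m-1$.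
   Context: Points are $y=(y_1,y')\in\mathbb{R}^d$; $\mathbb{R}^d_+=\{y_1>0\}$; $B_r(y)$ is the open ball, $B_r^+(y)=B_r(y)\cap\mathbb{R}^d_+$, $\Gamma_r(y)=B_r(y)\cap\partial\mathbb{R}^d_+$, $\Omega_r(y)=B_r(y)\cap\Omega$; $e_1$ is the first basis vector. $\alpha,\beta$ are $d$-dimensional multi-indices; functions $u,f_\alpha$ are $\mathbb{C}^n$-valued, and $a_{\alpha\beta}$ are measurable $n\times n$ complex matrix-valued functions on $\mathbb{R}^d$. Ellipticity condition (satisfied by $a_{\alpha\beta}$ and by $\bar a_{\alpha\beta}$, $|\alpha|=|\beta|=m$): for some $\delta\in(0,1)$, $$\delta|\xi|^2\le\sum_{|\alpha|=|\beta|=m}\Re(a_{\alpha\beta}\xi_\beta,\xi_\alpha),\quad|a_{\alpha\beta}|\le\delta^{-1}$$ at every point, for all $\xi=(\xi_\alpha)_{|\alpha|=m}$, $\xi_\alpha\in\mathbb{C}^n$, $(\xi,\eta)=\sum_i\xi^i\overline{\eta^i}$. Conormal condition on part of the boundary: for an open set $D$, $\Gamma\subset\partial D$, and $F_\alpha\in L_2(D)$, a function $u$ satisfies $(-1)^m\sum_{|\alpha|=|\beta|=m}D^\alpha(A_{\alpha\beta}D^\beta u)+\lambda u=\sum_{|\alpha|\le m}D^\alpha F_\alpha$ in $D$ with the conormal derivative condition on $\Gamma$ (associated with the $F_\alpha$) if $$\int_D\sum_{|\alpha|=|\beta|=m}D^\alpha\phi\cdot A_{\alpha\beta}D^\beta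 u+\lambda\phi\cdot u\,dy=\sum_{|\alpha|\le m}\int_D(-1)^{|\alpha|}D^\alpha\phi\cdot F_\alpha\,dy$$ for every $\phi\in W^m_2(D)$ supported in $D\cup\Gamma$ (that is, vanishing near $\partial D\setminus\Gamma$). In the conclusion the data are, for $|\alpha|=m$, $F_\alpha=(-1)^m\sum_{|\beta|=m}(\bar a_{\alpha\beta}-a_{\alpha\beta})D^\beta u+\tilde f_\alpha+g_\alpha$; for $0<|\alpha|<m$, $F_\alpha=\tilde f_\alpha$; and for $\alpha=0$, $F_0=\tilde f_0-\lambda h$. *)

theory Defs
  imports "HOL-Analysis.Analysis"
begin

text \<open>
  The space $R^d$ is \<^typ>\<open>real ^ 'd\<close>, where the finite index type carries a linear order; the
  coordinate written $y_1$ is the one with the least index.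
\<close>

type_synonym 'd pt = "(real, 'd) vec"

definition idx1 :: "'d::{finite,linorder}" where
  "idx1 = Min UNIV"

definition upper_half :: "'d::{finite,linorder} pt set" where
  "upper_half = {y. 0 < y $ idx1}"

definition half_ball :: "real \<Rightarrow> 'd::{finite,linorder} pt \<Rightarrow> 'd pt set" where
  "half_ball r y0 = ball y0 r \<inter> upper_half"

definition flat_part :: "real \<Rightarrow> 'd::{finite,linorder} pt \<Rightarrow> 'd pt set" where
  "flat_part r y0 = ball y0 r \<inter> frontier upper_half"

subsection \<open>Multi-indices, smooth functions, weak derivatives\<close>

type_synonym 'd mindex = "'d \<Rightarrow> nat"

definition mdeg :: "'d::finite mindex \<Rightarrow> nat" where
  "mdeg \<alpha> = (\<Sum>i\<in>UNIV. \<alpha> i)"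

definition partial :: "'d \<Rightarrow> ('d::finite pt \<Rightarrow> 'b::real_normed_vector) \<Rightarrow> 'd pt \<Rightarrow> 'b" where
  "partial i f x = frechet_derivative f (at x) (axis i 1)"

text \<open>
  For smooth functions the order of differentiation is immaterial; the order of the index type
  is used to fix one, the derivatives in the first coordinate being taken last.
\<close>

definition mderiv ::
  "'d::{finite,linorder} mindex \<Rightarrow> ('d pt \<Rightarrow> 'b::real_normed_vector) \<Rightarrow> 'd pt \<Rightarrow> 'b" where
  "mderiv \<alpha> f = foldr (\<lambda>i. partial i ^^ \<alpha> i) (sorted_list_of_set UNIV) f"

primrec Ck :: "nat \<Rightarrow> ('a::euclidean_space \<Rightarrow> 'b::real_normed_vector) \<Rightarrow> bool" where
  "Ck 0 f \<longleftrightarrow> continuous_on UNIV f"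
| "Ck (Suc k) f \<longleftrightarrow> (\<forall>x. f differentiable (at x)) \<and>
     (\<forall>b\<in>Basis. Ck k (\<lambda>x. frechet_derivative f (at x) b))"

definition smooth :: "('a::euclidean_space \<Rightarrow> 'b::real_normed_vector) \<Rightarrow> bool" where
  "smooth f \<longleftrightarrow> (\<forall>k. Ck k f)"

definition test_function :: "'a::euclidean_space set \<Rightarrow> ('a \<Rightarrow> real) \<Rightarrow> bool" where
  "test_function D \<psi> \<longleftrightarrow> smooth \<psi> \<and>
     compact (closure {x. \<psi> x \<noteq> 0}) \<and> closure {x. \<psi> x \<noteq> 0} \<subseteq> D"

definition loc_integrable ::
  "'a::euclidean_space set \<Rightarrow> ('a \<Rightarrow> 'b::{banach,second_countable_topology}) \<Rightarrow> bool" where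
  "loc_integrable D u \<longleftrightarrow> (\<forall>K. compact K \<and> K \<subseteq> D \<longrightarrow> integrable (lebesgue_on K) u)"

text \<open>
  Functions on \<open>D\<close> are represented by total functions; their values outside \<open>D\<close> play no role.
\<close>

definition has_weak_deriv ::
  "'d::{finite,linorder} pt set \<Rightarrow> 'd mindex \<Rightarrow>
   ('d pt \<Rightarrow> 'b::{banach,second_countable_topology}) \<Rightarrow> ('d pt \<Rightarrow> 'b) \<Rightarrow> bool" where
  "has_weak_deriv D \<alpha> u v \<longleftrightarrow> loc_integrable D u \<and> loc_integrable D v \<and>
     (\<forall>\<psi>. test_function D \<psi> \<longrightarrow>
        (LINT x|lebesgue_on D. mderiv \<alpha> \<psi> x *\<^sub>R u x) =
        (-1) ^ mdeg \<alpha> *\<^sub>R (LINT x|lebesgue_on D. \<psi> x *\<^sub>R v x))"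

text \<open>Some representative of the weak derivative, which is unique up to null sets of \<open>D\<close>.\<close>

definition wderiv ::
  "'d::{finite,linorder} pt set \<Rightarrow> 'd mindex \<Rightarrow>
   ('d pt \<Rightarrow> 'b::{banach,second_countable_topology}) \<Rightarrow> 'd pt \<Rightarrow> 'b" where
  "wderiv D \<alpha> u = (SOME v. has_weak_deriv D \<alpha> u v)"

definition in_Lp ::
  "real \<Rightarrow> 'a::euclidean_space set \<Rightarrow> ('a \<Rightarrow> 'b::{banach,second_countable_topology}) \<Rightarrow> bool" where
  "in_Lp p D f \<longleftrightarrow> f \<in> borel_measurable (lebesgue_on D) \<and>
     integrable (lebesgue_on D) (\<lambda>x. norm (f x) powr p)"

definition in_sobolev ::
  "nat \<Rightarrow> real \<Rightarrow> 'd::{finite,linorder} pt set \<Rightarrow>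
   ('d pt \<Rightarrow> 'b::{banach,second_countable_topology}) \<Rightarrow> bool" where
  "in_sobolev m p D u \<longleftrightarrow> in_Lp p D u \<and>
     (\<forall>\<alpha>. mdeg \<alpha> \<le> m \<longrightarrow> (\<exists>v. has_weak_deriv D \<alpha> u v \<and> in_Lp p D v))"

subsection \<open>Elliptic systems and the conormal derivative condition\<close>

text \<open>
  The pairing in the ellipticity condition is Hermitian, the dot product in the weak formulation
  is bilinear. The norm of a matrix is the Euclidean norm of its entries.
\<close>

definition hprod :: "complex ^ 'n::finite \<Rightarrow> complex ^ 'n \<Rightarrow> complex" where
  "hprod \<xi> \<eta> = (\<Sum>i\<in>UNIV. \<xi> $ i * cnj (\<eta> $ i))"

definition dotp :: "complex ^ 'n::finite \<Rightarrow> complex ^ 'n \<Rightarrow> complex" where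
  "dotp \<xi> \<eta> = (\<Sum>i\<in>UNIV. \<xi> $ i * \<eta> $ i)"

definition elliptic ::
  "nat \<Rightarrow> real \<Rightarrow> ('d::finite mindex \<Rightarrow> 'd mindex \<Rightarrow> complex ^ 'n::finite ^ 'n) \<Rightarrow> bool" where
  "elliptic m \<delta> A \<longleftrightarrow>
     (\<forall>\<xi> :: 'd mindex \<Rightarrow> complex ^ 'n.
        \<delta> * (\<Sum>\<alpha> | mdeg \<alpha> = m. (norm (\<xi> \<alpha>))\<^sup>2)
        \<le> (\<Sum>\<alpha> | mdeg \<alpha> = m. \<Sum>\<beta> | mdeg \<beta> = m. Re (hprod (A \<alpha> \<beta> *v \<xi> \<beta>) (\<xi> \<alpha>)))) \<and>
     (\<forall>\<alpha> \<beta>. mdeg \<alpha> = m \<and> mdeg \<beta> = m \<longrightarrow> norm (A \<alpha> \<beta>) \<le> inverse \<delta>)"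

definition vanishes_near ::
  "'a::euclidean_space set \<Rightarrow> 'a set \<Rightarrow> ('a \<Rightarrow> 'b::real_normed_vector) \<Rightarrow> bool" where
  "vanishes_near D S \<phi> \<longleftrightarrow>
     (\<exists>U. open U \<and> S \<subseteq> U \<and> (AE x in lebesgue_on (D \<inter> U). \<phi> x = 0))"

text \<open>
  The weak form of
  $(-1)^m \sum_{|\alpha| = |\beta| = m} D^\alpha (A_{\alpha\beta} D^\beta u) + \lambda u
    = \sum_{|\alpha| \le m} D^\alpha F_\alpha$ in \<open>D\<close> with the conormal derivative condition on
  \<open>\<Gamma>\<close>. The conditions on \<open>u\<close> and \<open>F\<close> make (for bounded measurable
  \<open>A\<close>) all integrands integrable, so that no integral takes its default value.
\<close>

definition conormal_solution ::
  "'d::{finite,linorder} pt set \<Rightarrow> 'd pt set \<Rightarrow> nat \<Rightarrow>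
   ('d mindex \<Rightarrow> 'd mindex \<Rightarrow> 'd pt \<Rightarrow> complex ^ 'n::finite ^ 'n) \<Rightarrow> real \<Rightarrow>
   ('d mindex \<Rightarrow> 'd pt \<Rightarrow> complex ^ 'n) \<Rightarrow> ('d pt \<Rightarrow> complex ^ 'n) \<Rightarrow> bool" where
  "conormal_solution D \<Gamma> m A lam F u \<longleftrightarrow>
     in_sobolev m 2 D u \<and> (\<forall>\<alpha>. mdeg \<alpha> \<le> m \<longrightarrow> in_Lp 2 D (F \<alpha>)) \<and>
     (\<forall>\<phi> :: 'd pt \<Rightarrow> complex ^ 'n.
        in_sobolev m 2 D \<phi> \<and> vanishes_near D (frontier D - \<Gamma>) \<phi> \<longrightarrow>
        (LINT y|lebesgue_on D.
           (\<Sum>\<alpha> | mdeg \<alpha> = m. \<Sum>\<beta> | mdeg \<beta> = m.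
              dotp (wderiv D \<alpha> \<phi> y) (A \<alpha> \<beta> y *v wderiv D \<beta> u y))
           + complex_of_real lam * dotp (\<phi> y) (u y)) =
        (\<Sum>\<alpha> | mdeg \<alpha> \<le> m.
           LINT y|lebesgue_on D. (-1) ^ mdeg \<alpha> * dotp (wderiv D \<alpha> \<phi> y) (F \<alpha> y)))"

subsection \<open>Reflected data\<close>

definition refl :: "nat \<Rightarrow> 'd::{finite,linorder} pt \<Rightarrow> 'd pt" where
  "refl k y = (\<chi> i. if i = idx1 then - real k * y $ i else y $ i)"

definition refl_coeff :: "(nat \<Rightarrow> real) \<Rightarrow> 'd::{finite,linorder} mindex \<Rightarrow> nat \<Rightarrow> real" where
  "refl_coeff c \<alpha> k = (-1) ^ \<alpha> idx1 * c k * real k powi (1 - int (\<alpha> idx1))"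

definition f_tilde ::
  "nat \<Rightarrow> (nat \<Rightarrow> real) \<Rightarrow> 'd::{finite,linorder} pt set \<Rightarrow>
   ('d mindex \<Rightarrow> 'd pt \<Rightarrow> complex ^ 'n::finite) \<Rightarrow> 'd mindex \<Rightarrow> 'd pt \<Rightarrow> complex ^ 'n" where
  "f_tilde m c S f \<alpha> y = f \<alpha> y +
     (\<Sum>k = 1..m. (refl_coeff c \<alpha> k * indicator S (refl k y)) *\<^sub>R f \<alpha> (refl k y))"

definition g_refl ::
  "nat \<Rightarrow> (nat \<Rightarrow> real) \<Rightarrow> 'd::{finite,linorder} pt set \<Rightarrow>
   ('d mindex \<Rightarrow> 'd mindex \<Rightarrow> 'd pt \<Rightarrow> complex ^ 'n::finite ^ 'n) \<Rightarrow>
   ('d mindex \<Rightarrow> 'd pt \<Rightarrow> complex ^ 'n) \<Rightarrow> 'd mindex \<Rightarrow> 'd pt \<Rightarrow> complex ^ 'n" where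
  "g_refl m c S a Du \<alpha> y = (-1) ^ (m + 1) *\<^sub>R
     (\<Sum>\<beta> | mdeg \<beta> = m. \<Sum>k = 1..m. (refl_coeff c \<alpha> k * indicator S (refl k y)) *\<^sub>R
        (a \<alpha> \<beta> (refl k y) *v Du \<beta> (refl k y)))"

definition h_refl ::
  "nat \<Rightarrow> (nat \<Rightarrow> real) \<Rightarrow> 'd::{finite,linorder} pt set \<Rightarrow>
   ('d pt \<Rightarrow> complex ^ 'n::finite) \<Rightarrow> 'd pt \<Rightarrow> complex ^ 'n" where
  "h_refl m c S u y =
     (\<Sum>k = 1..m. (real k * c k * indicator S (refl k y)) *\<^sub>R u (refl k y))"

end

theory Submission
  imports Defs
begin

text \<open>
  Let \<open>D\<close> be the half ball and \<open>G\<close> the intersection of \<open>\<Omega>\<close> with the ball. A test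
  function \<open>\<phi>\<close> for the conormal condition on \<open>D\<close> need not vanish on the hyperplane \<open>y\<^sub>1 = 0\<close>,
  so it must be extended to \<open>G\<close> before the equation of \<open>u\<close> can be tested with it. The extension
  is the higher-order reflection
  \[\Phi(y) = \phi(y)\ (y_1 > 0), \qquad \Phi(y) = \sum_{k=1}^m c_k\, \phi(-y_1/k, y')\ (y_1 < 0).\]
  The moment conditions on \<open>c\<close> make the normal derivatives of order less than \<open>m\<close> match at
  \<open>y\<^sub>1 = 0\<close>, so \<open>\<Phi>\<close> has \<open>m\<close> weak derivatives in \<open>L\<^sub>2\<close>, and below the hyperplane
  \[D^\alpha \Phi(y) = \sum_{k=1}^m c_k (-1/k)^{\alpha_1} (D^\alpha \phi)(-y_1/k, y').\]
  In the equation tested with \<open>\<Phi>\<close>, the substitution \<open>y = (- k z\<^sub>1, z')\<close>, whose Jacobian is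
  \<open>k\<close>, turns each integral over the part of \<open>G\<close> below the hyperplane into an integral over \<open>D\<close>
  against a derivative of \<open>\<phi>\<close>. The coefficient \<open>c\<^sub>k k (- 1 / k)\<^sup>a\<close> with \<open>a = \<alpha>\<^sub>1\<close>
  is \<open>c\<^sub>\<alpha>\<^sub>,\<^sub>k\<close>, and the three kinds of data that are folded in this way,
  \<open>f\<close>, \<open>a D\<^sup>\<beta> u\<close> and \<open>u\<close>, give the reflected parts of \<open>f_tilde\<close>, \<open>g_refl\<close> and \<open>h_refl\<close>
  (\<open>integral_reflect_ext_dotp\<close>). Adding the difference of the two leading coefficients on both
  sides gives the claim.

  Two points need an argument. First, \<open>\<Phi>\<close> must be admissible, that is, vanish near the sphere.
  A point \<open>y\<close> of \<open>G\<close> below the hyperplane satisfies \<open>2 y0\<^sub>1 \<le> y\<^sub>1\<close>, because its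
  reflection in the point \<open>y0\<close> lies outside \<open>\<Omega>\<close> and hence not in \<open>D\<close>
  (\<open>half_space_below_bound\<close>); therefore the points \<open>(- y\<^sub>1 / k, y')\<close> are at least as far from \<open>y0\<close>
  as \<open>y\<close> is (\<open>closer_after_reflection\<close>), and \<open>\<Phi>\<close> vanishes where \<open>\<phi>\<close> does.

  Secondly, the formula for the weak derivatives of \<open>\<Phi>\<close> across the hyperplane
  (\<open>weak_deriv_reflect_ext\<close>). It is proved by duality, without approximating \<open>\<phi>\<close> by smooth
  functions and without traces: the reflection is moved to the test function, where the moment
  conditions annihilate the normal derivatives of low order on the hyperplane, and for test functions
  with this property the hyperplane can be cut off with an error that tends to zero
  (\<open>weak_deriv_vanishing_trace\<close>). The fundamental lemma of the calculus of variations
  (\<open>fundamental_lemma\<close>) makes weak derivatives unique, so that the representatives chosen on the two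
  domains agree almost everywhere.
\<close>

section \<open>Smooth functions and cutoffs\<close>

lemma frechet_derivative_eqI:
  "(f has_derivative f') (at x) \<Longrightarrow> frechet_derivative f (at x) = f'"
  by (rule frechet_derivative_at [symmetric])

text \<open>
  Derivatives are usually computed as \<open>has_derivative\<close> facts; this is the way from them back to the
  recursive definition of \<open>Ck\<close>, and nearly all closure properties below are inductions through it.
\<close>

lemma Ck_SucI:
  assumes "\<And>x. (f has_derivative f' x) (at x)" "\<And>b. b \<in> Basis \<Longrightarrow> Ck k (\<lambda>x. f' x b)"
  shows "Ck (Suc k) f"
proof -
  have "frechet_derivative f (at x) = f' x" for x
    using assms(1) by (rule frechet_derivative_eqI)
  then show ?thesis
    using assms by (auto simp: differentiable_def)
qed

lemma Ck_SucD:
  "Ck (Suc k) f \<Longrightarrow> Ck k f"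
proof (induction k arbitrary: f)
  case 0
  then show ?case
    by (auto intro!: differentiable_imp_continuous_on simp: differentiable_on_def differentiable_at_withinI)
next
  case (Suc k)
  then show ?case by auto
qed

lemma Ck_has_derivative:
  "Ck (Suc k) f \<Longrightarrow> (f has_derivative frechet_derivative f (at x)) (at x)"
  by (simp add: frechet_derivative_works [symmetric])

lemma Ck_const: "Ck k (\<lambda>x. c)"
  by (induction k arbitrary: c) (auto intro!: continuous_intros simp: frechet_derivative_const)

lemma Ck_add:
  "Ck k f \<Longrightarrow> Ck k g \<Longrightarrow> Ck k (\<lambda>x. f x + g x)"
proof (induction k arbitrary: f g)
  case 0
  then show ?case by (auto intro!: continuous_intros)
next
  case (Suc k)
  show ?case
  proof (rule Ck_SucI)
    show "((\<lambda>x. f x + g x) has_derivative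
        (\<lambda>h. frechet_derivative f (at x) h + frechet_derivative g (at x) h)) (at x)" for x
      using Suc.prems Ck_has_derivative by (intro has_derivative_add) auto
  qed (use Suc in auto)
qed

lemma Ck_mult:
  fixes f g :: "'a::euclidean_space \<Rightarrow> real"
  shows "Ck k f \<Longrightarrow> Ck k g \<Longrightarrow> Ck k (\<lambda>x. f x * g x)"
proof (induction k arbitrary: f g)
  case 0
  then show ?case by (auto intro!: continuous_intros)
next
  case (Suc k)
  show ?case
  proof (rule Ck_SucI)
    show "((\<lambda>x. f x * g x) has_derivative
        (\<lambda>h. f x * frechet_derivative g (at x) h + frechet_derivative f (at x) h * g x)) (at x)" for x
      using Suc.prems Ck_has_derivative by (intro has_derivative_mult) auto
    show "Ck k (\<lambda>x. f x * frechet_derivative g (at x) b + frechet_derivative f (at x) b * g x)"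
      if "b \<in> Basis" for b
      using Suc.prems that Ck_SucD[OF Suc.prems(1)] Ck_SucD[OF Suc.prems(2)]
      by (intro Ck_add Suc.IH) auto
  qed
qed

lemma Ck_sum:
  "(\<And>i. i \<in> A \<Longrightarrow> Ck k (f i)) \<Longrightarrow> Ck k (\<lambda>x. \<Sum>i\<in>A. f i x)"
  by (induction A rule: infinite_finite_induct) (auto intro: Ck_const Ck_add)

lemma Ck_prod:
  fixes f :: "'i \<Rightarrow> 'a::euclidean_space \<Rightarrow> real"
  shows "(\<And>i. i \<in> A \<Longrightarrow> Ck k (f i)) \<Longrightarrow> Ck k (\<lambda>x. \<Prod>i\<in>A. f i x)"
  by (induction A rule: infinite_finite_induct) (auto intro: Ck_const Ck_mult)

text \<open>
  The derivative \<open>- f' / f\<^sup>2\<close> is a product of a \<open>C\<^sup>k\<close> function and of two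
  copies of \<open>1 / f\<close>, which are \<open>C\<^sup>k\<close> by the induction hypothesis.
\<close>

lemma Ck_inverse:
  fixes f :: "'a::euclidean_space \<Rightarrow> real"
  assumes nz: "\<And>x. f x \<noteq> 0"
  shows "Ck k f \<Longrightarrow> Ck k (\<lambda>x. inverse (f x))"
proof (induction k)
  case 0
  then show ?case using nz by (auto intro!: continuous_intros)
next
  case (Suc k)
  show ?case
  proof (rule Ck_SucI)
    show "((\<lambda>x. inverse (f x)) has_derivative
        (\<lambda>h. (- 1) * (inverse (f x) * frechet_derivative f (at x) h * inverse (f x)))) (at x)" for x
      using Deriv.has_derivative_inverse[OF nz Ck_has_derivative[OF Suc.prems]]
      by simp
    show "Ck k (\<lambda>x. (- 1) * (inverse (f x) * frechet_derivative f (at x) b * inverse (f x)))"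
      if "b \<in> Basis" for b
      using Suc.prems that Ck_SucD[OF Suc.prems(1)] Suc.IH
      by (intro Ck_mult Ck_const) auto
  qed
qed

text \<open>
  The chain rule is written in coordinates, because \<open>Ck\<close> speaks only of derivatives in the
  basis directions: a basis vector is not mapped to a basis vector by the derivative of \<open>T\<close>.
\<close>

lemma Ck_compose:
  fixes f :: "'b::euclidean_space \<Rightarrow> real" and T :: "'a::euclidean_space \<Rightarrow> 'b"
  shows "Ck k f \<Longrightarrow> (\<And>b. b \<in> Basis \<Longrightarrow> Ck k (\<lambda>x. T x \<bullet> b)) \<Longrightarrow> Ck k (\<lambda>x. f (T x))"
proof (induction k arbitrary: f)
  case 0
  have "continuous_on UNIV T"
    using 0(2) by (subst continuous_on_componentwise) auto
  then show ?case
    using 0(1) continuous_on_compose2[of UNIV f UNIV T] by auto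
next
  case (Suc k)
  define T' where "T' x h = (\<Sum>b\<in>Basis. frechet_derivative (\<lambda>x. T x \<bullet> b) (at x) h *\<^sub>R b)" for x h
  have T': "(T has_derivative T' x) (at x)" for x
  proof -
    have "((\<lambda>x. \<Sum>b\<in>Basis. (T x \<bullet> b) *\<^sub>R b) has_derivative T' x) (at x)"
      unfolding T'_def
      by (intro has_derivative_sum has_derivative_scaleR_left Ck_has_derivative[of k] Suc.prems(2))
    then show ?thesis by (simp add: euclidean_representation)
  qed
  show ?case
  proof (rule Ck_SucI)
    fix x
    have lin: "linear (frechet_derivative f (at (T x)))"
      using Ck_has_derivative[OF Suc.prems(1)] has_derivative_linear by blast
    have "((\<lambda>x. f (T x)) has_derivative (\<lambda>h. frechet_derivative f (at (T x)) (T' x h))) (at x)"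
      using Ck_has_derivative[OF Suc.prems(1)] T' by (rule has_derivative_compose[rotated])
    also have "(\<lambda>h. frechet_derivative f (at (T x)) (T' x h)) =
      (\<lambda>h. \<Sum>b\<in>Basis. frechet_derivative (\<lambda>x. T x \<bullet> b) (at x) h *
            frechet_derivative f (at (T x)) b)"
      unfolding T'_def by (simp add: linear_sum[OF lin] linear_scale[OF lin])
    finally show "((\<lambda>x. f (T x)) has_derivative
       (\<lambda>h. \<Sum>b\<in>Basis. frechet_derivative (\<lambda>x. T x \<bullet> b) (at x) h *
            frechet_derivative f (at (T x)) b)) (at x)" .
  next
    fix b :: 'a assume b: "b \<in> Basis"
    show "Ck k (\<lambda>x. \<Sum>b'\<in>Basis. frechet_derivative (\<lambda>x. T x \<bullet> b') (at x) b *
            frechet_derivative f (at (T x)) b')"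
    proof (intro Ck_sum Ck_mult)
      fix b' :: 'b assume b': "b' \<in> Basis"
      show "Ck k (\<lambda>x. frechet_derivative (\<lambda>x. T x \<bullet> b') (at x) b)"
        using Suc.prems(2)[OF b'] b by auto
      show "Ck k (\<lambda>x. frechet_derivative f (at (T x)) b')"
        by (rule Suc.IH) (use Suc.prems(1) b' in simp, rule Ck_SucD[OF Suc.prems(2)])
    qed
  qed
qed

lemma Ck_inner: "Ck k (\<lambda>x. x \<bullet> v)"
proof (cases k)
  case (Suc n)
  show ?thesis unfolding Suc
    by (rule Ck_SucI[where f' = "\<lambda>_ h. h \<bullet> v"])
       (auto intro!: Ck_const has_derivative_inner_left has_derivative_ident)
qed (auto intro!: continuous_intros)

lemma smooth_const: "smooth (\<lambda>x. c)"
  and smooth_add: "smooth f \<Longrightarrow> smooth g \<Longrightarrow> smooth (\<lambda>x. f x + g x)"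
  and smooth_sum: "(\<And>i. i \<in> A \<Longrightarrow> smooth (h i)) \<Longrightarrow> smooth (\<lambda>x. \<Sum>i\<in>A. h i x)"
  and smooth_inner: "smooth (\<lambda>x. x \<bullet> v)"
  by (simp_all add: smooth_def Ck_const Ck_add Ck_sum Ck_inner)

lemma smooth_mult: "smooth f \<Longrightarrow> smooth g \<Longrightarrow> smooth (\<lambda>x. f x * g x :: real)"
  and smooth_prod: "(\<And>i. i \<in> A \<Longrightarrow> smooth (h i)) \<Longrightarrow> smooth (\<lambda>x. \<Prod>i\<in>A. h i x :: real)"
  and smooth_inverse: "smooth f \<Longrightarrow> (\<And>x. f x \<noteq> 0) \<Longrightarrow> smooth (\<lambda>x. inverse (f x))"
  and smooth_compose: "smooth p \<Longrightarrow> (\<And>b. b \<in> Basis \<Longrightarrow> smooth (\<lambda>x. T x \<bullet> b)) \<Longrightarrow> smooth (\<lambda>x. p (T x) :: real)"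
  by (simp_all add: smooth_def Ck_mult Ck_prod Ck_inverse Ck_compose)

lemma smooth_real_compose:
  fixes p :: "real \<Rightarrow> real"
  shows "smooth p \<Longrightarrow> smooth f \<Longrightarrow> smooth (\<lambda>x. p (f x))"
  by (rule smooth_compose) auto

lemma smooth_nth: "smooth (\<lambda>x :: real ^ 'd. x $ i)"
  using smooth_inner[of "axis i (1::real)"] by (simp add: inner_axis)

lemma smooth_has_derivative:
  "smooth f \<Longrightarrow> (f has_derivative frechet_derivative f (at x)) (at x)"
  using Ck_has_derivative[of 0 f] unfolding smooth_def by blast

lemma smooth_continuous_on: "smooth f \<Longrightarrow> continuous_on S f"
  using continuous_on_subset unfolding smooth_def by (metis Ck.simps(1) subset_UNIV)

lemma smooth_frechet_derivative:
  "smooth f \<Longrightarrow> b \<in> Basis \<Longrightarrow> smooth (\<lambda>x. frechet_derivative f (at x) b)"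
  unfolding smooth_def by (metis Ck.simps(2))

text \<open>
  The family \<open>x\<^sup>-\<^sup>n exp (- 1 / x)\<close> on \<open>x > 0\<close>, extended by zero. All \<open>n\<close> are taken together
  since the derivative of one member is a combination of two later ones, which makes smoothness
  an induction on the order.
\<close>

definition flat_exp :: "nat \<Rightarrow> real \<Rightarrow> real" where
  "flat_exp n x = (if x \<le> 0 then 0 else inverse x ^ n * exp (- inverse x))"

lemma flat_exp_has_derivative:
  "(flat_exp n has_real_derivative - real n * flat_exp (Suc n) x + flat_exp (n + 2) x) (at x)"
proof -
  consider "x < 0" | "x = 0" | "x > 0" by linarith
  then show ?thesis
  proof cases
    case 1
    have "((\<lambda>_. 0) has_real_derivative 0) (at x)" by simp
    then have "(flat_exp n has_real_derivative 0) (at x)"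
      by (rule has_field_derivative_transform_within_open[of _ _ _ "{..<0}"])
         (use 1 in \<open>auto simp: flat_exp_def\<close>)
    then show ?thesis using 1 by (simp add: flat_exp_def)
  next
    case 3
    have "((\<lambda>x. inverse x ^ n * exp (- inverse x)) has_real_derivative
        - real n * flat_exp (Suc n) x + flat_exp (n + 2) x) (at x)"
      using 3
      by (auto intro!: derivative_eq_intros simp: flat_exp_def algebra_simps power2_eq_square)
         (cases n; simp add: field_simps)
    then show ?thesis
      by (rule has_field_derivative_transform_within_open[of _ _ _ "{0<..}"])
         (use 3 in \<open>auto simp: flat_exp_def\<close>)
  next
    case 2
    have *: "((\<lambda>t :: real. t ^ Suc n / exp t) \<longlongrightarrow> 0) at_top"
      by (rule tendsto_power_div_exp_0)
    have "((\<lambda>h :: real. inverse h ^ Suc n / exp (inverse h)) \<longlongrightarrow> 0) (at_right 0)"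
      using filterlim_compose[OF * filterlim_inverse_at_top_right] by simp
    then have r: "((\<lambda>h. flat_exp n h / h) \<longlongrightarrow> 0) (at_right 0)"
      by (rule Lim_transform_eventually)
         (auto simp: eventually_at_filter flat_exp_def exp_minus field_simps)
    have "((\<lambda>_. 0 :: real) \<longlongrightarrow> 0) (at_left 0)" by simp
    then have l: "((\<lambda>h. flat_exp n h / h) \<longlongrightarrow> 0) (at_left 0)"
      by (rule Lim_transform_eventually)
         (auto simp: eventually_at_filter flat_exp_def)
    from l r have "((\<lambda>h. flat_exp n h / h) \<longlongrightarrow> 0) (at 0)"
      by (simp add: filterlim_split_at_real)
    then have "(flat_exp n has_real_derivative 0) (at 0)"
      by (simp add: DERIV_def flat_exp_def)
    then show ?thesis using 2 by (simp add: flat_exp_def)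
  qed
qed

lemma smooth_flat_exp: "smooth (flat_exp n)"
proof -
  have "Ck k (flat_exp n)" for k
  proof (induction k arbitrary: n)
    case 0
    show ?case
      using DERIV_continuous_on[OF DERIV_subset[OF flat_exp_has_derivative]] by simp
  next
    case (Suc k)
    show ?case
    proof (rule Ck_SucI)
      show "(flat_exp n has_derivative
          (\<lambda>h. (- real n * flat_exp (Suc n) x + flat_exp (n + 2) x) * h)) (at x)" for x
        using flat_exp_has_derivative[of n x] by (simp add: has_field_derivative_def)
    qed (intro Ck_add Ck_mult Ck_const Suc)
  qed
  then show ?thesis by (simp add: smooth_def)
qed

text \<open>
  The standard smooth transition from \<open>0\<close> (on \<open>t \<le> 0\<close>) to \<open>1\<close> (on \<open>t \<ge> 1\<close>), from which all
  cutoff functions of this theory are made.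
\<close>

definition smooth_step :: "real \<Rightarrow> real" where
  "smooth_step t = flat_exp 0 t * inverse (flat_exp 0 t + flat_exp 0 (1 - t))"

lemma smooth_step_denom_pos: "flat_exp 0 t + flat_exp 0 (1 - t) > 0"
  by (auto simp: flat_exp_def add_pos_pos)

lemma smooth_smooth_step: "smooth smooth_step"
proof -
  have "smooth (\<lambda>t. t :: real)" using smooth_inner[of "1::real"] by simp
  then have "smooth (\<lambda>t. 1 + (- 1) * t :: real)"
    by (intro smooth_add smooth_const smooth_mult)
  then have "smooth (\<lambda>t. flat_exp 0 (1 - t))"
    using smooth_real_compose[OF smooth_flat_exp[of 0]] by simp
  moreover have "flat_exp 0 t + flat_exp 0 (1 - t) \<noteq> 0" for t
    using smooth_step_denom_pos[of t] by simp
  ultimately have "smooth (\<lambda>t. flat_exp 0 t * inverse (flat_exp 0 t + flat_exp 0 (1 - t)))"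
    by (intro smooth_mult smooth_inverse smooth_add smooth_flat_exp)
  then show ?thesis unfolding smooth_step_def .
qed

lemma smooth_step_0: "t \<le> 0 \<Longrightarrow> smooth_step t = 0"
  and smooth_step_1: "t \<ge> 1 \<Longrightarrow> smooth_step t = 1"
  by (auto simp: smooth_step_def flat_exp_def)

lemma smooth_step_range: "0 \<le> smooth_step t" "smooth_step t \<le> 1"
proof -
  have "0 \<le> flat_exp 0 t" "0 \<le> flat_exp 0 (1 - t)" by (auto simp: flat_exp_def)
  then show "0 \<le> smooth_step t" "smooth_step t \<le> 1"
    using smooth_step_denom_pos[of t] by (auto simp: smooth_step_def divide_inverse[symmetric])
qed

section \<open>Multi-index derivatives and stretchings of the first coordinate\<close>

lemma partial_eqI: "(f has_derivative f') (at x) \<Longrightarrow> partial i f x = f' (axis i 1)"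
  by (simp add: partial_def frechet_derivative_eqI)

lemma smooth_partial:
  fixes f :: "'d::finite pt \<Rightarrow> 'b::real_normed_vector"
  shows "smooth f \<Longrightarrow> smooth (partial i f)"
  unfolding partial_def[abs_def] by (rule smooth_frechet_derivative) (auto simp: axis_in_Basis_iff)

lemma smooth_funpow_partial:
  fixes f :: "'d::finite pt \<Rightarrow> 'b::real_normed_vector"
  shows "smooth f \<Longrightarrow> smooth ((partial i ^^ n) f)"
  by (induction n) (auto intro: smooth_partial)

lemma partial_sum:
  fixes F :: "'k \<Rightarrow> 'd::finite pt \<Rightarrow> real"
  assumes "\<And>k. k \<in> A \<Longrightarrow> smooth (F k)"
  shows "partial i (\<lambda>x. \<Sum>k\<in>A. c k * F k x) = (\<lambda>x. \<Sum>k\<in>A. c k * partial i (F k) x)"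
proof
  fix x
  have "((\<lambda>x. \<Sum>k\<in>A. c k * F k x) has_derivative
      (\<lambda>h. \<Sum>k\<in>A. c k * frechet_derivative (F k) (at x) h)) (at x)"
    using assms by (intro has_derivative_sum has_derivative_mult_right smooth_has_derivative)
  from partial_eqI[OF this] show
    "partial i (\<lambda>x. \<Sum>k\<in>A. c k * F k x) x = (\<Sum>k\<in>A. c k * partial i (F k) x)"
    by (simp add: partial_def)
qed

lemma partial_mult:
  fixes f g :: "'d::finite pt \<Rightarrow> real"
  assumes "smooth f" "smooth g"
  shows "partial i (\<lambda>x. f x * g x) = (\<lambda>x. f x * partial i g x + partial i f x * g x)"
proof
  fix x
  show "partial i (\<lambda>x. f x * g x) x = f x * partial i g x + partial i f x * g x"
    using partial_eqI[OF has_derivative_mult[OF smooth_has_derivative[OF assms(1)]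
        smooth_has_derivative[OF assms(2)]]] by (simp add: partial_def)
qed

lemma partial_cong_open:
  assumes "open S" "\<And>x. x \<in> S \<Longrightarrow> f x = g x" "x \<in> S"
  shows "partial i f x = partial i g x"
proof -
  have "(f has_derivative f') (at x) \<longleftrightarrow> (g has_derivative f') (at x)" for f'
    using assms has_derivative_transform_within_open[of f f' x UNIV S g]
      has_derivative_transform_within_open[of g f' x UNIV S f] by auto
  then show ?thesis unfolding partial_def frechet_derivative_def by simp
qed

lemma funpow_partial_sum:
  fixes F :: "'k \<Rightarrow> 'd::finite pt \<Rightarrow> real"
  assumes "\<And>k. k \<in> A \<Longrightarrow> smooth (F k)"
  shows "(partial i ^^ n) (\<lambda>x. \<Sum>k\<in>A. c k * F k x) = (\<lambda>x. \<Sum>k\<in>A. c k * (partial i ^^ n) (F k) x)"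
proof (induction n)
  case (Suc n)
  then show ?case
    using partial_sum[of A "\<lambda>k. (partial i ^^ n) (F k)" i c] assms
    by (simp add: smooth_funpow_partial)
qed simp

lemma funpow_partial_cong_open:
  assumes "open S" "\<And>x. x \<in> S \<Longrightarrow> f x = g x" "x \<in> S"
  shows "(partial i ^^ n) f x = (partial i ^^ n) g x"
  using assms(3)
  by (induction n arbitrary: x) (auto simp: assms(2) intro: partial_cong_open[OF assms(1)])

text \<open>
  \<open>mderiv\<close> over an arbitrary list of directions, so that its properties can be proved by
  induction on the list.
\<close>

definition iter_partial ::
  "'d mindex \<Rightarrow> 'd list \<Rightarrow> ('d::finite pt \<Rightarrow> 'b::real_normed_vector) \<Rightarrow> 'd pt \<Rightarrow> 'b" where
  "iter_partial \<alpha> is f = foldr (\<lambda>i. partial i ^^ \<alpha> i) is f"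

lemma iter_partial_simps [simp]:
  "iter_partial \<alpha> [] f = f"
  "iter_partial \<alpha> (i # is) f = (partial i ^^ \<alpha> i) (iter_partial \<alpha> is f)"
  by (simp_all add: iter_partial_def)

lemma mderiv_eq_iter_partial: "mderiv \<alpha> f = iter_partial \<alpha> (sorted_list_of_set UNIV) f"
  by (simp add: mderiv_def iter_partial_def)

definition tangential :: "'d::{finite,linorder} list" where
  "tangential = sorted_list_of_set (UNIV - {idx1})"

lemma idx1_notin_tangential: "idx1 \<notin> set tangential"
  by (simp add: tangential_def)

text \<open>
  The derivatives in the direction of \<open>y\<^sub>1\<close> are taken last. Hence a function of \<open>y\<^sub>1\<close> alone
  passes through all the earlier ones.
\<close>

lemma mderiv_split:
  fixes f :: "'d::{finite,linorder} pt \<Rightarrow> 'b::real_normed_vector"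
  shows "mderiv \<alpha> f = (partial idx1 ^^ \<alpha> idx1) (iter_partial \<alpha> tangential f)"
proof -
  have "sorted_list_of_set (UNIV :: 'd set) = idx1 # tangential"
    unfolding tangential_def idx1_def
    by (rule sorted_list_of_set_nonempty) auto
  then show ?thesis by (simp add: mderiv_eq_iter_partial)
qed

lemma iter_partial_cong_index:
  "(\<And>i. i \<in> set is \<Longrightarrow> \<alpha> i = \<beta> i) \<Longrightarrow> iter_partial \<alpha> is f = iter_partial \<beta> is f"
  by (induction "is") auto

lemma mderiv_upd_idx1:
  "mderiv (\<alpha>(idx1 := n)) f = (partial idx1 ^^ n) (iter_partial \<alpha> tangential f)"
proof -
  have "iter_partial (\<alpha>(idx1 := n)) tangential f = iter_partial \<alpha> tangential f"
    by (rule iter_partial_cong_index) (use idx1_notin_tangential in auto)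
  then show ?thesis by (simp add: mderiv_split)
qed

lemma smooth_iter_partial:
  "smooth f \<Longrightarrow> smooth (iter_partial \<alpha> is f)"
  by (induction "is") (auto intro: smooth_funpow_partial)

lemma iter_partial_sum:
  fixes F :: "'k \<Rightarrow> 'd::finite pt \<Rightarrow> real"
  assumes "\<And>k. k \<in> A \<Longrightarrow> smooth (F k)"
  shows "iter_partial \<alpha> is (\<lambda>x. \<Sum>k\<in>A. c k * F k x) =
    (\<lambda>x. \<Sum>k\<in>A. c k * iter_partial \<alpha> is (F k) x)"
  by (induction "is") (auto simp: funpow_partial_sum smooth_iter_partial assms)

lemma iter_partial_cong_open:
  assumes "open S" "\<And>x. x \<in> S \<Longrightarrow> f x = g x" "x \<in> S"
  shows "iter_partial \<alpha> is f x = iter_partial \<alpha> is g x"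
  using assms(3)
  by (induction "is" arbitrary: x) (auto simp: assms(2) intro: funpow_partial_cong_open[OF assms(1)])

lemma smooth_mderiv: "smooth f \<Longrightarrow> smooth (mderiv \<alpha> f)"
  by (simp add: mderiv_eq_iter_partial smooth_iter_partial)

lemma mderiv_cong_open:
  assumes "open S" "\<And>x. x \<in> S \<Longrightarrow> f x = g x" "x \<in> S"
  shows "mderiv \<alpha> f x = mderiv \<alpha> g x"
  unfolding mderiv_eq_iter_partial by (rule iter_partial_cong_open[OF assms])

lemma mderiv_sum:
  fixes F :: "'k \<Rightarrow> 'd::{finite,linorder} pt \<Rightarrow> real"
  assumes "\<And>k. k \<in> A \<Longrightarrow> smooth (F k)"
  shows "mderiv \<alpha> (\<lambda>x. \<Sum>k\<in>A. c k * F k x) = (\<lambda>x. \<Sum>k\<in>A. c k * mderiv \<alpha> (F k) x)"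
  by (simp add: mderiv_eq_iter_partial iter_partial_sum assms)

lemma mderiv_eq_0_outside:
  fixes f :: "'d::{finite,linorder} pt \<Rightarrow> real"
  assumes "x \<notin> closure {x. f x \<noteq> 0}"
  shows "mderiv \<alpha> f x = 0"
proof -
  have "mderiv \<alpha> f x = mderiv \<alpha> (\<lambda>_. 0) x"
    by (rule mderiv_cong_open[of "- closure {x. f x \<noteq> 0}"])
       (use assms closure_subset[of "{x. f x \<noteq> 0}"] in auto)
  also have "\<dots> = 0"
    using mderiv_sum[of "{}" "\<lambda>_ _. 0" \<alpha> "\<lambda>_. 0"] by simp
  finally show ?thesis .
qed

lemma mderiv_zero_index: "mdeg \<alpha> = 0 \<Longrightarrow> mderiv \<alpha> f = f"
proof -
  assume "mdeg \<alpha> = 0"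
  then have "\<alpha> = (\<lambda>_. 0)" by (auto simp: mdeg_def)
  moreover have "iter_partial (\<lambda>_. 0) is f = f" for "is"
    by (induction "is") auto
  ultimately show ?thesis by (simp add: mderiv_eq_iter_partial)
qed

lemma bounded_if_compact_support:
  fixes f :: "'a::euclidean_space \<Rightarrow> real"
  assumes "continuous_on UNIV f" "compact K" "\<And>x. x \<notin> K \<Longrightarrow> f x = 0"
  obtains B where "0 \<le> B" "\<And>x. \<bar>f x\<bar> \<le> B"
proof -
  have "compact (f ` K)"
    using assms continuous_on_subset compact_continuous_image by blast
  then obtain B where B: "\<And>y. y \<in> f ` K \<Longrightarrow> norm y \<le> B"
    using compact_imp_bounded bounded_iff by metis
  have "\<bar>f x\<bar> \<le> max 0 B" for x
    using B[of "f x"] assms(3)[of x] by (cases "x \<in> K") auto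
  then show ?thesis using that[of "max 0 B"] by auto
qed

lemma mderiv_bounded:
  fixes f :: "'d::{finite,linorder} pt \<Rightarrow> real"
  assumes "smooth f" "compact (closure {x. f x \<noteq> 0})"
  obtains B where "0 \<le> B" "\<And>x. \<bar>mderiv \<alpha> f x\<bar> \<le> B"
  using bounded_if_compact_support[OF smooth_continuous_on[OF smooth_mderiv[OF assms(1)]] assms(2)]
    mderiv_eq_0_outside by metis

text \<open>
  The reflections \<open>refl k\<close> and their inverses, which are the stretchings by \<open>- k\<close> and by
  \<open>- 1 / k\<close>, together with the identity, form one family.
\<close>

definition stretch :: "real \<Rightarrow> 'd::{finite,linorder} pt \<Rightarrow> 'd pt" where
  "stretch s y = (\<chi> i. if i = idx1 then s * y $ i else y $ i)"

lemma refl_eq_stretch: "refl k = stretch (- real k)"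
  by (simp add: fun_eq_iff refl_def stretch_def vec_eq_iff)

lemma stretch_nth: "stretch s y $ i = (if i = idx1 then s * y $ i else y $ i)"
  by (simp add: stretch_def)

lemma stretch_stretch: "stretch s (stretch t y) = stretch (s * t) y"
  by (simp add: vec_eq_iff stretch_nth)

lemma stretch_one: "stretch 1 y = y"
  by (simp add: vec_eq_iff stretch_nth)

lemma linear_stretch: "linear (stretch s)"
  by (rule linearI) (simp_all add: vec_eq_iff stretch_nth algebra_simps)

lemma has_derivative_stretch: "(stretch s has_derivative stretch s) (at x)"
  using linear_stretch linear_linear bounded_linear_imp_has_derivative by blast

lemma smooth_stretch:
  fixes f :: "'d::{finite,linorder} pt \<Rightarrow> real"
  assumes "smooth f"
  shows "smooth (\<lambda>x. f (stretch s x))"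
proof (rule smooth_compose[OF assms])
  fix b :: "'d pt" assume "b \<in> Basis"
  then obtain i where b: "b = axis i 1" by (auto simp: Basis_vec_def)
  show "smooth (\<lambda>x. stretch s x \<bullet> b)"
    using smooth_mult[OF smooth_const[of s] smooth_nth[of i]] smooth_nth[of i]
    by (cases "i = idx1") (simp_all add: b inner_axis stretch_nth)
qed

lemma partial_stretch:
  fixes f :: "'d::{finite,linorder} pt \<Rightarrow> real"
  assumes "smooth f"
  shows "partial i (\<lambda>x. f (stretch s x)) =
    (\<lambda>x. (if i = idx1 then s else 1) * partial i f (stretch s x))"
proof
  fix x
  have "((\<lambda>x. f (stretch s x)) has_derivative
      (\<lambda>h. frechet_derivative f (at (stretch s x)) (stretch s h))) (at x)"
    by (rule has_derivative_compose[OF has_derivative_stretch smooth_has_derivative[OF assms]])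
  from partial_eqI[OF this, of i]
  have "partial i (\<lambda>x. f (stretch s x)) x =
      frechet_derivative f (at (stretch s x)) (stretch s (axis i 1))" .
  moreover have "stretch s (axis i 1) = (if i = idx1 then s else 1) *\<^sub>R (axis i 1 :: 'd pt)"
    by (auto simp: vec_eq_iff stretch_nth axis_def)
  moreover have "linear (frechet_derivative f (at (stretch s x)))"
    using smooth_has_derivative[OF assms] has_derivative_linear by blast
  ultimately show "partial i (\<lambda>x. f (stretch s x)) x =
      (if i = idx1 then s else 1) * partial i f (stretch s x)"
    by (simp add: partial_def linear_scale)
qed

lemma partial_cmult:
  fixes f :: "'d::finite pt \<Rightarrow> real"
  shows "smooth f \<Longrightarrow> partial i (\<lambda>x. c * f x) = (\<lambda>x. c * partial i f x)"
  using partial_sum[of "{()}" "\<lambda>_. f" i "\<lambda>_. c"] by simp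

lemma funpow_partial_stretch:
  fixes f :: "'d::{finite,linorder} pt \<Rightarrow> real"
  assumes "smooth f"
  shows "(partial i ^^ n) (\<lambda>x. f (stretch s x)) =
    (\<lambda>x. (if i = idx1 then s else 1) ^ n * (partial i ^^ n) f (stretch s x))"
proof (induction n)
  case (Suc n)
  have sm: "smooth ((partial i ^^ n) f)" by (rule smooth_funpow_partial[OF assms])
  show ?case
    using partial_cmult[OF smooth_stretch[OF sm], of i _ s] partial_stretch[OF sm, of i s]
    by (auto simp: Suc mult_ac)
qed simp

text \<open>
  Each of the \<open>\<alpha>\<^sub>1\<close> normal derivatives gives a factor \<open>s\<close>, the tangential ones give none.
\<close>

lemma mderiv_stretch:
  fixes f :: "'d::{finite,linorder} pt \<Rightarrow> real"
  assumes "smooth f"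
  shows "mderiv \<alpha> (\<lambda>x. f (stretch s x)) = (\<lambda>x. s ^ \<alpha> idx1 * mderiv \<alpha> f (stretch s x))"
proof -
  have "iter_partial \<alpha> is (\<lambda>x. f (stretch s x)) = (\<lambda>x. iter_partial \<alpha> is f (stretch s x))"
    if "idx1 \<notin> set is" for "is"
    using that
    by (induction "is") (auto simp: funpow_partial_stretch smooth_iter_partial assms)
  from this[OF idx1_notin_tangential] show ?thesis
    by (simp add: mderiv_split funpow_partial_stretch smooth_iter_partial assms)
qed

section \<open>Cutoffs near the hyperplane\<close>

lemma smooth_deriv:
  fixes \<eta> :: "real \<Rightarrow> real"
  assumes "smooth \<eta>"
  shows "smooth (deriv \<eta>)" and "(\<eta> has_real_derivative deriv \<eta> t) (at t)"
proof -
  have d: "(\<eta> has_real_derivative frechet_derivative \<eta> (at t) 1) (at t)" for t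
  proof -
    have h: "(\<eta> has_derivative frechet_derivative \<eta> (at t)) (at t)"
      by (rule smooth_has_derivative[OF assms])
    have "(*) (frechet_derivative \<eta> (at t) 1) = frechet_derivative \<eta> (at t)"
    proof
      fix k :: real
      have "frechet_derivative \<eta> (at t) (k *\<^sub>R 1) = k *\<^sub>R frechet_derivative \<eta> (at t) 1"
        by (rule linear_scale[OF has_derivative_linear[OF h]])
      then show "frechet_derivative \<eta> (at t) 1 * k = frechet_derivative \<eta> (at t) k"
        by (simp only: real_scaleR_def mult_1_right mult.commute[of _ k])
    qed
    then show ?thesis
      unfolding has_field_derivative_def using h by (simp only:)
  qed
  then have "deriv \<eta> = (\<lambda>t. frechet_derivative \<eta> (at t) 1)"
    by (auto intro: DERIV_imp_deriv)
  with d smooth_frechet_derivative[OF assms, of 1]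
  show "smooth (deriv \<eta>)" "(\<eta> has_real_derivative deriv \<eta> t) (at t)" by auto
qed

lemma smooth_scaled_nth:
  fixes \<eta> :: "real \<Rightarrow> real"
  shows "smooth \<eta> \<Longrightarrow> smooth (\<lambda>y :: real ^ 'd::finite. \<eta> (y $ i / r))"
  using smooth_real_compose[of \<eta> "\<lambda>y :: real ^ 'd. (1 / r) * y $ i"]
    smooth_mult[OF smooth_const[of "1 / r"] smooth_nth[of i]]
  by simp

lemma partial_scaled_nth:
  fixes \<eta> :: "real \<Rightarrow> real"
  assumes "smooth \<eta>"
  shows "partial j (\<lambda>y :: 'd::finite pt. \<eta> (y $ i / r)) =
    (\<lambda>y. if j = i then inverse r * deriv \<eta> (y $ i / r) else 0)"
proof
  fix y :: "'d pt"
  have "((\<lambda>y :: 'd pt. y $ i / r) has_derivative (\<lambda>h. h $ i / r)) (at y)"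

    by (intro bounded_linear_imp_has_derivative bounded_linear_compose[OF bounded_linear_divide]
        bounded_linear_vec_nth)
  from has_derivative_compose[OF this smooth_deriv(2)[OF assms, unfolded has_field_derivative_def]]
  have "((\<lambda>y :: 'd pt. \<eta> (y $ i / r)) has_derivative
      (\<lambda>h. deriv \<eta> (y $ i / r) * (h $ i / r))) (at y)" .
  from partial_eqI[OF this, of j] show "partial j (\<lambda>y. \<eta> (y $ i / r)) y =
      (if j = i then inverse r * deriv \<eta> (y $ i / r) else 0)"
    by (auto simp: axis_def field_simps)
qed

text \<open>
  A cutoff \<open>\<eta> (y\<^sub>1 / r)\<close> loses a factor \<open>1 / r\<close> with each normal derivative that falls on
  it. If the \<open>j\<close>-th normal derivative of \<open>H\<close> is of size \<open>r\<^sup>n\<^sup>-\<^sup>j\<close> in the strip, the loss is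
  compensated and the \<open>n\<close>-th derivative of the product is bounded uniformly in \<open>r\<close>. The
  induction runs over all cutoffs at once: one derivative of \<open>\<eta> (y\<^sub>1 / r) H\<close> gives
  \<open>\<eta> (y\<^sub>1 / r) \<partial>\<^sub>1 H\<close> and \<open>\<eta>' (y\<^sub>1 / r) (H / r)\<close>, and both factors \<open>\<partial>\<^sub>1 H\<close> and
  \<open>H / r\<close> satisfy the hypothesis for \<open>n - 1\<close>.
\<close>

lemma normal_derivative_cutoff_bound:
  fixes \<eta> :: "real \<Rightarrow> real"
  assumes "smooth \<eta>"
  shows "\<exists>M\<ge>0. \<forall>r C (H :: 'd::{finite,linorder} pt \<Rightarrow> real). 0 < r \<longrightarrow> smooth H \<longrightarrow>
    (\<forall>j\<le>n. \<forall>y. 0 \<le> y $ idx1 \<and> y $ idx1 \<le> 2 * r \<longrightarrow>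
        \<bar>(partial idx1 ^^ j) H y\<bar> \<le> C * r ^ (n - j)) \<longrightarrow>
    (\<forall>y. 0 \<le> y $ idx1 \<and> y $ idx1 \<le> 2 * r \<longrightarrow>
        \<bar>(partial idx1 ^^ n) (\<lambda>y. \<eta> (y $ idx1 / r) * H y) y\<bar> \<le> M * C)"
  using assms
proof (induction n arbitrary: \<eta>)
  case 0
  have "bounded (\<eta> ` {0..2})"
    by (intro compact_imp_bounded compact_continuous_image smooth_continuous_on 0 compact_Icc)
  then obtain B where "\<forall>x\<in>\<eta> ` {0..2}. norm x \<le> B"
    unfolding bounded_iff by blast
  then have B: "\<bar>\<eta> t\<bar> \<le> B" if "t \<in> {0..2}" for t
    using that by auto
  have "0 \<le> B" using B[of 0] by simp
  moreover have "\<bar>\<eta> (y $ idx1 / r) * H y\<bar> \<le> B * C"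
    if "0 < r" "\<forall>y. 0 \<le> y $ idx1 \<and> y $ idx1 \<le> 2 * r \<longrightarrow> \<bar>H y\<bar> \<le> C"
      "0 \<le> y $ idx1" "y $ idx1 \<le> 2 * r" for r C and H :: "'d pt \<Rightarrow> real" and y :: "'d pt"
    using that B[of "y $ idx1 / r"] \<open>0 \<le> B\<close> unfolding abs_mult
    by (intro mult_mono) (auto simp: field_simps)
  ultimately show ?case by auto
next
  case (Suc n)
  note sm' = smooth_deriv(1)[OF Suc.prems]
  obtain M where M: "0 \<le> M" "\<forall>r C (H :: 'd pt \<Rightarrow> real). 0 < r \<longrightarrow> smooth H \<longrightarrow>
    (\<forall>j\<le>n. \<forall>y. 0 \<le> y $ idx1 \<and> y $ idx1 \<le> 2 * r \<longrightarrow>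
        \<bar>(partial idx1 ^^ j) H y\<bar> \<le> C * r ^ (n - j)) \<longrightarrow>
    (\<forall>y. 0 \<le> y $ idx1 \<and> y $ idx1 \<le> 2 * r \<longrightarrow>
        \<bar>(partial idx1 ^^ n) (\<lambda>y. \<eta> (y $ idx1 / r) * H y) y\<bar> \<le> M * C)"
    using Suc.IH[OF Suc.prems] by (elim exE conjE) (rule that)
  obtain M' where M': "0 \<le> M'" "\<forall>r C (H :: 'd pt \<Rightarrow> real). 0 < r \<longrightarrow> smooth H \<longrightarrow>
    (\<forall>j\<le>n. \<forall>y. 0 \<le> y $ idx1 \<and> y $ idx1 \<le> 2 * r \<longrightarrow>
        \<bar>(partial idx1 ^^ j) H y\<bar> \<le> C * r ^ (n - j)) \<longrightarrow>
    (\<forall>y. 0 \<le> y $ idx1 \<and> y $ idx1 \<le> 2 * r \<longrightarrow>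
        \<bar>(partial idx1 ^^ n) (\<lambda>y. deriv \<eta> (y $ idx1 / r) * H y) y\<bar> \<le> M' * C)"
    using Suc.IH[OF sm'] by (elim exE conjE) (rule that)
  have "\<bar>(partial idx1 ^^ Suc n) (\<lambda>y. \<eta> (y $ idx1 / r) * H y) y\<bar> \<le> (M + M') * C"
    if r: "0 < r" and H: "smooth H" and bd: "\<And>j y. j \<le> Suc n \<Longrightarrow> 0 \<le> y $ idx1 \<Longrightarrow> y $ idx1 \<le> 2 * r \<Longrightarrow>
        \<bar>(partial idx1 ^^ j) H y\<bar> \<le> C * r ^ (Suc n - j)"
      and y: "0 \<le> y $ idx1" "y $ idx1 \<le> 2 * r"
    for r C and H :: "'d pt \<Rightarrow> real" and y :: "'d pt"
  proof -
    \<comment> \<open>The two terms of the product rule, as a family over \<open>{0, 1}\<close> whose sum is differentiated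
      further term by term.\<close>
    define F where "F k = (if k = (0::nat) then \<lambda>y. \<eta> (y $ idx1 / r) * partial idx1 H y
      else (\<lambda>y. deriv \<eta> (y $ idx1 / r) * (inverse r * H y)))" for k
    have H': "smooth (\<lambda>y. inverse r * H y)"
      by (intro smooth_mult smooth_const H)
    have smF: "smooth (F k)" for k
      unfolding F_def
      by (auto intro!: smooth_mult smooth_scaled_nth Suc.prems sm' H smooth_partial smooth_const)
    have "partial idx1 (\<lambda>y. \<eta> (y $ idx1 / r) * H y) = (\<lambda>y. \<Sum>k\<in>{0,1}. 1 * F k y)"
      by (subst partial_mult) (auto intro!: smooth_scaled_nth Suc.prems H simp: fun_eq_iff
          partial_scaled_nth[OF Suc.prems] F_def)
    then have "(partial idx1 ^^ Suc n) (\<lambda>y. \<eta> (y $ idx1 / r) * H y) y =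
        (\<Sum>k\<in>{0,1}. 1 * (partial idx1 ^^ n) (F k) y)"
      unfolding funpow_Suc_right comp_def by (simp only: funpow_partial_sum[OF smF])
    also have "\<dots> = (partial idx1 ^^ n) (F 0) y + (partial idx1 ^^ n) (F 1) y" by simp
    finally have "\<bar>(partial idx1 ^^ Suc n) (\<lambda>y. \<eta> (y $ idx1 / r) * H y) y\<bar> \<le>
        \<bar>(partial idx1 ^^ n) (F 0) y\<bar> + \<bar>(partial idx1 ^^ n) (F 1) y\<bar>" by linarith
    also have "\<bar>(partial idx1 ^^ n) (F 0) y\<bar> \<le> M * C"
    proof -
      have "\<bar>(partial idx1 ^^ j) (partial idx1 H) z\<bar> \<le> C * r ^ (n - j)"
        if "j \<le> n" "0 \<le> z $ idx1" "z $ idx1 \<le> 2 * r" for j z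
        using bd[of "Suc j" z] that unfolding funpow_Suc_right comp_def by simp
      then have "\<bar>(partial idx1 ^^ n) (\<lambda>y. \<eta> (y $ idx1 / r) * partial idx1 H y) y\<bar> \<le> M * C"
        by (intro M(2)[rule_format, OF r smooth_partial[OF H]]) (use y in simp_all)
      then show ?thesis by (simp add: F_def)
    qed
    also have "\<bar>(partial idx1 ^^ n) (F 1) y\<bar> \<le> M' * C"
    proof -
      have "\<bar>(partial idx1 ^^ j) (\<lambda>y. inverse r * H y) z\<bar> \<le> C * r ^ (n - j)"
        if "j \<le> n" "0 \<le> z $ idx1" "z $ idx1 \<le> 2 * r" for j z
      proof -
        have "(partial idx1 ^^ j) (\<lambda>y. inverse r * H y) z = inverse r * (partial idx1 ^^ j) H z"
          using funpow_partial_sum[of "{()}" "\<lambda>_. H" j idx1 "\<lambda>_. inverse r"] H by simp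
        moreover have "inverse r * \<bar>(partial idx1 ^^ j) H z\<bar> \<le> inverse r * (C * r ^ (Suc n - j))"
          using r that bd[of j z] by (intro mult_left_mono) auto
        moreover have "inverse r * (C * r ^ (Suc n - j)) = C * r ^ (n - j)"
          using r that by (simp add: Suc_diff_le)
        ultimately show ?thesis using r by (simp add: abs_mult)
      qed
      then have "\<bar>(partial idx1 ^^ n) (\<lambda>y. deriv \<eta> (y $ idx1 / r) * (inverse r * H y)) y\<bar> \<le> M' * C"
        by (intro M'(2)[rule_format, OF r H']) (use y in simp_all)
      then show ?thesis by (simp add: F_def)
    qed
    finally show ?thesis by (simp add: algebra_simps)
  qed
  then show ?case using M(1) M'(1)
    by (intro exI[of _ "M + M'"] conjI allI impI) simp_all
qed

text \<open>
  The mean value theorem on the normal segment from the hyperplane \<open>y\<^sub>1 = 0\<close> to \<open>y\<close>.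
\<close>

lemma normal_derivative_growth:
  fixes F :: "'d::{finite,linorder} pt \<Rightarrow> real"
  assumes F: "smooth F" and z: "\<And>y. y $ idx1 = 0 \<Longrightarrow> F y = 0"
    and bd: "\<And>y. 0 \<le> y $ idx1 \<Longrightarrow> \<bar>partial idx1 F y\<bar> \<le> C * (y $ idx1) ^ p"
    and y: "0 \<le> y $ idx1"
  shows "\<bar>F y\<bar> \<le> C * (y $ idx1) ^ Suc p"
proof (cases "y $ idx1 = 0")
  case False
  define P where "P t = y + (t - y $ idx1) *\<^sub>R axis idx1 1" for t
  have P1: "P t $ idx1 = t" for t by (simp add: P_def axis_def)
  have "((\<lambda>t. F (P t)) has_real_derivative partial idx1 F (P t)) (at t)" for t
  proof -
    have "(P has_derivative (\<lambda>h. h *\<^sub>R axis idx1 1)) (at t)"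
      unfolding P_def by (auto intro!: derivative_eq_intros)
    from has_derivative_compose[OF this smooth_has_derivative[OF F]]
    have "((\<lambda>t. F (P t)) has_derivative
       (\<lambda>h. frechet_derivative F (at (P t)) (h *\<^sub>R axis idx1 1))) (at t)" .
    moreover have "linear (frechet_derivative F (at (P t)))"
      using smooth_has_derivative[OF F] has_derivative_linear by blast
    ultimately show ?thesis
      by (simp add: has_field_derivative_def linear_scale partial_def mult_commute_abs)
  qed
  then obtain t where t: "0 < t" "t < y $ idx1"
    and "F (P (y $ idx1)) - F (P 0) = (y $ idx1 - 0) * partial idx1 F (P t)"
    using MVT2[of 0 "y $ idx1" "\<lambda>t. F (P t)" "\<lambda>t. partial idx1 F (P t)"] False y by auto
  then have eq: "F y = y $ idx1 * partial idx1 F (P t)"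
    using z[of "P 0"] P1 by (simp add: P_def)
  have "0 \<le> C"
  proof -
    have "0 \<le> C * (P t $ idx1) ^ p"
      using bd[of "P t"] t P1[of t] by simp
    moreover have "0 < (P t $ idx1) ^ p" using t P1[of t] by simp
    ultimately show ?thesis using mult_neg_pos[of C "(P t $ idx1) ^ p"] by linarith
  qed
  have "\<bar>partial idx1 F (P t)\<bar> \<le> C * t ^ p" using bd[of "P t"] t P1[of t] by simp
  also have "\<dots> \<le> C * (y $ idx1) ^ p"
    using t \<open>0 \<le> C\<close> by (intro mult_left_mono power_mono) auto
  finally show ?thesis
    unfolding eq abs_mult
    using y mult_left_mono[of "\<bar>partial idx1 F (P t)\<bar>" "C * (y $ idx1) ^ p" "y $ idx1"]
    by (simp add: mult_ac)
qed (use z in simp)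

text \<open>
  Integrating the bound on the highest normal derivative back to the hyperplane gains one power
  of \<open>y\<^sub>1\<close> at each step. This supplies the hypothesis of \<open>normal_derivative_cutoff_bound\<close>.
\<close>

lemma normal_derivatives_growth:
  fixes F :: "'d::{finite,linorder} pt \<Rightarrow> real"
  assumes F: "smooth F" and z: "\<And>j y. j < n \<Longrightarrow> y $ idx1 = 0 \<Longrightarrow> (partial idx1 ^^ j) F y = 0"
    and bd: "\<And>y. \<bar>(partial idx1 ^^ n) F y\<bar> \<le> C"
    and "j \<le> n" and y: "0 \<le> y $ idx1"
  shows "\<bar>(partial idx1 ^^ j) F y\<bar> \<le> C * (y $ idx1) ^ (n - j)"
  using \<open>j \<le> n\<close> y
proof (induction "n - j" arbitrary: j y)
  case 0
  then show ?case using bd by simp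
next
  case (Suc p)
  then have j: "j < n" "n - Suc j = p" by auto
  have "\<bar>(partial idx1 ^^ j) F y\<bar> \<le> C * (y $ idx1) ^ Suc p"
  proof (rule normal_derivative_growth[OF smooth_funpow_partial[OF F] z[OF j(1)] _ Suc.prems(2)])
    fix y :: "'d pt" assume "0 \<le> y $ idx1"
    then show "\<bar>partial idx1 ((partial idx1 ^^ j) F) y\<bar> \<le> C * (y $ idx1) ^ p"
      using Suc.hyps(1)[of "Suc j" y] j by simp
  qed
  then show ?case using Suc.hyps(2) by simp
qed

lemma iter_partial_cutoff:
  fixes H :: "'d::{finite,linorder} pt \<Rightarrow> real" and \<eta> :: "real \<Rightarrow> real"
  assumes "smooth \<eta>" "smooth H" "idx1 \<notin> set is"
  shows "iter_partial \<alpha> is (\<lambda>y. \<eta> (y $ idx1 / r) * H y) =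
    (\<lambda>y. \<eta> (y $ idx1 / r) * iter_partial \<alpha> is H y)"
proof -
  have one: "(partial i ^^ n) (\<lambda>y. \<eta> (y $ idx1 / r) * G y) =
      (\<lambda>y. \<eta> (y $ idx1 / r) * (partial i ^^ n) G y)" if "i \<noteq> idx1" "smooth G" for i n and G :: "'d pt \<Rightarrow> real"
  proof (induction n)
    case (Suc n)
    have "partial i (\<lambda>y. \<eta> (y $ idx1 / r) * (partial i ^^ n) G y) =
        (\<lambda>y. \<eta> (y $ idx1 / r) * partial i ((partial i ^^ n) G) y)"
      using that by (subst partial_mult) (auto intro!: smooth_scaled_nth assms smooth_funpow_partial
          simp: partial_scaled_nth[OF assms(1)])
    then show ?case by (simp add: Suc)
  qed simp
  show ?thesis
    using assms(3) by (induction "is") (auto simp: one smooth_iter_partial assms)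
qed

section \<open>The fundamental lemma of the calculus of variations\<close>

text \<open>
  Integrals over sets are turned into integrals over the whole space, where changes of variables
  and integrals over different sets can be compared.
\<close>

lemma lebesgue_on_integral:
  fixes f :: "'a::euclidean_space \<Rightarrow> 'b::{banach,second_countable_topology}"
  assumes "S \<in> sets lebesgue"
  shows "(LINT x|lebesgue_on S. f x) = (LINT x|lebesgue. indicator S x *\<^sub>R f x)"
    and "integrable (lebesgue_on S) f \<longleftrightarrow> integrable lebesgue (\<lambda>x. indicator S x *\<^sub>R f x)"
    and "f \<in> borel_measurable (lebesgue_on S) \<longleftrightarrow> (\<lambda>x. indicator S x *\<^sub>R f x) \<in> borel_measurable lebesgue"
  using assms
  by (simp_all add: integral_restrict_space integrable_restrict_space borel_measurable_restrict_space_iff)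

lemma AE_lebesgue_on_iff:
  fixes S :: "'a::euclidean_space set"
  assumes "S \<in> sets lebesgue"
  shows "(AE x in lebesgue_on S. P x) \<longleftrightarrow> (AE x in lebesgue. x \<in> S \<longrightarrow> P x)"
  using assms by (simp add: AE_restrict_space_iff)

lemma continuous_lebesgue_measurable:
  fixes f :: "'a::euclidean_space \<Rightarrow> 'b::euclidean_space"
  shows "continuous_on UNIV f \<Longrightarrow> f \<in> borel_measurable lebesgue"
  by (intro measurable_completion) (simp add: borel_measurable_continuous_onI)

lemma open_lebesgue: "open S \<Longrightarrow> S \<in> sets lebesgue"
  by (simp add: borel_open)

text \<open>
  Boxes form an intersection-stable generator of the Borel sets, so by Dynkin's argument all
  integrals over Borel sets vanish; sets of the completion differ from Borel sets by null sets.
\<close>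

lemma AE_zero_if_box_integrals_zero:
  fixes v :: "'a::euclidean_space \<Rightarrow> 'b::{banach,second_countable_topology}"
  assumes v: "integrable lebesgue v"
    and box0: "\<And>p q. (LINT x|lebesgue. indicator (box p q) x *\<^sub>R v x) = 0"
    and total: "(LINT x|lebesgue. v x) = 0"
  shows "AE x in lebesgue. v x = 0"
proof -
  have setint: "set_integrable lebesgue A v" if "A \<in> sets lebesgue" for A
    using that v by (simp add: set_integrable_def integrable_mult_indicator)
  let ?G = "range (\<lambda>(a, b). box a b :: 'a set)"
  have leb: "A \<in> sets lebesgue" if "A \<in> sigma_sets UNIV ?G" for A
  proof -
    have "A \<in> sets borel" using that by (simp add: borel_eq_box)
    then show ?thesis by (simp add: sets_completionI_sets)
  qed
  have borel0: "set_lebesgue_integral lebesgue A v = 0" if "A \<in> sets borel" for A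
  proof -
    have "A \<in> sigma_sets UNIV ?G"
      using that by (simp add: borel_eq_box)
    have stable: "Int_stable ?G"
    proof (rule Int_stableI, clarsimp simp: image_iff)
      fix a b c d :: 'a
      show "\<exists>p q. box a b \<inter> box c d = box p q"
        unfolding box_Int_box by blast
    qed
    show ?thesis
      using stable subset_Pow_Union[of ?G, THEN order_trans, OF Pow_mono[OF subset_UNIV]]
        \<open>A \<in> sigma_sets UNIV ?G\<close>
    proof (induction rule: sigma_sets_induct_disjoint)
      case (basic A)
      then show ?case using box0 by (auto simp: set_lebesgue_integral_def)
    next
      case empty
      then show ?case by (simp add: set_lebesgue_integral_def)
    next
      case (compl A)
      then have A: "A \<in> sets lebesgue" by (intro leb)
      have "set_lebesgue_integral lebesgue (A \<union> (UNIV - A)) v =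
          set_lebesgue_integral lebesgue A v + set_lebesgue_integral lebesgue (UNIV - A) v"
        using A by (intro set_integral_Un setint) auto
      then show ?case using compl total by (simp add: set_lebesgue_integral_def)
    next
      case (union A)
      then have A: "A i \<in> sets lebesgue" for i by (intro leb) auto
      have "set_lebesgue_integral lebesgue (\<Union>i. A i) v = (\<Sum>i. set_lebesgue_integral lebesgue (A i) v)"
        using A union(1)
        by (intro lebesgue_integral_countable_add setint) (auto simp: disjoint_family_on_def)
      then show ?case using union by simp
    qed
  qed
  interpret sigma_finite_measure "lebesgue :: 'a measure"
  proof
    obtain A :: "'a set set" where A: "countable A" "A \<subseteq> sets lborel" "\<Union>A = space lborel"
      "\<forall>a\<in>A. emeasure lborel a \<noteq> \<infinity>"
      using lborel.sigma_finite_countable by blast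
    moreover have "emeasure lebesgue a \<noteq> \<infinity>" if "a \<in> A" for a
      using that A(2,4) by (auto simp: subset_iff)
    ultimately show "\<exists>A :: 'a set set. countable A \<and> A \<subseteq> sets lebesgue \<and> \<Union>A = space lebesgue \<and>
        (\<forall>a\<in>A. emeasure lebesgue a \<noteq> \<infinity>)"
      by (intro exI[of _ A]) (auto simp: sets_completionI_sets subset_iff)
  qed
  show ?thesis
  proof (rule density_zero[OF v])
    fix A :: "'a set" assume "A \<in> sets lebesgue"
    then obtain S N N' where A: "A = S \<union> N" "N \<subseteq> N'" "N' \<in> null_sets lborel" "S \<in> sets lborel"
      by (auto elim: sets_completionE)
    have N': "N' \<in> null_sets lebesgue" using A(3) null_sets_completionI by blast
    have "set_lebesgue_integral lebesgue A v = set_lebesgue_integral lebesgue S v"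
      unfolding set_lebesgue_integral_def
    proof (rule integral_cong_AE)
      show "AE x in lebesgue. indicator A x *\<^sub>R v x = indicator S x *\<^sub>R v x"
        using AE_not_in[OF N'] by eventually_elim (use A in \<open>auto simp: indicator_def\<close>)
      show "(\<lambda>x. indicator A x *\<^sub>R v x) \<in> borel_measurable lebesgue"
        by (rule borel_measurable_integrable[OF setint[unfolded set_integrable_def]]) fact
      have "S \<in> sets lebesgue" using A(4) by (rule sets_completionI_sets)
      then show "(\<lambda>x. indicator S x *\<^sub>R v x) \<in> borel_measurable lebesgue"
        by (rule borel_measurable_integrable[OF setint[unfolded set_integrable_def]])
    qed
    then show "set_lebesgue_integral lebesgue A v = 0"
      using borel0[of S] A by simp
  qed
qed

text \<open>
  Smooth functions that converge to the indicator of the open box: each factor is \<open>0\<close> at distance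
  at most \<open>1 / (n + 1)\<close> from its face and \<open>1\<close> at distance at least \<open>2 / (n + 1)\<close>.
\<close>

definition box_bump :: "nat \<Rightarrow> 'a::euclidean_space \<Rightarrow> 'a \<Rightarrow> 'a \<Rightarrow> real" where
  "box_bump n p q x = (\<Prod>i\<in>Basis. smooth_step (Suc n * (x \<bullet> i - p \<bullet> i) - 1) *
     smooth_step (Suc n * (q \<bullet> i - x \<bullet> i) - 1))"

lemma smooth_box_bump: "smooth (box_bump n p q)"
proof -
  have "smooth (\<lambda>x. smooth_step (c * (x \<bullet> i + - t) + - 1))"
    "smooth (\<lambda>x. smooth_step (c * (t + (- 1) * (x \<bullet> i)) + - 1))" for c t and i :: 'a
    by (rule smooth_real_compose[OF smooth_smooth_step],
        intro smooth_add smooth_mult smooth_const smooth_inner)+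
  then have "smooth (\<lambda>x. smooth_step (Suc n * (x \<bullet> i - p \<bullet> i) - 1))"
    "smooth (\<lambda>x. smooth_step (Suc n * (q \<bullet> i - x \<bullet> i) - 1))" for i
    by (simp_all only: add_uminus_conv_diff mult_minus1)
  then show ?thesis
    unfolding box_bump_def[abs_def] by (intro smooth_prod smooth_mult)
qed

lemma box_bump_range: "0 \<le> box_bump n p q x" "box_bump n p q x \<le> 1"
  unfolding box_bump_def
  by (auto intro!: prod_nonneg prod_le_1 mult_nonneg_nonneg mult_le_one smooth_step_range)

lemma box_bump_support: "closure {x. box_bump n p q x \<noteq> 0} \<subseteq>
    cbox (p + (\<Sum>i\<in>Basis. inverse (Suc n) *\<^sub>R i)) (q - (\<Sum>i\<in>Basis. inverse (Suc n) *\<^sub>R i))"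
proof (rule closure_minimal)
  show "{x. box_bump n p q x \<noteq> 0} \<subseteq>
    cbox (p + (\<Sum>i\<in>Basis. inverse (Suc n) *\<^sub>R i)) (q - (\<Sum>i\<in>Basis. inverse (Suc n) *\<^sub>R i))"
  proof
    fix x assume "x \<in> {x. box_bump n p q x \<noteq> 0}"
    then have "smooth_step (Suc n * (x \<bullet> i - p \<bullet> i) - 1) \<noteq> 0"
      "smooth_step (Suc n * (q \<bullet> i - x \<bullet> i) - 1) \<noteq> 0" if "i \<in> Basis" for i
      using that by (auto simp: box_bump_def)
    then have "Suc n * (x \<bullet> i - p \<bullet> i) > 1" "Suc n * (q \<bullet> i - x \<bullet> i) > 1" if "i \<in> Basis" for i
      using that smooth_step_0 by (metis diff_le_0_iff_le not_le)+
    then have "inverse (Suc n) < x \<bullet> i - p \<bullet> i" "inverse (Suc n) < q \<bullet> i - x \<bullet> i" if "i \<in> Basis" for i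
      using that by (metis inverse_eq_divide mult.commute of_nat_0_less_iff pos_divide_less_eq zero_less_Suc)+
    then show "x \<in> cbox (p + (\<Sum>i\<in>Basis. inverse (Suc n) *\<^sub>R i)) (q - (\<Sum>i\<in>Basis. inverse (Suc n) *\<^sub>R i))"
      by (force simp: mem_box inner_add_left inner_diff_left inner_sum_left inner_Basis if_distrib cong: if_cong)
  qed
qed (rule closed_cbox)

lemma test_function_box_bump: "test_function (box p q) (box_bump n p q)"
proof -
  have "cbox (p + (\<Sum>i\<in>Basis. inverse (Suc n) *\<^sub>R i)) (q - (\<Sum>i\<in>Basis. inverse (Suc n) *\<^sub>R i)) \<subseteq> box p q"
    by (auto simp: mem_box inner_add_left inner_diff_left inner_sum_left inner_Basis if_distrib cong: if_cong)
       (smt (verit) inverse_positive_iff_positive of_nat_0_less_iff of_nat_Suc zero_less_Suc)+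
  moreover have "compact (closure {x. box_bump n p q x \<noteq> 0})"
    using box_bump_support bounded_subset[OF bounded_cbox] compact_eq_bounded_closed closed_closure by metis
  ultimately show ?thesis
    using box_bump_support[of n p q] by (auto simp: test_function_def smooth_box_bump)
qed

lemma box_bump_outside: "x \<notin> box p q \<Longrightarrow> box_bump n p q x = 0"
  using test_function_box_bump[of p q n] closure_subset[of "{x. box_bump n p q x \<noteq> 0}"]
  unfolding test_function_def by blast

lemma box_bump_tendsto: "(\<lambda>n. box_bump n p q x) \<longlonglongrightarrow> indicator (box p q) x"
proof (cases "x \<in> box p q")
  case True
  have ev: "\<forall>\<^sub>F n in sequentially. smooth_step (Suc n * t - 1) = 1" if "t > 0" for t :: real
  proof -
    have "\<forall>\<^sub>F n in sequentially. inverse (Suc n) < t / 2"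
      using order_tendstoD(2)[OF LIMSEQ_inverse_real_of_nat, of "t / 2"] that by simp
    then show ?thesis
    proof eventually_elim
      case (elim n)
      then have "2 \<le> Suc n * t" using that by (simp add: field_simps)
      then show ?case by (intro smooth_step_1) simp
    qed
  qed
  have "\<forall>\<^sub>F n in sequentially. \<forall>i\<in>Basis. smooth_step (Suc n * (x \<bullet> i - p \<bullet> i) - 1) *
     smooth_step (Suc n * (q \<bullet> i - x \<bullet> i) - 1) = 1"
  proof (rule eventually_ball_finite, simp, rule ballI)
    fix i :: 'a assume "i \<in> Basis"
    then have "x \<bullet> i - p \<bullet> i > 0" "q \<bullet> i - x \<bullet> i > 0" using True by (auto simp: mem_box)
    from ev[OF this(1)] ev[OF this(2)]
    show "\<forall>\<^sub>F n in sequentially. smooth_step (Suc n * (x \<bullet> i - p \<bullet> i) - 1) *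
      smooth_step (Suc n * (q \<bullet> i - x \<bullet> i) - 1) = 1"
      by eventually_elim simp
  qed
  then have "\<forall>\<^sub>F n in sequentially. box_bump n p q x = 1"
    by eventually_elim (simp add: box_bump_def)
  then show ?thesis using True by (simp add: tendsto_eventually)
qed (simp add: box_bump_outside)

lemma test_function_mono: "test_function D \<psi> \<Longrightarrow> D \<subseteq> E \<Longrightarrow> test_function E \<psi>"
  by (auto simp: test_function_def)

text \<open>
  The fundamental lemma of the calculus of variations. Testing with \<open>box_bump\<close> and passing to the
  limit shows that the integral over each box inside \<open>D\<close> vanishes, and countably many such boxes
  cover \<open>D\<close>.
\<close>

lemma fundamental_lemma:
  fixes w :: "'a::euclidean_space \<Rightarrow> 'b::{banach,second_countable_topology}"
  assumes D: "open D" and w: "loc_integrable D w"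
    and test: "\<And>\<psi>. test_function D \<psi> \<Longrightarrow> (LINT x|lebesgue_on D. \<psi> x *\<^sub>R w x) = 0"
  shows "AE x in lebesgue_on D. w x = 0"
proof -
  have int: "integrable lebesgue (\<lambda>x. indicator (box p q) x *\<^sub>R w x)" if "cbox p q \<subseteq> D" for p q
  proof -
    have "integrable (lebesgue_on (cbox p q)) w"
      using w[unfolded loc_integrable_def, rule_format, of "cbox p q"] that by simp
    then have "integrable lebesgue (\<lambda>x. indicator (cbox p q) x *\<^sub>R w x)"
      by (rule lebesgue_on_integral(2)[THEN iffD1, rotated]) simp
    from integrable_mult_indicator[OF _ this, of "box p q"]
    have "integrable lebesgue (\<lambda>x. indicator (box p q) x *\<^sub>R (indicator (cbox p q) x *\<^sub>R w x))" by simp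
    moreover have "indicator (box p q) x *\<^sub>R (indicator (cbox p q) x *\<^sub>R w x) = indicator (box p q) x *\<^sub>R w x" for x
      using box_subset_cbox[of p q] by (auto simp: indicator_def)
    ultimately show ?thesis by (simp only:)
  qed
  have box0: "(LINT x|lebesgue. indicator (box p q) x *\<^sub>R w x) = 0"
    if sub: "box p q \<subseteq> box a b" "cbox a b \<subseteq> D" for p q a b
  proof (cases "box p q = {}")
    case False
    have cb: "cbox p q \<subseteq> D"
      using sub False closure_mono[OF sub(1)] box_subset_cbox[of a b]
      by (metis bot.extremum_uniqueI closure_box order_trans)
    have bd: "box p q \<subseteq> D" using cb box_subset_cbox by blast
    have "(\<lambda>n. LINT x|lebesgue. box_bump n p q x *\<^sub>R w x) \<longlonglongrightarrow>
        (LINT x|lebesgue. indicator (box p q) x *\<^sub>R w x)"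
    proof (rule integral_dominated_convergence)
      show "(\<lambda>x. indicator (box p q) x *\<^sub>R w x) \<in> borel_measurable lebesgue"
        using int[OF cb] by (rule borel_measurable_integrable)
      have "(\<lambda>x. box_bump n p q x *\<^sub>R (indicator (box p q) x *\<^sub>R w x)) \<in> borel_measurable lebesgue" for n
        by (intro borel_measurable_scaleR[OF _ borel_measurable_integrable[OF int[OF cb]]]
            continuous_lebesgue_measurable smooth_continuous_on smooth_box_bump)
      then show "(\<lambda>x. box_bump n p q x *\<^sub>R w x) \<in> borel_measurable lebesgue" for n
        by (rule measurable_cong[THEN iffD1, rotated]) (auto simp: indicator_def box_bump_outside)
      show "integrable lebesgue (\<lambda>x. norm (indicator (box p q) x *\<^sub>R w x))"
        using int[OF cb] by (rule integrable_norm)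
      show "AE x in lebesgue. (\<lambda>n. box_bump n p q x *\<^sub>R w x) \<longlonglongrightarrow> indicator (box p q) x *\<^sub>R w x"
        by (intro AE_I2 tendsto_scaleR box_bump_tendsto tendsto_const)
      show "AE x in lebesgue. norm (box_bump n p q x *\<^sub>R w x) \<le> norm (indicator (box p q) x *\<^sub>R w x)" for n
        using box_bump_range[of n p q] box_bump_outside[of _ p q n]
        by (intro AE_I2) (auto simp: indicator_def mult_left_le_one_le)
    qed
    moreover have "(LINT x|lebesgue. box_bump n p q x *\<^sub>R w x) = 0" for n
    proof -
      have "(LINT x|lebesgue. box_bump n p q x *\<^sub>R w x) =
          (LINT x|lebesgue. indicator D x *\<^sub>R (box_bump n p q x *\<^sub>R w x))"
        by (intro Bochner_Integration.integral_cong)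
           (use bd box_bump_outside[of _ p q n] in \<open>force simp: indicator_def\<close>)+
      also have "\<dots> = (LINT x|lebesgue_on D. box_bump n p q x *\<^sub>R w x)"
        using D by (intro lebesgue_on_integral(1)[symmetric] open_lebesgue)
      also have "\<dots> = 0"
        by (rule test[OF test_function_mono[OF test_function_box_bump bd]])
      finally show ?thesis .
    qed
    ultimately show ?thesis
      by (simp add: LIMSEQ_const_iff)
  qed simp
  have AEbox: "AE x in lebesgue. x \<in> box a b \<longrightarrow> w x = 0" if "cbox a b \<subseteq> D" for a b
  proof -
    have "AE x in lebesgue. indicator (box a b) x *\<^sub>R w x = 0"
    proof (rule AE_zero_if_box_integrals_zero[OF int[OF that]])
      show "(LINT x|lebesgue. indicator (box a b) x *\<^sub>R w x) = 0"
        by (rule box0[OF order_refl that])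
      fix p q :: 'a
      have "indicator (box p q) x *\<^sub>R indicator (box a b) x *\<^sub>R w x = indicator (box p q \<inter> box a b) x *\<^sub>R w x" for x
        by (auto simp: indicator_def)
      moreover obtain p' q' where pq: "box p q \<inter> box a b = box p' q'"
        using box_Int_box[of p q a b] by blast
      moreover have "box p' q' \<subseteq> box a b" unfolding pq[symmetric] by simp
      note box0[OF this that]
      ultimately show "(LINT x|lebesgue. indicator (box p q) x *\<^sub>R indicator (box a b) x *\<^sub>R w x) = 0"
        by (simp only:)
    qed
    then show ?thesis by eventually_elim (auto simp: indicator_def)
  qed
  obtain \<D> where \<D>: "countable \<D>" "\<And>X. X \<in> \<D> \<Longrightarrow> \<exists>a b. X = box a b \<and> cbox a b \<subseteq> D" "\<Union>\<D> = D"
  proof -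
    define \<F> where "\<F> = {box a b | a b. cbox a b \<subseteq> D}"
    have un: "\<Union>\<F> = D"
    proof (intro equalityI subsetI)
      fix x assume "x \<in> \<Union>\<F>"
      then obtain a b where "x \<in> box a b" "cbox a b \<subseteq> D" by (auto simp: \<F>_def)
      then show "x \<in> D" using box_subset_cbox[of a b] by auto
    next
      fix x assume "x \<in> D"
      then obtain a b where "cbox a b \<subseteq> D" "x \<in> box a b"
        using open_contains_cbox[OF D] by metis
      then show "x \<in> \<Union>\<F>" by (auto simp: \<F>_def)
    qed
    obtain \<D> where \<D>: "\<D> \<subseteq> \<F>" "countable \<D>" "\<Union>\<D> = \<Union>\<F>"
      by (rule Lindelof[of \<F>]) (auto simp: \<F>_def)
    show ?thesis by (rule that[OF \<D>(2) _ \<D>(3)[unfolded un]]) (use \<D>(1) in \<open>auto simp: \<F>_def\<close>)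
  qed
  have "AE x in lebesgue. \<forall>X\<in>\<D>. x \<in> X \<longrightarrow> w x = 0"
    using \<D>(2) AEbox by (subst AE_ball_countable[OF \<D>(1)]) blast
  then have "AE x in lebesgue. x \<in> D \<longrightarrow> w x = 0"
    by eventually_elim (use \<D>(3) in blast)
  then show ?thesis
    using D by (simp add: AE_lebesgue_on_iff open_lebesgue)
qed

section \<open>Weak derivatives\<close>

lemma integrable_bounded_mult:
  fixes f :: "'a::euclidean_space \<Rightarrow> 'b::{banach,second_countable_topology}" and g :: "'a \<Rightarrow> real"
  assumes g: "g \<in> borel_measurable lebesgue" "\<And>x. \<bar>g x\<bar> \<le> B" and f: "integrable lebesgue f"
  shows "integrable lebesgue (\<lambda>x. g x *\<^sub>R f x)"
proof (rule Bochner_Integration.integrable_bound)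
  show "integrable lebesgue (\<lambda>x. B * norm (f x))"
    using f by simp
  show "(\<lambda>x. g x *\<^sub>R f x) \<in> borel_measurable lebesgue"
    by (intro borel_measurable_scaleR g(1) borel_measurable_integrable[OF f])
  show "AE x in lebesgue. norm (g x *\<^sub>R f x) \<le> norm (B * norm (f x))"
    using g(2) by (intro AE_I2) (auto simp: abs_mult intro!: mult_right_mono order_trans[OF g(2)])
qed

lemma smooth_measurable: "smooth (f :: 'a::euclidean_space \<Rightarrow> real) \<Longrightarrow> f \<in> borel_measurable lebesgue"
  by (intro continuous_lebesgue_measurable smooth_continuous_on)

lemma compact_lebesgue: "compact K \<Longrightarrow> K \<in> sets lebesgue"
  by (simp add: borel_compact)

lemma smooth_compact_support_integrable:
  fixes g :: "'a::euclidean_space \<Rightarrow> real" and f :: "'a \<Rightarrow> 'b::{banach,second_countable_topology}"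
  assumes g: "smooth g" and K: "compact K" "\<And>x. x \<notin> K \<Longrightarrow> g x = 0" "K \<subseteq> D"
    and f: "loc_integrable D f" and D: "D \<in> sets lebesgue"
  shows "integrable (lebesgue_on D) (\<lambda>x. g x *\<^sub>R f x)"
proof -
  obtain B where B: "\<And>x. \<bar>g x\<bar> \<le> B"
    using bounded_if_compact_support[OF smooth_continuous_on[OF g] K(1,2)] by blast
  have "integrable (lebesgue_on K) f"
    using f K by (simp add: loc_integrable_def)
  then have "integrable lebesgue (\<lambda>x. indicator K x *\<^sub>R f x)"
    by (rule lebesgue_on_integral(2)[THEN iffD1, rotated]) (rule compact_lebesgue[OF K(1)])
  from integrable_bounded_mult[OF smooth_measurable[OF g] B this]
  have "integrable lebesgue (\<lambda>x. g x *\<^sub>R (indicator K x *\<^sub>R f x))" .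
  moreover have "g x *\<^sub>R (indicator K x *\<^sub>R f x) = indicator D x *\<^sub>R (g x *\<^sub>R f x)" for x
    using K(2)[of x] K(3) by (auto simp: indicator_def)
  ultimately have "integrable lebesgue (\<lambda>x. indicator D x *\<^sub>R (g x *\<^sub>R f x))"
    by (simp only:)
  then show ?thesis by (rule lebesgue_on_integral(2)[THEN iffD2, rotated]) (rule D)
qed

lemma test_function_outside: "test_function D \<psi> \<Longrightarrow> x \<notin> closure {x. \<psi> x \<noteq> 0} \<Longrightarrow> \<psi> x = 0"
  using closure_subset[of "{x. \<psi> x \<noteq> 0}"] by auto

lemma test_function_integrable:
  fixes f :: "'d::{finite,linorder} pt \<Rightarrow> 'b::{banach,second_countable_topology}"
  assumes "test_function D \<psi>" "loc_integrable D f" "D \<in> sets lebesgue"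
  shows "integrable (lebesgue_on D) (\<lambda>x. \<psi> x *\<^sub>R f x)"
    and "integrable (lebesgue_on D) (\<lambda>x. mderiv \<alpha> \<psi> x *\<^sub>R f x)"
proof -
  have \<psi>: "smooth \<psi>" "compact (closure {x. \<psi> x \<noteq> 0})" "closure {x. \<psi> x \<noteq> 0} \<subseteq> D"
    using assms(1) by (simp_all add: test_function_def)
  show "integrable (lebesgue_on D) (\<lambda>x. \<psi> x *\<^sub>R f x)"
    by (rule smooth_compact_support_integrable[OF \<psi>(1,2) test_function_outside[OF assms(1)] \<psi>(3) assms(2,3)])
  show "integrable (lebesgue_on D) (\<lambda>x. mderiv \<alpha> \<psi> x *\<^sub>R f x)"
    by (rule smooth_compact_support_integrable[OF smooth_mderiv[OF \<psi>(1)] \<psi>(2) mderiv_eq_0_outside \<psi>(3) assms(2,3)])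
qed

lemma has_weak_derivD:
  assumes "has_weak_deriv D \<alpha> u v"
  shows "loc_integrable D u" "loc_integrable D v"
    and "test_function D \<psi> \<Longrightarrow> (LINT x|lebesgue_on D. mderiv \<alpha> \<psi> x *\<^sub>R u x) =
        (-1) ^ mdeg \<alpha> *\<^sub>R (LINT x|lebesgue_on D. \<psi> x *\<^sub>R v x)"
  using assms by (simp_all add: has_weak_deriv_def)

lemma loc_integrable_mono: "loc_integrable E f \<Longrightarrow> D \<subseteq> E \<Longrightarrow> loc_integrable D f"
  by (auto simp: loc_integrable_def)

lemma weak_deriv_unique:
  fixes u v v' :: "'d::{finite,linorder} pt \<Rightarrow> 'b::{banach,second_countable_topology}"
  assumes D: "open D" and v: "has_weak_deriv D \<alpha> u v" and v': "has_weak_deriv D \<alpha> u v'"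
  shows "AE x in lebesgue_on D. v x = v' x"
proof -
  have "AE x in lebesgue_on D. v x - v' x = 0"
  proof (rule fundamental_lemma[OF D])
    have l: "loc_integrable D v" "loc_integrable D v'"
      by (rule has_weak_derivD(2)[OF v], rule has_weak_derivD(2)[OF v'])
    then show "loc_integrable D (\<lambda>x. v x - v' x)"
      by (auto simp: loc_integrable_def)
    fix \<psi> :: "'d pt \<Rightarrow> real" assume t: "test_function D \<psi>"
    have "(-1) ^ mdeg \<alpha> *\<^sub>R (LINT x|lebesgue_on D. \<psi> x *\<^sub>R v x) =
        ((-1) ^ mdeg \<alpha> *\<^sub>R (LINT x|lebesgue_on D. \<psi> x *\<^sub>R v' x))"
      by (simp only: has_weak_derivD(3)[OF v t, symmetric] has_weak_derivD(3)[OF v' t])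
    then have "(LINT x|lebesgue_on D. \<psi> x *\<^sub>R v x) = (LINT x|lebesgue_on D. \<psi> x *\<^sub>R v' x)"
      by simp
    then show "(LINT x|lebesgue_on D. \<psi> x *\<^sub>R (v x - v' x)) = 0"
      using test_function_integrable(1)[OF t l(1)] test_function_integrable(1)[OF t l(2)] D
      by (simp add: scaleR_diff_right open_lebesgue)
  qed
  then show ?thesis by simp
qed

text \<open>
  The operator \<open>wderiv\<close> picks some representative; the next two facts are all that is ever used
  about this choice.
\<close>

lemma has_weak_deriv_wderiv:
  "has_weak_deriv D \<alpha> u v \<Longrightarrow> has_weak_deriv D \<alpha> u (wderiv D \<alpha> u)"
  unfolding wderiv_def by (rule someI[where P = "has_weak_deriv D \<alpha> u"])

lemma wderiv_AE_eq:
  assumes "open D" "has_weak_deriv D \<alpha> u v"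
  shows "AE x in lebesgue_on D. wderiv D \<alpha> u x = v x"
  using weak_deriv_unique[OF assms(1) has_weak_deriv_wderiv[OF assms(2)] assms(2)] .

lemma weak_deriv_zero_index:
  assumes "mdeg \<alpha> = 0" "loc_integrable D u"
  shows "has_weak_deriv D \<alpha> u u"
  using assms by (simp add: has_weak_deriv_def mderiv_zero_index)

lemma integral_lebesgue_on_mono_support:
  fixes f :: "'a::euclidean_space \<Rightarrow> 'b::{banach,second_countable_topology}"
  assumes "D \<in> sets lebesgue" "E \<in> sets lebesgue" "D \<subseteq> E" "\<And>x. x \<in> E \<Longrightarrow> x \<notin> D \<Longrightarrow> f x = 0"
  shows "(LINT x|lebesgue_on E. f x) = (LINT x|lebesgue_on D. f x)"
proof -
  have "(\<lambda>x. indicator E x *\<^sub>R f x) = (\<lambda>x. indicator D x *\<^sub>R f x)"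
    using assms(3,4) by (auto simp: indicator_def fun_eq_iff)
  then show ?thesis using assms(1,2) by (simp add: lebesgue_on_integral(1))
qed

lemma weak_deriv_restrict:
  fixes u v :: "'d::{finite,linorder} pt \<Rightarrow> 'b::{banach,second_countable_topology}"
  assumes "open D" "open E" "D \<subseteq> E" "has_weak_deriv E \<alpha> u v"
  shows "has_weak_deriv D \<alpha> u v"
  unfolding has_weak_deriv_def
proof (intro conjI allI impI)
  show "loc_integrable D u" "loc_integrable D v"
    using assms(3,4) loc_integrable_mono by (auto simp: has_weak_deriv_def)
  fix \<psi> :: "'d pt \<Rightarrow> real" assume t: "test_function D \<psi>"
  then have sub: "closure {x. \<psi> x \<noteq> 0} \<subseteq> D" by (simp add: test_function_def)
  have "(LINT x|lebesgue_on E. mderiv \<alpha> \<psi> x *\<^sub>R u x) = (LINT x|lebesgue_on D. mderiv \<alpha> \<psi> x *\<^sub>R u x)"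
    using sub by (intro integral_lebesgue_on_mono_support open_lebesgue assms)
      (auto intro!: mderiv_eq_0_outside)
  moreover have "(LINT x|lebesgue_on E. \<psi> x *\<^sub>R v x) = (LINT x|lebesgue_on D. \<psi> x *\<^sub>R v x)"
    using sub by (intro integral_lebesgue_on_mono_support open_lebesgue assms)
      (auto intro!: test_function_outside[OF t])
  ultimately show "(LINT x|lebesgue_on D. mderiv \<alpha> \<psi> x *\<^sub>R u x) =
      (-1) ^ mdeg \<alpha> *\<^sub>R (LINT x|lebesgue_on D. \<psi> x *\<^sub>R v x)"
    using assms(4) test_function_mono[OF t assms(3)] by (simp add: has_weak_deriv_def)
qed

lemma ball_cutoff_exists:
  fixes y0 :: "'a::euclidean_space"
  assumes "0 \<le> \<rho>" "\<rho> < \<sigma>"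
  obtains \<zeta> :: "'a \<Rightarrow> real" where "smooth \<zeta>" "\<And>x. x \<in> cball y0 \<rho> \<Longrightarrow> \<zeta> x = 1"
    "\<And>x. x \<notin> ball y0 \<sigma> \<Longrightarrow> \<zeta> x = 0"
proof
  define q where "q = inverse (\<sigma>\<^sup>2 - \<rho>\<^sup>2)"
  have q: "q > 0" using assms by (simp add: q_def power_strict_mono)
  define \<zeta> where "\<zeta> x = smooth_step (q * (\<sigma>\<^sup>2 + - 1 * (\<Sum>b\<in>Basis. (x \<bullet> b + - (y0 \<bullet> b)) * (x \<bullet> b + - (y0 \<bullet> b)))))"
    for x
  have eq: "\<zeta> x = smooth_step (q * (\<sigma>\<^sup>2 - (dist y0 x)\<^sup>2))" for x
  proof -
    have "(dist y0 x)\<^sup>2 = (\<Sum>b\<in>Basis. ((x - y0) \<bullet> b) * ((x - y0) \<bullet> b))"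
      unfolding dist_norm norm_minus_commute[of y0] power2_norm_eq_inner by (rule euclidean_inner)
    then show ?thesis by (simp add: \<zeta>_def inner_diff_left)
  qed
  show "smooth \<zeta>"
    unfolding \<zeta>_def
    by (rule smooth_real_compose[OF smooth_smooth_step],
        intro smooth_add smooth_sum smooth_mult smooth_const smooth_inner)
  show "\<zeta> x = 1" if "x \<in> cball y0 \<rho>" for x
  proof -
    have "(dist y0 x)\<^sup>2 \<le> \<rho>\<^sup>2" using that by (auto intro!: power_mono)
    then have "q * (\<sigma>\<^sup>2 - (dist y0 x)\<^sup>2) \<ge> q * (\<sigma>\<^sup>2 - \<rho>\<^sup>2)" using q by (intro mult_left_mono) auto
    also have "q * (\<sigma>\<^sup>2 - \<rho>\<^sup>2) = 1" using q by (simp add: q_def)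
    finally show ?thesis unfolding eq by (rule smooth_step_1)
  qed
  show "\<zeta> x = 0" if "x \<notin> ball y0 \<sigma>" for x
  proof -
    have "\<sigma>\<^sup>2 \<le> (dist y0 x)\<^sup>2" using that assms by (auto intro!: power_mono)
    then have "q * (\<sigma>\<^sup>2 - (dist y0 x)\<^sup>2) \<le> 0" using q by (simp add: mult_le_0_iff)
    then show ?thesis unfolding eq by (rule smooth_step_0)
  qed
qed

lemma weak_deriv_zero_AE:
  fixes u v :: "'d::{finite,linorder} pt \<Rightarrow> 'b::{banach,second_countable_topology}"
  assumes D: "open D" and v: "has_weak_deriv D \<alpha> u v" and z: "AE x in lebesgue_on D. u x = 0"
  shows "AE x in lebesgue_on D. v x = 0"
proof (rule fundamental_lemma[OF D])
  show "loc_integrable D v" using v by (simp add: has_weak_deriv_def)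
  fix \<psi> :: "'d pt \<Rightarrow> real" assume t: "test_function D \<psi>"
  have "(LINT x|lebesgue_on D. mderiv \<alpha> \<psi> x *\<^sub>R u x) = 0"
    using z by (intro integral_eq_zero_AE) (auto elim!: eventually_mono)
  then show "(LINT x|lebesgue_on D. \<psi> x *\<^sub>R v x) = 0"
    using has_weak_derivD(3)[OF v t] by simp
qed

text \<open>
  Since \<open>u\<close> vanishes outside the smaller ball, a test function may be multiplied by a cutoff that
  is \<open>1\<close> near that ball without changing its pairing with \<open>u\<close> or \<open>v\<close>; the product is supported in
  \<open>ball y0 R\<close>. Since differentiation is local, no derivative of the
  cutoff enters. The values
  outside the smaller ball are set to zero exactly, and not only almost everywhere, so that they
  stay zero under every stretching.
\<close>

lemma weak_deriv_zero_extension: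
  fixes u v :: "'d::{finite,linorder} pt \<Rightarrow> 'b::{banach,second_countable_topology}"
  assumes H: "open H" and D: "D = ball y0 R \<inter> H" and r: "0 \<le> r" "r < R"
    and v: "has_weak_deriv D \<alpha> u v"
    and z: "AE x in lebesgue. x \<in> D - cball y0 r \<longrightarrow> u x = 0"
    and int: "integrable (lebesgue_on D) u" "integrable (lebesgue_on D) v"
  shows "has_weak_deriv H \<alpha> (\<lambda>x. indicator (D \<inter> cball y0 r) x *\<^sub>R u x)
           (\<lambda>x. indicator (D \<inter> cball y0 r) x *\<^sub>R v x)"
proof -
  let ?E = "D - cball y0 r"
  have oD: "open D" using H D by auto
  have oE: "open ?E" using oD by auto
  have zv: "AE x in lebesgue. x \<in> ?E \<longrightarrow> v x = 0"
    using weak_deriv_zero_AE[OF oE weak_deriv_restrict[OF oE oD _ v]] z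
    by (simp add: AE_lebesgue_on_iff[OF open_lebesgue[OF oE]])
  have li: "loc_integrable H (\<lambda>x. indicator (D \<inter> cball y0 r) x *\<^sub>R w x)"
    if "integrable (lebesgue_on D) w" for w :: "'d pt \<Rightarrow> 'b"
    unfolding loc_integrable_def
  proof (intro allI impI, elim conjE)
    fix K :: "'d pt set" assume K: "compact K"
    have "integrable lebesgue (\<lambda>x. indicator D x *\<^sub>R w x)"
      using that by (rule lebesgue_on_integral(2)[THEN iffD1, rotated]) (rule open_lebesgue[OF oD])
    then have "integrable lebesgue (\<lambda>x. indicator (K \<inter> cball y0 r) x *\<^sub>R (indicator D x *\<^sub>R w x))"
      by (rule integrable_mult_indicator[OF compact_lebesgue[OF compact_Int_closed[OF K closed_cball]]])
    moreover have "indicator (K \<inter> cball y0 r) x *\<^sub>R (indicator D x *\<^sub>R w x) =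
        indicator K x *\<^sub>R (indicator (D \<inter> cball y0 r) x *\<^sub>R w x)" for x
      by (auto simp: indicator_def)
    ultimately have "integrable lebesgue (\<lambda>x. indicator K x *\<^sub>R (indicator (D \<inter> cball y0 r) x *\<^sub>R w x))"
      by (simp only:)
    then show "integrable (lebesgue_on K) (\<lambda>x. indicator (D \<inter> cball y0 r) x *\<^sub>R w x)"
      by (rule lebesgue_on_integral(2)[THEN iffD2, rotated]) (rule compact_lebesgue[OF K])
  qed
  \<comment> \<open>The cutoff is \<open>1\<close> on a ball strictly larger than \<open>cball y0 r\<close>, so that the derivatives of
    \<open>\<psi>\<close> and \<open>\<psi>'\<close> agree on the latter.\<close>
  define \<rho> \<sigma> where "\<rho> = (2 * r + R) / 3" and "\<sigma> = (r + 2 * R) / 3"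
  have rs: "0 \<le> \<rho>" "\<rho> < \<sigma>" "r < \<rho>" "\<sigma> < R" using r by (auto simp: \<rho>_def \<sigma>_def)
  obtain \<zeta> :: "'d pt \<Rightarrow> real" where \<zeta>: "smooth \<zeta>" "\<And>x. x \<in> cball y0 \<rho> \<Longrightarrow> \<zeta> x = 1"
    "\<And>x. x \<notin> ball y0 \<sigma> \<Longrightarrow> \<zeta> x = 0"
    using ball_cutoff_exists[OF rs(1,2)] by metis
  show ?thesis
    unfolding has_weak_deriv_def
  proof (intro conjI allI impI li int)
    fix \<psi> :: "'d pt \<Rightarrow> real" assume t: "test_function H \<psi>"
    define \<psi>' where "\<psi>' x = \<zeta> x * \<psi> x" for x
    have supp: "closure {x. \<psi>' x \<noteq> 0} \<subseteq> closure {x. \<psi> x \<noteq> 0} \<inter> cball y0 \<sigma>"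
    proof (rule closure_minimal)
      show "{x. \<psi>' x \<noteq> 0} \<subseteq> closure {x. \<psi> x \<noteq> 0} \<inter> cball y0 \<sigma>"
        using closure_subset[of "{x. \<psi> x \<noteq> 0}"] \<zeta>(3) by (force simp: \<psi>'_def)
    qed auto
    have t': "test_function D \<psi>'"
      unfolding test_function_def
    proof (intro conjI)
      show "smooth \<psi>'"
        unfolding \<psi>'_def using t by (intro smooth_mult \<zeta>) (simp add: test_function_def)
      have "compact (closure {x. \<psi> x \<noteq> 0} \<inter> cball y0 \<sigma>)"
        using t by (auto simp: test_function_def intro: compact_Int_closed)
      then show "compact (closure {x. \<psi>' x \<noteq> 0})"
        using supp by (meson bounded_subset closed_closure compact_eq_bounded_closed)
      show "closure {x. \<psi>' x \<noteq> 0} \<subseteq> D"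
        using supp t rs(4) unfolding test_function_def D by (auto simp: subset_iff)
    qed
    have der: "mderiv \<alpha> \<psi> x = mderiv \<alpha> \<psi>' x" if "x \<in> cball y0 r" for x
      by (rule mderiv_cong_open[of "ball y0 \<rho>"]) (use that rs \<zeta>(2) in \<open>auto simp: \<psi>'_def\<close>)
    have eq: "\<psi> x = \<psi>' x" if "x \<in> cball y0 r" for x
      using that \<zeta>(2)[of x] rs by (auto simp: \<psi>'_def)
    have conv: "(LINT x|lebesgue_on H. g x *\<^sub>R (indicator (D \<inter> cball y0 r) x *\<^sub>R w x)) =
        (LINT x|lebesgue_on D. g' x *\<^sub>R w x)"
      if g: "\<And>x. x \<in> cball y0 r \<Longrightarrow> g x = g' x" and w: "AE x in lebesgue. x \<in> ?E \<longrightarrow> w x = 0"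
        and iw: "integrable (lebesgue_on D) (\<lambda>x. g' x *\<^sub>R w x)"
      for g g' and w :: "'d pt \<Rightarrow> 'b"
    proof -
      have "(LINT x|lebesgue_on H. g x *\<^sub>R (indicator (D \<inter> cball y0 r) x *\<^sub>R w x)) =
          (LINT x|lebesgue. indicator (cball y0 r) x *\<^sub>R (indicator D x *\<^sub>R (g' x *\<^sub>R w x)))"
        unfolding lebesgue_on_integral(1)[OF open_lebesgue[OF H]]
        by (intro Bochner_Integration.integral_cong) (auto simp: indicator_def g D)
      also have "\<dots> = (LINT x|lebesgue. indicator D x *\<^sub>R (g' x *\<^sub>R w x))"
      proof (rule integral_cong_AE)
        have i: "integrable lebesgue (\<lambda>x. indicator D x *\<^sub>R (g' x *\<^sub>R w x))"
          using iw by (rule lebesgue_on_integral(2)[THEN iffD1, rotated]) (rule open_lebesgue[OF oD])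
        then show "(\<lambda>x. indicator D x *\<^sub>R (g' x *\<^sub>R w x)) \<in> borel_measurable lebesgue"
          by (rule borel_measurable_integrable)
        have "integrable lebesgue (\<lambda>x. indicator (cball y0 r) x *\<^sub>R (indicator D x *\<^sub>R (g' x *\<^sub>R w x)))"
          by (rule integrable_mult_indicator[OF compact_lebesgue i]) simp
        then show "(\<lambda>x. indicator (cball y0 r) x *\<^sub>R (indicator D x *\<^sub>R (g' x *\<^sub>R w x))) \<in> borel_measurable lebesgue"
          by (rule borel_measurable_integrable)
        show "AE x in lebesgue. indicator (cball y0 r) x *\<^sub>R (indicator D x *\<^sub>R (g' x *\<^sub>R w x)) =
            indicator D x *\<^sub>R (g' x *\<^sub>R w x)"
          using w by eventually_elim (auto simp: indicator_def)
      qed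
      also have "\<dots> = (LINT x|lebesgue_on D. g' x *\<^sub>R w x)"
        by (rule lebesgue_on_integral(1)[symmetric, OF open_lebesgue[OF oD]])
      finally show ?thesis .
    qed
    have "(LINT x|lebesgue_on H. mderiv \<alpha> \<psi> x *\<^sub>R (indicator (D \<inter> cball y0 r) x *\<^sub>R u x)) =
        (LINT x|lebesgue_on D. mderiv \<alpha> \<psi>' x *\<^sub>R u x)"
      by (intro conv der z test_function_integrable[OF t'] open_lebesgue oD has_weak_derivD[OF v])
    also have "\<dots> = (-1) ^ mdeg \<alpha> *\<^sub>R (LINT x|lebesgue_on D. \<psi>' x *\<^sub>R v x)"
      by (rule has_weak_derivD(3)[OF v t'])
    also have "(LINT x|lebesgue_on D. \<psi>' x *\<^sub>R v x) =
        (LINT x|lebesgue_on H. \<psi> x *\<^sub>R (indicator (D \<inter> cball y0 r) x *\<^sub>R v x))"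
      by (intro conv[symmetric] eq zv test_function_integrable[OF t'] open_lebesgue oD has_weak_derivD[OF v])
    finally show "(LINT x|lebesgue_on H. mderiv \<alpha> \<psi> x *\<^sub>R (indicator (D \<inter> cball y0 r) x *\<^sub>R u x)) =
        (-1) ^ mdeg \<alpha> *\<^sub>R (LINT x|lebesgue_on H. \<psi> x *\<^sub>R (indicator (D \<inter> cball y0 r) x *\<^sub>R v x))" .
  qed
qed

section \<open>Change of variables and test functions with vanishing normal derivatives\<close>

lemma
  fixes s :: real
  assumes "s \<noteq> 0"
  shows lebesgue_stretch: "(lebesgue :: 'd::{finite,linorder} pt measure) =
      density (distr lebesgue lebesgue (stretch s)) (\<lambda>_. ennreal \<bar>s\<bar>)"
    and stretch_lebesgue_measurable: "(stretch s :: 'd pt \<Rightarrow> 'd pt) \<in> lebesgue \<rightarrow>\<^sub>M lebesgue"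
proof -
  define e where "e = (axis idx1 1 :: 'd pt)"
  define c where "c j = (if j = e then s else 1)" for j :: "'d pt"
  have e: "e \<in> Basis" by (simp add: e_def axis_in_Basis_iff)
  have c: "c j \<noteq> 0" if "j \<in> Basis" for j using assms by (simp add: c_def)
  have st: "stretch s = (\<lambda>x. 0 + (\<Sum>j\<in>Basis. (c j * (x \<bullet> j)) *\<^sub>R j))"
  proof
    fix x :: "'d pt"
    have "stretch s x \<bullet> j = (0 + (\<Sum>j\<in>Basis. (c j * (x \<bullet> j)) *\<^sub>R j)) \<bullet> j" if j: "j \<in> Basis" for j
    proof -
      obtain i where "j = axis i 1" using j by (auto simp: Basis_vec_def)
      then have "stretch s x \<bullet> j = c j * (x \<bullet> j)"
        by (auto simp: c_def e_def inner_axis stretch_nth axis_eq_axis)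
      then show ?thesis using j by (simp add: inner_sum_left inner_Basis if_distrib cong: if_cong)
    qed
    then show "stretch s x = 0 + (\<Sum>j\<in>Basis. (c j * (x \<bullet> j)) *\<^sub>R j)"
      by (rule euclidean_eqI)
  qed
  have pr: "(\<Prod>j\<in>Basis. \<bar>c j\<bar>) = \<bar>s\<bar>"
  proof -
    have "(\<Prod>j\<in>Basis. \<bar>c j\<bar>) = (\<Prod>j\<in>Basis. if j = e then \<bar>s\<bar> else 1)"
      by (intro prod.cong) (auto simp: c_def)
    also have "\<dots> = \<bar>s\<bar>" using e by (subst prod.delta) auto
    finally show ?thesis .
  qed
  show "(lebesgue :: 'd pt measure) = density (distr lebesgue lebesgue (stretch s)) (\<lambda>_. ennreal \<bar>s\<bar>)"
    using lebesgue_affine_euclidean[of c 0, OF c] unfolding st pr[symmetric] .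
  show "(stretch s :: 'd pt \<Rightarrow> 'd pt) \<in> lebesgue \<rightarrow>\<^sub>M lebesgue"
    using lebesgue_affine_measurable[of c 0, OF c] unfolding st .
qed

lemma integral_stretch:
  fixes f :: "'d::{finite,linorder} pt \<Rightarrow> 'b::{banach,second_countable_topology}"
  assumes s: "s \<noteq> 0" and f: "f \<in> borel_measurable lebesgue"
  shows "(LINT x|lebesgue. f x) = \<bar>s\<bar> *\<^sub>R (LINT x|lebesgue. f (stretch s x))"
    and "integrable lebesgue (\<lambda>x. f (stretch s x)) \<longleftrightarrow> integrable lebesgue f"
proof -
  note m = stretch_lebesgue_measurable[OF s]
  have f': "f \<in> borel_measurable (distr lebesgue lebesgue (stretch s))" using f by simp
  have "(LINT x|lebesgue. f x) =
      (LINT x|density (distr lebesgue lebesgue (stretch s)) (\<lambda>_. ennreal \<bar>s\<bar>). f x)"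
    by (rule arg_cong[OF lebesgue_stretch[OF s], of "\<lambda>M. integral\<^sup>L M f"])
  also have "\<dots> = \<bar>s\<bar> *\<^sub>R (LINT x|lebesgue. f (stretch s x))"
    using f' by (simp add: integral_density integral_distr[OF m f])
  finally show "(LINT x|lebesgue. f x) = \<bar>s\<bar> *\<^sub>R (LINT x|lebesgue. f (stretch s x))" .
  have "integrable lebesgue f \<longleftrightarrow>
      integrable (density (distr lebesgue lebesgue (stretch s)) (\<lambda>_. ennreal \<bar>s\<bar>)) f"
    by (rule arg_cong[OF lebesgue_stretch[OF s], of "\<lambda>M. integrable M f"])
  also have "\<dots> \<longleftrightarrow> integrable (distr lebesgue lebesgue (stretch s)) (\<lambda>x. \<bar>s\<bar> *\<^sub>R f x)"
    using f' by (simp add: integrable_density)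
  also have "\<dots> \<longleftrightarrow> integrable (distr lebesgue lebesgue (stretch s)) f"
  proof
    assume "integrable (distr lebesgue lebesgue (stretch s)) (\<lambda>x. \<bar>s\<bar> *\<^sub>R f x)"
    from integrable_scaleR_right[OF this, of "inverse \<bar>s\<bar>"]
    show "integrable (distr lebesgue lebesgue (stretch s)) f" using s by simp
  qed (rule integrable_scaleR_right)
  also have "\<dots> \<longleftrightarrow> integrable lebesgue (\<lambda>x. f (stretch s x))"
    by (rule integrable_distr_eq[OF m f])
  finally show "integrable lebesgue (\<lambda>x. f (stretch s x)) \<longleftrightarrow> integrable lebesgue f" by simp
qed

lemma measurable_stretch:
  assumes "s \<noteq> 0" "f \<in> borel_measurable lebesgue"
  shows "(\<lambda>x. f (stretch s x)) \<in> borel_measurable lebesgue"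
  using measurable_compose[OF stretch_lebesgue_measurable[OF assms(1)] assms(2)] .

lemma open_upper_half: "open (upper_half :: 'd::{finite,linorder} pt set)"
  unfolding upper_half_def by (rule open_halfspace_component_gt_cart)

text \<open>
  The definition of a weak derivative in the half space may be tested with a function that does
  not vanish near the boundary, provided that its normal derivatives of order less than \<open>\<alpha>\<^sub>1\<close>
  vanish there. Such a \<open>\<Psi>\<close> is multiplied by the cutoff \<open>\<eta> (y\<^sub>1 / r)\<close>: the result is an admissible
  test function, its derivative of order \<open>\<alpha>\<close> is bounded uniformly in \<open>r\<close> (by the growth of the
  normal derivatives of \<open>\<Psi>\<close> away from the boundary) and agrees with that of \<open>\<Psi>\<close> on
  \<open>y\<^sub>1 > 2 r\<close>. Dominated convergence for \<open>r \<rightarrow> 0\<close> gives the claim.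
\<close>

lemma weak_deriv_vanishing_trace:
  fixes u v :: "'d::{finite,linorder} pt \<Rightarrow> 'b::{banach,second_countable_topology}"
  assumes v: "has_weak_deriv upper_half \<alpha> u v"
    and int: "integrable (lebesgue_on upper_half) u" "integrable (lebesgue_on upper_half) v"
    and \<Psi>: "smooth \<Psi>" "compact (closure {x. \<Psi> x \<noteq> (0::real)})"
    and tr: "\<And>j y. j < \<alpha> idx1 \<Longrightarrow> y $ idx1 = 0 \<Longrightarrow> mderiv (\<alpha>(idx1 := j)) \<Psi> y = 0"
  shows "(LINT x|lebesgue_on upper_half. mderiv \<alpha> \<Psi> x *\<^sub>R u x) =
    (-1) ^ mdeg \<alpha> *\<^sub>R (LINT x|lebesgue_on upper_half. \<Psi> x *\<^sub>R v x)"
proof -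
  define n where "n = \<alpha> idx1"
  define G where "G = iter_partial \<alpha> tangential \<Psi>"
  have G: "smooth G" unfolding G_def by (rule smooth_iter_partial[OF \<Psi>(1)])
  have mG: "mderiv \<alpha> \<Psi> = (partial idx1 ^^ n) G" by (simp add: mderiv_split G_def n_def)
  obtain C where C: "0 \<le> C" "\<And>x. \<bar>mderiv \<alpha> \<Psi> x\<bar> \<le> C"
    using mderiv_bounded[OF \<Psi>] by blast
  obtain B where B: "0 \<le> B" "\<And>x. \<bar>\<Psi> x\<bar> \<le> B"
    using bounded_if_compact_support[OF smooth_continuous_on[OF \<Psi>(1)] \<Psi>(2)]
      closure_subset[of "{x. \<Psi> x \<noteq> 0}"] by (metis (mono_tags, lifting) mem_Collect_eq subsetD)
  have growth: "\<bar>(partial idx1 ^^ j) G y\<bar> \<le> C * (y $ idx1) ^ (n - j)"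
    if "j \<le> n" "0 \<le> y $ idx1" for j y
  proof (rule normal_derivatives_growth[OF G _ _ that])
    show "(partial idx1 ^^ j) G y = 0" if "j < n" "y $ idx1 = 0" for j y
      using tr[of j y] that by (simp add: mderiv_upd_idx1 G_def n_def)
    show "\<bar>(partial idx1 ^^ n) G y\<bar> \<le> C" for y
      using C(2)[of y] by (simp add: mG)
  qed
  \<comment> \<open>The shift makes the cutoff vanish for \<open>y\<^sub>1 \<le> r\<close>, as compact support in the open half space
    demands.\<close>
  define \<eta> :: "real \<Rightarrow> real" where "\<eta> t = smooth_step (t + - 1)" for t
  have \<eta>: "smooth \<eta>"
    unfolding \<eta>_def using smooth_inner[of "1::real"]
    by (intro smooth_real_compose[OF smooth_smooth_step] smooth_add smooth_const) simp
  define \<Psi>' where "\<Psi>' r y = \<eta> (y $ idx1 / r) * \<Psi> y" for r y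
  have sm: "smooth (\<Psi>' r)" for r
    unfolding \<Psi>'_def by (intro smooth_mult smooth_scaled_nth \<eta> \<Psi>(1))
  have mder: "mderiv \<alpha> (\<Psi>' r) = (partial idx1 ^^ n) (\<lambda>y. \<eta> (y $ idx1 / r) * G y)" for r
    unfolding mderiv_split \<Psi>'_def G_def n_def
    by (subst iter_partial_cutoff[OF \<eta> \<Psi>(1) idx1_notin_tangential]) simp
  obtain M where M: "0 \<le> M" "\<forall>r C (H :: 'd pt \<Rightarrow> real). 0 < r \<longrightarrow> smooth H \<longrightarrow>
    (\<forall>j\<le>n. \<forall>y. 0 \<le> y $ idx1 \<and> y $ idx1 \<le> 2 * r \<longrightarrow>
        \<bar>(partial idx1 ^^ j) H y\<bar> \<le> C * r ^ (n - j)) \<longrightarrow>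
    (\<forall>y. 0 \<le> y $ idx1 \<and> y $ idx1 \<le> 2 * r \<longrightarrow>
        \<bar>(partial idx1 ^^ n) (\<lambda>y. \<eta> (y $ idx1 / r) * H y) y\<bar> \<le> M * C)"
    using normal_derivative_cutoff_bound[OF \<eta>, of n] by (elim exE conjE) (rule that)
  define K where "K = max C (M * (C * 2 ^ n))"
  have far: "mderiv \<alpha> (\<Psi>' r) y = mderiv \<alpha> \<Psi> y" and far0: "\<Psi>' r y = \<Psi> y"
    if "0 < r" "2 * r < y $ idx1" for r y
  proof -
    have *: "\<Psi>' r z = \<Psi> z" if "z \<in> {z. 2 * r < z $ idx1}" for z
    proof -
      have "1 \<le> z $ idx1 / r - 1" using that \<open>0 < r\<close> by (simp add: field_simps)
      then show ?thesis by (simp add: \<Psi>'_def \<eta>_def smooth_step_1)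
    qed
    show "\<Psi>' r y = \<Psi> y" using that by (intro *) simp
    have "open {z :: 'd pt. 2 * r < z $ idx1}"
      using open_halfspace_component_gt_cart[of "2 * r" idx1] by simp
    then show "mderiv \<alpha> (\<Psi>' r) y = mderiv \<alpha> \<Psi> y"
      by (rule mderiv_cong_open) (use * that in auto)
  qed
  have bound: "\<bar>mderiv \<alpha> (\<Psi>' r) y\<bar> \<le> K" if r: "0 < r" and y: "0 \<le> y $ idx1" for r y
  proof (cases "y $ idx1 \<le> 2 * r")
    case True
    have "\<bar>(partial idx1 ^^ j) G z\<bar> \<le> C * 2 ^ n * r ^ (n - j)"
      if "j \<le> n" "0 \<le> z $ idx1" "z $ idx1 \<le> 2 * r" for j z
    proof -
      have "(z $ idx1) ^ (n - j) \<le> (2 * r) ^ (n - j)" using that by (intro power_mono) auto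
      also have "\<dots> = 2 ^ (n - j) * r ^ (n - j)" by (rule power_mult_distrib)
      also have "\<dots> \<le> 2 ^ n * r ^ (n - j)"
        using r by (intro mult_right_mono power_increasing) auto
      finally have "C * (z $ idx1) ^ (n - j) \<le> C * (2 ^ n * r ^ (n - j))"
        using C(1) by (rule mult_left_mono)
      then show ?thesis using growth[of j z] that by (simp add: mult.assoc)
    qed
    then have "\<bar>mderiv \<alpha> (\<Psi>' r) y\<bar> \<le> M * (C * 2 ^ n)"
      unfolding mder by (intro M(2)[rule_format, OF r G]) (use True y in simp_all)
    then show ?thesis by (simp add: K_def)
  next
    case False
    then show ?thesis using far[OF r, of y] C(2)[of y] by (simp add: K_def)
  qed
  have bound0: "\<bar>\<Psi>' r y\<bar> \<le> B" for r y
  proof -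
    have "\<bar>\<eta> t\<bar> \<le> 1" for t unfolding \<eta>_def using smooth_step_range by (simp add: abs_le_iff)
    then show ?thesis unfolding \<Psi>'_def abs_mult
      using B by (meson abs_ge_zero mult_left_le_one_le order_trans)
  qed
  have test: "test_function upper_half (\<Psi>' r)" if r: "0 < r" for r
  proof -
    have sub: "closure {x. \<Psi>' r x \<noteq> 0} \<subseteq> closure {x. \<Psi> x \<noteq> 0} \<inter> {x. r \<le> x $ idx1}"
    proof (rule closure_minimal)
      show "{x. \<Psi>' r x \<noteq> 0} \<subseteq> closure {x. \<Psi> x \<noteq> 0} \<inter> {x. r \<le> x $ idx1}"
      proof
        fix x assume "x \<in> {x. \<Psi>' r x \<noteq> 0}"
        then have nz: "\<Psi> x \<noteq> 0" "\<eta> (x $ idx1 / r) \<noteq> 0" by (auto simp: \<Psi>'_def)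
        then have "x $ idx1 / r + - 1 > 0"
          using smooth_step_0[of "x $ idx1 / r + - 1"] unfolding \<eta>_def by linarith
        then show "x \<in> closure {x. \<Psi> x \<noteq> 0} \<inter> {x. r \<le> x $ idx1}"
          using nz(1) r closure_subset[of "{x. \<Psi> x \<noteq> 0}"] by (auto simp: field_simps)
      qed
      show "closed (closure {x. \<Psi> x \<noteq> 0} \<inter> {x. r \<le> x $ idx1})"
        using closed_halfspace_component_ge_cart[of r idx1] by (intro closed_Int closed_closure) simp
    qed
    have "compact (closure {x. \<Psi>' r x \<noteq> 0})"
      using sub \<Psi>(2) by (meson bounded_subset closed_closure compact_eq_bounded_closed le_inf_iff)
    moreover have "closure {x. \<Psi>' r x \<noteq> 0} \<subseteq> upper_half"
      using sub r by (auto simp: upper_half_def)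
    ultimately show ?thesis using sm by (simp add: test_function_def)
  qed
  define r where "r k = inverse (real (Suc k))" for k
  have r: "0 < r k" for k by (simp add: r_def)
  have ev: "\<forall>\<^sub>F k in sequentially. 2 * r k < t" if "0 < t" for t
    using order_tendstoD(2)[OF LIMSEQ_inverse_real_of_nat, of "t / 2"] that
    by (auto simp: r_def field_simps elim!: eventually_mono)
  have upper: "x \<in> upper_half \<longleftrightarrow> 0 < x $ idx1" for x :: "'d pt" by (simp add: upper_half_def)
  have open_leb: "upper_half \<in> sets lebesgue" by (rule open_lebesgue[OF open_upper_half])
  have lim1: "(\<lambda>k. LINT x|lebesgue_on upper_half. mderiv \<alpha> (\<Psi>' (r k)) x *\<^sub>R u x) \<longlonglongrightarrow>
      (LINT x|lebesgue_on upper_half. mderiv \<alpha> \<Psi> x *\<^sub>R u x)"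
  proof (rule integral_dominated_convergence)
    show "(\<lambda>x. mderiv \<alpha> \<Psi> x *\<^sub>R u x) \<in> borel_measurable (lebesgue_on upper_half)"
      by (intro borel_measurable_scaleR measurable_restrict_space1 smooth_measurable smooth_mderiv
          \<Psi>(1) borel_measurable_integrable[OF int(1)])
    show "(\<lambda>x. mderiv \<alpha> (\<Psi>' (r k)) x *\<^sub>R u x) \<in> borel_measurable (lebesgue_on upper_half)" for k
      by (intro borel_measurable_scaleR measurable_restrict_space1 smooth_measurable smooth_mderiv
          sm borel_measurable_integrable[OF int(1)])
    show "integrable (lebesgue_on upper_half) (\<lambda>x. K * norm (u x))" using int(1) by simp
    show "AE x in lebesgue_on upper_half. norm (mderiv \<alpha> (\<Psi>' (r k)) x *\<^sub>R u x) \<le> K * norm (u x)" for k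
      using bound[OF r] by (intro AE_I2) (auto simp: upper intro!: mult_right_mono)
    show "AE x in lebesgue_on upper_half. (\<lambda>k. mderiv \<alpha> (\<Psi>' (r k)) x *\<^sub>R u x) \<longlonglongrightarrow> mderiv \<alpha> \<Psi> x *\<^sub>R u x"
    proof (rule AE_I2)
      fix x :: "'d pt" assume "x \<in> space (lebesgue_on upper_half)"
      then have "0 < x $ idx1" by (simp add: upper)
      from ev[OF this] show "(\<lambda>k. mderiv \<alpha> (\<Psi>' (r k)) x *\<^sub>R u x) \<longlonglongrightarrow> mderiv \<alpha> \<Psi> x *\<^sub>R u x"
        by (intro tendsto_eventually) (auto elim!: eventually_mono simp: far[OF r])
    qed
  qed
  have lim2: "(\<lambda>k. LINT x|lebesgue_on upper_half. \<Psi>' (r k) x *\<^sub>R v x) \<longlonglongrightarrow>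
      (LINT x|lebesgue_on upper_half. \<Psi> x *\<^sub>R v x)"
  proof (rule integral_dominated_convergence)
    show "(\<lambda>x. \<Psi> x *\<^sub>R v x) \<in> borel_measurable (lebesgue_on upper_half)"
      by (intro borel_measurable_scaleR measurable_restrict_space1 smooth_measurable
          \<Psi>(1) borel_measurable_integrable[OF int(2)])
    show "(\<lambda>x. \<Psi>' (r k) x *\<^sub>R v x) \<in> borel_measurable (lebesgue_on upper_half)" for k
      by (intro borel_measurable_scaleR measurable_restrict_space1 smooth_measurable
          sm borel_measurable_integrable[OF int(2)])
    show "integrable (lebesgue_on upper_half) (\<lambda>x. B * norm (v x))" using int(2) by simp
    show "AE x in lebesgue_on upper_half. norm (\<Psi>' (r k) x *\<^sub>R v x) \<le> B * norm (v x)" for k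
      using bound0 by (intro AE_I2) (auto intro!: mult_right_mono)
    show "AE x in lebesgue_on upper_half. (\<lambda>k. \<Psi>' (r k) x *\<^sub>R v x) \<longlonglongrightarrow> \<Psi> x *\<^sub>R v x"
    proof (rule AE_I2)
      fix x :: "'d pt" assume "x \<in> space (lebesgue_on upper_half)"
      then have "0 < x $ idx1" by (simp add: upper)
      from ev[OF this] show "(\<lambda>k. \<Psi>' (r k) x *\<^sub>R v x) \<longlonglongrightarrow> \<Psi> x *\<^sub>R v x"
        by (intro tendsto_eventually) (auto elim!: eventually_mono simp: far0[OF r])
    qed
  qed
  have "(LINT x|lebesgue_on upper_half. mderiv \<alpha> (\<Psi>' (r k)) x *\<^sub>R u x) =
      (-1) ^ mdeg \<alpha> *\<^sub>R (LINT x|lebesgue_on upper_half. \<Psi>' (r k) x *\<^sub>R v x)" for k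
    by (rule has_weak_derivD(3)[OF v test[OF r]])
  then have "(\<lambda>k. LINT x|lebesgue_on upper_half. mderiv \<alpha> (\<Psi>' (r k)) x *\<^sub>R u x) \<longlonglongrightarrow>
      (-1) ^ mdeg \<alpha> *\<^sub>R (LINT x|lebesgue_on upper_half. \<Psi> x *\<^sub>R v x)"
    using tendsto_scaleR[OF tendsto_const lim2] by simp
  with lim1 show ?thesis by (rule LIMSEQ_unique)
qed

section \<open>Higher-order reflection\<close>

text \<open>
  Index \<open>0\<close> stands for the identity with weight \<open>1\<close>, index \<open>k \<ge> 1\<close> for the map
  \<open>y \<mapsto> (- y\<^sub>1 / k, y')\<close> with weight \<open>c k\<close>. A function and its reflections then form a single sum.
\<close>

definition refl_factor :: "nat \<Rightarrow> real" where
  "refl_factor k = (if k = 0 then 1 else - 1 / real k)"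

definition refl_weight :: "(nat \<Rightarrow> real) \<Rightarrow> nat \<Rightarrow> real" where
  "refl_weight c k = (if k = 0 then 1 else c k)"

text \<open>
  The higher-order reflection of Lichtenstein and Hestenes, for functions \<open>g\<close> that vanish outside
  the upper half space: there only the term \<open>k = 0\<close> contributes for \<open>y\<^sub>1 > 0\<close>, and only the terms
  \<open>k \<ge> 1\<close> for \<open>y\<^sub>1 \<le> 0\<close>. The exponent \<open>n\<close> is the number of normal derivatives that
  have been taken: by the chain rule, the derivative of order \<open>\<alpha>\<close> of the extension of \<open>u\<close> should be
  the extension, with \<open>n = \<alpha>\<^sub>1\<close>, of the derivative of \<open>u\<close>.
\<close>

definition reflect_ext ::
  "(nat \<Rightarrow> real) \<Rightarrow> nat \<Rightarrow> nat \<Rightarrow> ('d::{finite,linorder} pt \<Rightarrow> 'b::real_vector) \<Rightarrow> 'd pt \<Rightarrow> 'b" where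
  "reflect_ext c m n g y =
     (\<Sum>k\<le>m. (refl_weight c k * refl_factor k ^ n) *\<^sub>R g (stretch (refl_factor k) y))"

lemma refl_factor_nz: "refl_factor k \<noteq> 0"
  by (simp add: refl_factor_def)

text \<open>
  With \<open>t = - 1 / k\<close> one has \<open>k = - t\<^sup>-\<^sup>1\<close>, so the sum over \<open>k \<ge> 1\<close> is
  \<open>- (\<Sum>k. c k * t\<^sup>n\<^sup>-\<^sup>1\<^sup>-\<^sup>j)\<close>, which is \<open>- 1\<close> because the exponent \<open>n - 1 - j\<close> is
  less than \<open>m\<close>; it cancels the term \<open>k = 0\<close>.
\<close>

lemma refl_moments:
  assumes c: "\<And>j. j < m \<Longrightarrow> (\<Sum>k = 1..m. (- 1 / real k) ^ j * c k) = 1" and "j < n" "n \<le> m"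
  shows "(\<Sum>k\<le>m. refl_weight c k * \<bar>inverse (refl_factor k)\<bar> * refl_factor k ^ n *
      inverse (refl_factor k) ^ j) = 0"
proof -
  let ?f = "\<lambda>k. refl_weight c k * \<bar>inverse (refl_factor k)\<bar> * refl_factor k ^ n *
      inverse (refl_factor k) ^ j"
  obtain p where n: "n = Suc (j + p)" using \<open>j < n\<close> less_imp_Suc_add by blast
  have "{..m} = insert 0 {1..m}" by auto
  then have "sum ?f {..m} = ?f 0 + sum ?f {1..m}" by simp
  also have "?f 0 = 1" by (simp add: refl_weight_def refl_factor_def)
  also have "sum ?f {1..m} = (\<Sum>k=1..m. - ((- 1 / real k) ^ p * c k))"
  proof (rule sum.cong)
    fix k assume "k \<in> {1..m}"
    then have k: "k \<noteq> 0" by simp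
    let ?t = "- 1 / real k"
    have "\<bar>inverse ?t\<bar> * ?t ^ n * inverse ?t ^ j = (\<bar>inverse ?t\<bar> * ?t) * ?t ^ p * (?t * inverse ?t) ^ j"
      unfolding n power_mult_distrib by (simp only: power_Suc power_add mult_ac)
    also have "?t * inverse ?t = 1" using k by simp
    also have "\<bar>inverse ?t\<bar> * ?t = - 1" using k by simp
    finally have "\<bar>inverse ?t\<bar> * ?t ^ n * inverse ?t ^ j = - (?t ^ p)" by simp
    then have "c k * (\<bar>inverse ?t\<bar> * ?t ^ n * inverse ?t ^ j) = - (?t ^ p * c k)" by simp
    then show "?f k = - (?t ^ p * c k)"
      using k by (simp add: refl_weight_def refl_factor_def mult.assoc)
  qed simp
  also have "\<dots> = - 1" unfolding sum_negf using c[of p] n \<open>n \<le> m\<close> by simp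
  finally show ?thesis by simp
qed

lemma integrable_loc_integrable:
  fixes f :: "'a::euclidean_space \<Rightarrow> 'b::{banach,second_countable_topology}"
  shows "integrable lebesgue f \<Longrightarrow> loc_integrable D f"
  unfolding loc_integrable_def
  by (auto simp: integrable_restrict_space compact_lebesgue intro!: integrable_mult_indicator)

lemma integrable_reflect_ext:
  fixes g :: "'d::{finite,linorder} pt \<Rightarrow> 'b::{banach,second_countable_topology}"
  assumes "integrable lebesgue g"
  shows "integrable lebesgue (reflect_ext c m n g)"
  unfolding reflect_ext_def[abs_def] using assms
  by (intro Bochner_Integration.integrable_sum integrable_scaleR_right)
     (simp add: integral_stretch(2) refl_factor_nz borel_measurable_integrable)

text \<open>
  By a change of variables the reflection is moved from the function to the test function: the
  pairing of \<open>\<psi>\<close> with the extension over the whole space is the pairing over the upper half space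
  of the original function with a combination \<open>\<Psi>\<close> of stretched copies of \<open>\<psi>\<close>. On \<open>y\<^sub>1 = 0\<close> all
  the copies coincide up to powers of the stretching factors, and \<open>refl_moments\<close> says that the
  normal derivatives of \<open>\<Psi>\<close> of order less than \<open>\<alpha>\<^sub>1\<close> vanish, as \<open>weak_deriv_vanishing_trace\<close>
  requires.
\<close>

lemma weak_deriv_reflect_ext:
  fixes u v :: "'d::{finite,linorder} pt \<Rightarrow> 'b::{banach,second_countable_topology}"
  assumes v: "has_weak_deriv upper_half \<alpha> u v"
    and int: "integrable lebesgue u" "integrable lebesgue v"
    and zero: "\<And>y. y \<notin> upper_half \<Longrightarrow> u y = 0" "\<And>y. y \<notin> upper_half \<Longrightarrow> v y = 0"
    and c: "\<And>j. j < m \<Longrightarrow> (\<Sum>k = 1..m. (- 1 / real k) ^ j * c k) = 1"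
    and \<alpha>: "\<alpha> idx1 \<le> m"
  shows "has_weak_deriv UNIV \<alpha> (reflect_ext c m 0 u) (reflect_ext c m (\<alpha> idx1) v)"
  unfolding has_weak_deriv_def
proof (intro conjI allI impI integrable_loc_integrable integrable_reflect_ext int)
  fix \<psi> :: "'d pt \<Rightarrow> real" assume t: "test_function UNIV \<psi>"
  define n where "n = \<alpha> idx1"
  have \<psi>: "smooth \<psi>" "compact (closure {x. \<psi> x \<noteq> 0})"
    using t by (simp_all add: test_function_def)
  let ?t = refl_factor and ?s = "\<lambda>k. inverse (refl_factor k)"
  have s_nz: "?s k \<noteq> 0" for k by (simp add: refl_factor_nz)
  define d where "d k = refl_weight c k * \<bar>?s k\<bar> * ?t k ^ n" for k
  define \<Psi> where "\<Psi> x = (\<Sum>k\<le>m. d k * \<psi> (stretch (?s k) x))" for x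
  have sm: "smooth (\<lambda>x. \<psi> (stretch a x))" for a by (rule smooth_stretch[OF \<psi>(1)])
  have mder: "mderiv \<beta> \<Psi> x = (\<Sum>k\<le>m. d k * (?s k ^ \<beta> idx1 * mderiv \<beta> \<psi> (stretch (?s k) x)))" for \<beta> x
    unfolding \<Psi>_def mderiv_sum[OF sm] mderiv_stretch[OF \<psi>(1)] ..
  \<comment> \<open>Moving the reflection from \<open>w\<close> to the function \<open>p\<close> by which it is multiplied; used with
    \<open>p = mderiv \<alpha> \<psi>\<close> and with \<open>p = \<psi>\<close>.\<close>
  have cv: "(LINT x|lebesgue. p x *\<^sub>R reflect_ext c m j w x) =
      (LINT x|lebesgue_on upper_half. (\<Sum>k\<le>m. (refl_weight c k * \<bar>?s k\<bar> * ?t k ^ j) * p (stretch (?s k) x)) *\<^sub>R w x)"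
    if p: "p \<in> borel_measurable lebesgue" "\<And>x. \<bar>p x\<bar> \<le> B"
      and w: "integrable lebesgue w" "\<And>y. y \<notin> upper_half \<Longrightarrow> w y = 0"
    for p :: "'d pt \<Rightarrow> real" and B j and w :: "'d pt \<Rightarrow> 'b"
  proof -
    have i1: "integrable lebesgue (\<lambda>x. p x *\<^sub>R w (stretch (?t k) x))" for k
      by (rule integrable_bounded_mult[OF p])
         (simp add: integral_stretch(2)[OF refl_factor_nz borel_measurable_integrable[OF w(1)]] w(1))
    have i2: "integrable lebesgue (\<lambda>x. p (stretch (?s k) x) *\<^sub>R w x)" for k
      by (rule integrable_bounded_mult[OF measurable_stretch[OF s_nz p(1)] p(2) w(1)])
    have one: "(LINT x|lebesgue. p x *\<^sub>R w (stretch (?t k) x)) =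
        \<bar>?s k\<bar> *\<^sub>R (LINT x|lebesgue. p (stretch (?s k) x) *\<^sub>R w x)" for k
      using integral_stretch(1)[OF s_nz borel_measurable_integrable[OF i1], of k k]
      by (simp add: stretch_stretch refl_factor_nz stretch_one)
    have "(LINT x|lebesgue. p x *\<^sub>R reflect_ext c m j w x) =
        (LINT x|lebesgue. (\<Sum>k\<le>m. (refl_weight c k * ?t k ^ j) *\<^sub>R (p x *\<^sub>R w (stretch (?t k) x))))"
      by (simp add: reflect_ext_def scaleR_sum_right mult_ac)
    also have "\<dots> = (\<Sum>k\<le>m. (refl_weight c k * ?t k ^ j) *\<^sub>R (LINT x|lebesgue. p x *\<^sub>R w (stretch (?t k) x)))"
      by (subst Bochner_Integration.integral_sum)
         (intro integrable_scaleR_right i1, intro sum.cong refl integral_scaleR_right i1)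
    also have "\<dots> = (\<Sum>k\<le>m. (refl_weight c k * \<bar>?s k\<bar> * ?t k ^ j) *\<^sub>R (LINT x|lebesgue. p (stretch (?s k) x) *\<^sub>R w x))"
      by (simp only: one scaleR_scaleR mult_ac)
    also have "\<dots> = (LINT x|lebesgue. (\<Sum>k\<le>m. (refl_weight c k * \<bar>?s k\<bar> * ?t k ^ j) *\<^sub>R (p (stretch (?s k) x) *\<^sub>R w x)))"
      by (subst Bochner_Integration.integral_sum)
         (intro integrable_scaleR_right i2, intro sum.cong refl integral_scaleR_right[symmetric] i2)
    also have "\<dots> = (LINT x|lebesgue. indicator upper_half x *\<^sub>R
        ((\<Sum>k\<le>m. (refl_weight c k * \<bar>?s k\<bar> * ?t k ^ j) * p (stretch (?s k) x)) *\<^sub>R w x))"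
      using w(2) by (intro Bochner_Integration.integral_cong) (auto simp: indicator_def scaleR_sum_left)
    also have "\<dots> = (LINT x|lebesgue_on upper_half.
        (\<Sum>k\<le>m. (refl_weight c k * \<bar>?s k\<bar> * ?t k ^ j) * p (stretch (?s k) x)) *\<^sub>R w x)"
      by (rule lebesgue_on_integral(1)[symmetric, OF open_lebesgue[OF open_upper_half]])
    finally show ?thesis .
  qed
  obtain B where B: "\<And>x. \<bar>\<psi> x\<bar> \<le> B"
    using bounded_if_compact_support[OF smooth_continuous_on[OF \<psi>(1)] \<psi>(2)] test_function_outside[OF t] by blast
  obtain B' where B': "\<And>x. \<bar>mderiv \<alpha> \<psi> x\<bar> \<le> B'" using mderiv_bounded[OF \<psi>] by blast
  have "smooth \<Psi>"
    unfolding \<Psi>_def by (intro smooth_sum smooth_mult smooth_const sm)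
  moreover have "compact (closure {x. \<Psi> x \<noteq> 0})"
  proof -
    let ?K = "\<Union>k\<le>m. stretch (?t k) ` closure {x. \<psi> x \<noteq> 0}"
    have "continuous_on S (stretch a :: 'd pt \<Rightarrow> 'd pt)" for S a
      by (rule linear_continuous_on[OF linear_linear[THEN iffD2, OF linear_stretch]])
    then have K: "compact ?K"
      by (intro compact_UN compact_continuous_image \<psi>(2)) auto
    have "{x. \<Psi> x \<noteq> 0} \<subseteq> ?K"
    proof
      fix x assume "x \<in> {x. \<Psi> x \<noteq> 0}"
      then obtain k where k: "k \<le> m" "\<psi> (stretch (?s k) x) \<noteq> 0"
        unfolding \<Psi>_def using sum.neutral[of "{..m}" "\<lambda>k. d k * \<psi> (stretch (?s k) x)"] by auto
      have "x = stretch (?t k) (stretch (?s k) x)"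
        by (simp add: stretch_stretch refl_factor_nz stretch_one)
      moreover have "stretch (?s k) x \<in> closure {x. \<psi> x \<noteq> 0}"
        using k(2) closure_subset[of "{x. \<psi> x \<noteq> 0}"] by auto
      ultimately show "x \<in> ?K" using k(1) by blast
    qed
    then have "closure {x. \<Psi> x \<noteq> 0} \<subseteq> ?K"
      by (intro closure_minimal compact_imp_closed K)
    then show ?thesis using K by (meson bounded_subset closed_closure compact_eq_bounded_closed)
  qed
  moreover have "mderiv (\<alpha>(idx1 := j)) \<Psi> y = 0" if "j < \<alpha> idx1" "y $ idx1 = 0" for j y
  proof -
    have "stretch a y = y" for a using that(2) by (simp add: vec_eq_iff stretch_nth)
    then have "mderiv (\<alpha>(idx1 := j)) \<Psi> y = (\<Sum>k\<le>m. d k * ?s k ^ j) * mderiv (\<alpha>(idx1 := j)) \<psi> y"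
      by (simp only: mder sum_distrib_right mult.assoc fun_upd_same)
    also have "(\<Sum>k\<le>m. d k * ?s k ^ j) = 0"
      unfolding d_def n_def using refl_moments[OF c that(1) \<alpha>] by simp
    finally show ?thesis by (simp only: mult_zero_left)
  qed
  moreover have "integrable (lebesgue_on upper_half) u" "integrable (lebesgue_on upper_half) v"
    using int by (auto simp: integrable_restrict_space open_lebesgue open_upper_half
        intro!: integrable_mult_indicator)
  ultimately have main: "(LINT x|lebesgue_on upper_half. mderiv \<alpha> \<Psi> x *\<^sub>R u x) =
    (-1) ^ mdeg \<alpha> *\<^sub>R (LINT x|lebesgue_on upper_half. \<Psi> x *\<^sub>R v x)"
    by (intro weak_deriv_vanishing_trace[OF v])
  have der: "mderiv \<alpha> \<Psi> x = (\<Sum>k\<le>m. (refl_weight c k * \<bar>?s k\<bar> * ?t k ^ 0) * mderiv \<alpha> \<psi> (stretch (?s k) x))" for x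
  proof -
    have eq: "d k * (?s k ^ n * z) = refl_weight c k * \<bar>?s k\<bar> * z" for k z
    proof -
      have "?t k ^ n * ?s k ^ n = 1"
        by (simp add: power_mult_distrib[symmetric] refl_factor_nz)
      then have "d k * (?s k ^ n * z) = refl_weight c k * \<bar>?s k\<bar> * z * (?t k ^ n * ?s k ^ n)"
        unfolding d_def by (simp only: mult_ac)
      then show ?thesis using \<open>?t k ^ n * ?s k ^ n = 1\<close> by simp
    qed
    show ?thesis by (simp only: mder n_def[symmetric] eq power_0 mult_1_right)
  qed
  have "(LINT x|lebesgue. mderiv \<alpha> \<psi> x *\<^sub>R reflect_ext c m 0 u x) =
      (LINT x|lebesgue_on upper_half. mderiv \<alpha> \<Psi> x *\<^sub>R u x)"
    unfolding der by (rule cv[OF smooth_measurable[OF smooth_mderiv[OF \<psi>(1)]] B' int(1) zero(1)])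
  moreover have "(LINT x|lebesgue. \<psi> x *\<^sub>R reflect_ext c m n v x) =
      (LINT x|lebesgue_on upper_half. \<Psi> x *\<^sub>R v x)"
    unfolding \<Psi>_def d_def by (rule cv[OF smooth_measurable[OF \<psi>(1)] B int(2) zero(2)])
  ultimately show "(LINT x|lebesgue_on UNIV. mderiv \<alpha> \<psi> x *\<^sub>R reflect_ext c m 0 u x) =
      (-1) ^ mdeg \<alpha> *\<^sub>R (LINT x|lebesgue_on UNIV. \<psi> x *\<^sub>R reflect_ext c m (\<alpha> idx1) v x)"
    using main by (simp add: lebesgue_on_UNIV_eq n_def)
qed

section \<open>Square integrable functions\<close>

text \<open>
  The space \<open>L\<^sub>2\<close> over a measure; \<open>in_Lp 2\<close> is the case of \<open>lebesgue_on\<close>.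
\<close>

definition sq_integrable ::
  "'a measure \<Rightarrow> ('a \<Rightarrow> 'b::{banach,second_countable_topology}) \<Rightarrow> bool" where
  "sq_integrable M f \<longleftrightarrow> f \<in> borel_measurable M \<and> integrable M (\<lambda>x. (norm (f x))\<^sup>2)"

lemma in_Lp_2_iff: "in_Lp 2 D f \<longleftrightarrow> sq_integrable (lebesgue_on D) f"
  by (simp add: in_Lp_def sq_integrable_def)

lemma sq_integrable_bound:
  assumes "sq_integrable M f" "h \<in> borel_measurable M" "AE x in M. norm (h x) \<le> B * norm (f x)"
  shows "sq_integrable M h"
proof -
  have "integrable M (\<lambda>x. (norm (h x))\<^sup>2)"
  proof (rule Bochner_Integration.integrable_bound)
    show "integrable M (\<lambda>x. B\<^sup>2 * (norm (f x))\<^sup>2)"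
      using assms(1) by (simp add: sq_integrable_def)
    show "AE x in M. norm ((norm (h x))\<^sup>2) \<le> norm (B\<^sup>2 * (norm (f x))\<^sup>2)"
      using assms(3)
    proof eventually_elim
      case (elim x)
      then have "(norm (h x))\<^sup>2 \<le> (B * norm (f x))\<^sup>2" by (intro power_mono) auto
      then show ?case by (simp add: power_mult_distrib)
    qed
  qed (use assms(2) in simp)
  then show ?thesis using assms(2) by (simp add: sq_integrable_def)
qed

lemma sq_integrable_add:
  assumes "sq_integrable M f" "sq_integrable M g"
  shows "sq_integrable M (\<lambda>x. f x + g x)"
proof -
  have m: "f \<in> borel_measurable M" "g \<in> borel_measurable M"
    using assms by (auto simp: sq_integrable_def)
  have "integrable M (\<lambda>x. (norm (f x + g x))\<^sup>2)"
  proof (rule Bochner_Integration.integrable_bound)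
    show "integrable M (\<lambda>x. 2 * (norm (f x))\<^sup>2 + 2 * (norm (g x))\<^sup>2)"
      using assms by (simp add: sq_integrable_def)
    show "AE x in M. norm ((norm (f x + g x))\<^sup>2) \<le> norm (2 * (norm (f x))\<^sup>2 + 2 * (norm (g x))\<^sup>2)"
    proof (rule AE_I2)
      fix x
      have "(norm (f x + g x))\<^sup>2 \<le> (norm (f x) + norm (g x))\<^sup>2"
        by (intro power_mono norm_triangle_ineq) simp
      also have "\<dots> \<le> 2 * (norm (f x))\<^sup>2 + 2 * (norm (g x))\<^sup>2"
        using sum_squares_bound[of "norm (f x)" "norm (g x)"] by (simp add: power2_sum)
      finally show "norm ((norm (f x + g x))\<^sup>2) \<le> norm (2 * (norm (f x))\<^sup>2 + 2 * (norm (g x))\<^sup>2)"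
        by simp
    qed
  qed (use m in simp)
  then show ?thesis using m by (simp add: sq_integrable_def)
qed

lemma sq_integrable_scaleR:
  assumes "sq_integrable M f" shows "sq_integrable M (\<lambda>x. c *\<^sub>R f x)"
  by (rule sq_integrable_bound[OF assms, where B = "\<bar>c\<bar>"])
     (use assms in \<open>auto simp: sq_integrable_def\<close>)

lemma sq_integrable_diff:
  assumes "sq_integrable M f" "sq_integrable M g"
  shows "sq_integrable M (\<lambda>x. f x - g x)"
  using sq_integrable_add[OF assms(1) sq_integrable_scaleR[OF assms(2), of "-1"]] by simp

lemma sq_integrable_sum:
  "(\<And>i. i \<in> A \<Longrightarrow> sq_integrable M (f i)) \<Longrightarrow> sq_integrable M (\<lambda>x. \<Sum>i\<in>A. f i x)"
  by (induction A rule: infinite_finite_induct)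
     (auto intro: sq_integrable_add simp: sq_integrable_def[of M "\<lambda>_. 0"])

lemma sq_integrable_lebesgue_on:
  fixes f :: "'a::euclidean_space \<Rightarrow> 'b::{banach,second_countable_topology}"
  assumes "S \<in> sets lebesgue"
  shows "sq_integrable (lebesgue_on S) f \<longleftrightarrow> sq_integrable lebesgue (\<lambda>x. indicator S x *\<^sub>R f x)"
proof -
  have "(\<lambda>x. (norm (indicator S x *\<^sub>R f x))\<^sup>2) = (\<lambda>x. indicator S x *\<^sub>R (norm (f x))\<^sup>2)"
    by (auto simp: fun_eq_iff indicator_def)
  then show ?thesis
    unfolding sq_integrable_def lebesgue_on_integral(2)[OF assms] lebesgue_on_integral(3)[OF assms]
    by simp
qed

lemma sq_integrable_mono:
  fixes f :: "'a::euclidean_space \<Rightarrow> 'b::{banach,second_countable_topology}"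
  assumes "sq_integrable (lebesgue_on T) f" "S \<subseteq> T" "S \<in> sets lebesgue" "T \<in> sets lebesgue"
  shows "sq_integrable (lebesgue_on S) f"
proof -
  have f: "sq_integrable lebesgue (\<lambda>x. indicator T x *\<^sub>R f x)"
    using assms by (simp add: sq_integrable_lebesgue_on)
  have "sq_integrable lebesgue (\<lambda>x. indicator S x *\<^sub>R (indicator T x *\<^sub>R f x))"
  proof (rule sq_integrable_bound[OF f, where B = 1])
    have "(\<lambda>x. indicator T x *\<^sub>R f x) \<in> borel_measurable lebesgue"
      using f by (simp only: sq_integrable_def)
    then show "(\<lambda>x. indicator S x *\<^sub>R (indicator T x *\<^sub>R f x)) \<in> borel_measurable lebesgue"
      by (rule borel_measurable_scaleR[OF borel_measurable_indicator[OF assms(3)]])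
  qed (auto simp: indicator_def)
  moreover have "indicator S x *\<^sub>R (indicator T x *\<^sub>R f x) = indicator S x *\<^sub>R f x" for x
    using assms(2) by (auto simp: indicator_def)
  ultimately show ?thesis using assms(3) by (simp only: sq_integrable_lebesgue_on)
qed

text \<open>
  Lebesgue measure is complete, so that measurability passes to almost everywhere equal functions.
  This makes chosen representatives such as \<open>wderiv\<close> measurable.
\<close>

lemma sq_integrable_AE_lebesgue_on:
  fixes f g :: "'a::euclidean_space \<Rightarrow> 'b::euclidean_space"
  assumes S: "S \<in> sets lebesgue" and f: "sq_integrable (lebesgue_on S) f"
    and ae: "AE x in lebesgue_on S. f x = g x"
  shows "sq_integrable (lebesgue_on S) g"
proof (rule sq_integrable_bound[OF f, where B = 1])
  have "(\<lambda>x. indicator S x *\<^sub>R f x) \<in> borel_measurable lebesgue"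
    using f unfolding sq_integrable_lebesgue_on[OF S] unfolding sq_integrable_def by blast
  then have "(\<lambda>x. indicator S x *\<^sub>R g x) \<in> borel_measurable lebesgue"
    by (rule borel_measurable_AE)
       (use ae in \<open>auto simp: AE_lebesgue_on_iff[OF S] indicator_def elim!: eventually_mono\<close>)
  then show "g \<in> borel_measurable (lebesgue_on S)"
    by (simp only: lebesgue_on_integral(3)[OF S])
qed (use ae in \<open>auto elim!: eventually_mono\<close>)

lemma sq_integrable_integrable:
  fixes f :: "'a::euclidean_space \<Rightarrow> 'b::{banach,second_countable_topology}"
  assumes f: "sq_integrable (lebesgue_on S) f" and S: "S \<in> lmeasurable"
  shows "integrable (lebesgue_on S) f"
proof (rule Bochner_Integration.integrable_bound)
  interpret finite_measure "lebesgue_on S" using S by (rule finite_measure_lebesgue_on)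
  show "integrable (lebesgue_on S) (\<lambda>x. 1 + (norm (f x))\<^sup>2)"
    using f by (intro Bochner_Integration.integrable_add integrable_const) (simp add: sq_integrable_def)
  show "f \<in> borel_measurable (lebesgue_on S)" using f by (simp add: sq_integrable_def)
  have "t \<le> 1 + t\<^sup>2" for t :: real
    using zero_le_power2[of "t - 1/2"] by (simp add: power2_eq_square algebra_simps)
  then show "AE x in lebesgue_on S. norm (f x) \<le> norm (1 + (norm (f x))\<^sup>2)"
    by (intro AE_I2) (simp add: add_nonneg_nonneg)
qed

lemma sq_integrable_loc_integrable:
  fixes f :: "'a::euclidean_space \<Rightarrow> 'b::{banach,second_countable_topology}"
  assumes f: "sq_integrable (lebesgue_on S) f" and S: "S \<in> sets lebesgue"
  shows "loc_integrable S f"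
  unfolding loc_integrable_def
proof (intro allI impI)
  fix K :: "'a set" assume "compact K \<and> K \<subseteq> S"
  then show "integrable (lebesgue_on K) f"
    by (intro sq_integrable_integrable sq_integrable_mono[OF f _ _ S])
       (auto simp: lmeasurable_compact compact_lebesgue)
qed

lemma bounded_bilinear_dotp: "bounded_bilinear (dotp :: complex ^ 'n::finite \<Rightarrow> _)"
  unfolding bilinear_conv_bounded_bilinear[symmetric] bilinear_def
  by (intro conjI allI linearI)
     (auto simp: dotp_def algebra_simps sum.distrib scaleR_sum_right)

lemma bounded_bilinear_mv: "bounded_bilinear ((*v) :: complex ^ 'n::finite ^ 'n \<Rightarrow> _)"
  unfolding bilinear_conv_bounded_bilinear[symmetric] bilinear_def
  by (intro conjI allI linearI)
     (auto simp: vec_eq_iff matrix_vector_mult_def algebra_simps sum.distrib scaleR_sum_right)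

lemma measurable_bilinear:
  fixes f :: "'a \<Rightarrow> 'b::{real_normed_vector,second_countable_topology}"
    and g :: "'a \<Rightarrow> 'c::{real_normed_vector,second_countable_topology}"
    and B :: "'b \<Rightarrow> 'c \<Rightarrow> 'd::real_normed_vector"
  assumes "bounded_bilinear B" "f \<in> borel_measurable M" "g \<in> borel_measurable M"
  shows "(\<lambda>x. B (f x) (g x)) \<in> borel_measurable M"
  by (rule borel_measurable_continuous_Pair[OF assms(2,3)])
     (intro bounded_bilinear.continuous_on[OF assms(1)] continuous_intros)

lemma sq_integrable_mv:
  fixes A :: "'a \<Rightarrow> complex ^ 'n::finite ^ 'n"
  assumes f: "sq_integrable M f" and A: "A \<in> borel_measurable M" "\<And>x. norm (A x) \<le> C"
  shows "sq_integrable M (\<lambda>x. A x *v f x)"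
proof -
  obtain K where K: "K \<ge> 0" "\<And>(A :: complex ^ 'n ^ 'n) x. norm (A *v x) \<le> norm A * norm x * K"
    using bounded_bilinear.nonneg_bounded[OF bounded_bilinear_mv] by metis
  show ?thesis
  proof (rule sq_integrable_bound[OF f, where B = "C * K"])
    show "(\<lambda>x. A x *v f x) \<in> borel_measurable M"
      by (rule measurable_bilinear[OF bounded_bilinear_mv A(1)]) (use f in \<open>simp add: sq_integrable_def\<close>)
    show "AE x in M. norm (A x *v f x) \<le> C * K * norm (f x)"
    proof (rule AE_I2)
      fix x
      have "norm (A x *v f x) \<le> norm (A x) * (norm (f x) * K)"
        using K(2)[of "A x" "f x"] by (simp add: mult.assoc)
      also have "\<dots> \<le> C * (norm (f x) * K)"
        using A(2)[of x] K(1) by (intro mult_right_mono) auto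
      finally show "norm (A x *v f x) \<le> C * K * norm (f x)" by (simp add: mult_ac)
    qed
  qed
qed

lemma integrable_dotp:
  fixes f g :: "'a \<Rightarrow> complex ^ 'n::finite"
  assumes f: "sq_integrable M f" and g: "sq_integrable M g"
  shows "integrable M (\<lambda>x. dotp (f x) (g x))"
proof -
  obtain K where K: "K \<ge> 0" "\<And>x y :: complex ^ 'n. norm (dotp x y) \<le> norm x * norm y * K"
    using bounded_bilinear.nonneg_bounded[OF bounded_bilinear_dotp] by metis
  show ?thesis
  proof (rule Bochner_Integration.integrable_bound)
    show "integrable M (\<lambda>x. K * ((norm (f x))\<^sup>2 + (norm (g x))\<^sup>2))"
      using f g by (simp add: sq_integrable_def)
    show "(\<lambda>x. dotp (f x) (g x)) \<in> borel_measurable M"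
      by (rule measurable_bilinear[OF bounded_bilinear_dotp]) (use f g in \<open>simp_all add: sq_integrable_def\<close>)
    show "AE x in M. norm (dotp (f x) (g x)) \<le> norm (K * ((norm (f x))\<^sup>2 + (norm (g x))\<^sup>2))"
    proof (rule AE_I2)
      fix x
      have "norm (f x) * norm (g x) \<le> (norm (f x))\<^sup>2 + (norm (g x))\<^sup>2"
        using sum_squares_bound[of "norm (f x)" "norm (g x)"]
          mult_nonneg_nonneg[OF norm_ge_zero[of "f x"] norm_ge_zero[of "g x"]] by linarith
      from mult_left_mono[OF this K(1)] K(2)[of "f x" "g x"]
      show "norm (dotp (f x) (g x)) \<le> norm (K * ((norm (f x))\<^sup>2 + (norm (g x))\<^sup>2))"
        using K(1) by (simp add: mult_ac)
    qed
  qed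
qed

lemma sq_integrable_stretch:
  fixes f :: "'d::{finite,linorder} pt \<Rightarrow> 'b::{banach,second_countable_topology}"
  assumes "s \<noteq> 0" "sq_integrable lebesgue f"
  shows "sq_integrable lebesgue (\<lambda>x. f (stretch s x))"
  using assms integral_stretch(2)[OF assms(1), of "\<lambda>x. (norm (f x))\<^sup>2"]
  by (auto simp: sq_integrable_def intro: measurable_stretch)

lemma sq_integrable_reflect_ext:
  fixes g :: "'d::{finite,linorder} pt \<Rightarrow> 'b::{banach,second_countable_topology}"
  assumes "sq_integrable lebesgue g"
  shows "sq_integrable lebesgue (reflect_ext c m n g)"
  unfolding reflect_ext_def[abs_def]
  by (intro sq_integrable_sum sq_integrable_scaleR sq_integrable_stretch refl_factor_nz assms)

section \<open>Geometry of the two domains and folding of the data\<close>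

text \<open>
  Only the first coordinate changes, and there the distance of \<open>- y\<^sub>1 / k \<ge> 0\<close> to the first
  coordinate of \<open>y0\<close> is at least \<open>\<bar>y0\<^sub>1\<bar>\<close>, while \<open>y\<^sub>1\<close> lies between \<open>2 y0\<^sub>1\<close> and \<open>0\<close> and is
  therefore at distance at most \<open>\<bar>y0\<^sub>1\<bar>\<close>.
\<close>

lemma closer_after_reflection:
  fixes y y0 :: "'d::{finite,linorder} pt"
  assumes "y $ idx1 \<le> 0" "2 * y0 $ idx1 \<le> y $ idx1" "0 < k"
  shows "dist y0 y \<le> dist y0 (stretch (refl_factor k) y)"
proof -
  have "norm (y - y0) \<le> norm (stretch (refl_factor k) y - y0)"
  proof (rule norm_le_componentwise_cart)
    fix i
    have "0 \<le> - y $ idx1 / real k" using assms by (simp add: divide_nonpos_nonneg)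
    then show "norm ((y - y0) $ i) \<le> norm ((stretch (refl_factor k) y - y0) $ i)"
      using assms by (auto simp: stretch_nth refl_factor_def)
  qed
  then show ?thesis by (simp add: dist_norm norm_minus_commute)
qed

text \<open>
  The reflection of \<open>y\<close> in the boundary point \<open>y0\<close> stays in the ball but leaves the half space.
  Hence it is not in the half ball, and so its first coordinate \<open>2 y0\<^sub>1 - y\<^sub>1\<close> is at most \<open>0\<close>.
\<close>

lemma half_space_below_bound:
  fixes nrm y0 y :: "'d::{finite,linorder} pt"
  assumes "half_ball R y0 \<subseteq> {y. b < nrm \<bullet> y}" "nrm \<bullet> y0 = b"
    and "y \<in> {y. b < nrm \<bullet> y} \<inter> ball y0 R"
  shows "2 * y0 $ idx1 \<le> y $ idx1"
proof -
  have sub: "z $ idx1 \<le> 0" if "z \<in> ball y0 R" "nrm \<bullet> z \<le> b" for z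
  proof (rule ccontr)
    assume "\<not> z $ idx1 \<le> 0"
    then have "z \<in> half_ball R y0" using that(1) by (simp add: half_ball_def upper_half_def)
    then show False using that(2) assms(1) by auto
  qed
  have "dist y0 (2 *\<^sub>R y0 - y) = dist y0 y"
    by (simp add: dist_norm scaleR_2 norm_minus_commute)
  then have "2 *\<^sub>R y0 - y \<in> ball y0 R" using assms(3) by simp
  moreover have "nrm \<bullet> (2 *\<^sub>R y0 - y) \<le> b"
    using assms by (simp add: inner_diff_right)
  ultimately show "2 * y0 $ idx1 \<le> y $ idx1" using sub[of "2 *\<^sub>R y0 - y"] by simp
qed

text \<open>
  The part \<open>y\<^sub>1 \<ge> 0\<close> of the closed ball outside the given neighbourhood is compact and does not
  meet the sphere, so it stays at a positive distance from the sphere.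
\<close>

lemma vanishes_outside_smaller_ball:
  fixes y0 :: "'d::{finite,linorder} pt" and \<phi> :: "'d pt \<Rightarrow> 'b::real_normed_vector"
  assumes R: "0 < R" and ne: "half_ball R y0 \<noteq> {}"
    and van: "vanishes_near (half_ball R y0) (frontier (half_ball R y0) - flat_part R y0) \<phi>"
  obtains r where "0 \<le> r" "r < R" "AE x in lebesgue. x \<in> half_ball R y0 - cball y0 r \<longrightarrow> \<phi> x = 0"
proof -
  let ?D = "half_ball R y0"
  have oD: "open ?D" unfolding half_ball_def by (intro open_Int open_ball open_upper_half)
  obtain U where U: "open U" "frontier ?D - flat_part R y0 \<subseteq> U"
    and ae: "AE x in lebesgue_on (?D \<inter> U). \<phi> x = 0"
    using van by (auto simp: vanishes_near_def)
  obtain w where w: "w \<in> ?D" using ne by auto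
  have sph: "z \<in> U" if z: "dist y0 z = R" "0 \<le> z $ idx1" for z
  proof -
    have wD: "dist y0 w < R" "0 < w $ idx1" using w by (auto simp: half_ball_def upper_half_def)
    have "z \<in> closure ?D"
    proof (rule closure_approachable[THEN iffD2], intro allI impI)
      fix e :: real assume "e > 0"
      define t where "t = min (1/2) (e / (2 * (dist w z + 1)))"
      have t: "0 < t" "t < 1" using \<open>e > 0\<close> by (auto simp: t_def add_nonneg_pos)
      define p where "p = z + t *\<^sub>R (w - z)"
      have "p - y0 = (1 - t) *\<^sub>R (z - y0) + t *\<^sub>R (w - y0)" by (simp add: p_def algebra_simps)
      then have "norm (p - y0) \<le> (1 - t) * norm (z - y0) + t * norm (w - y0)"
        using norm_triangle_ineq[of "(1 - t) *\<^sub>R (z - y0)" "t *\<^sub>R (w - y0)"] t by simp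
      also have "\<dots> < (1 - t) * R + t * R"
        using z(1) wD(1) t by (simp add: dist_norm norm_minus_commute)
      finally have "dist y0 p < R" by (simp add: dist_norm norm_minus_commute algebra_simps)
      moreover have "p $ idx1 = (1 - t) * z $ idx1 + t * w $ idx1" by (simp add: p_def algebra_simps)
      then have "0 < p $ idx1" using t z(2) wD(2) by (simp add: add_nonneg_pos)
      ultimately have "p \<in> ?D" by (simp add: half_ball_def upper_half_def)
      moreover have "dist p z < e"
      proof -
        have "dist p z = t * dist w z" using t by (simp add: p_def dist_norm)
        also have "\<dots> \<le> e / (2 * (dist w z + 1)) * dist w z" by (intro mult_right_mono) (auto simp: t_def)
        also have "\<dots> < e"
        proof -
          have "a < 2 * (a + 1)" if "0 \<le> a" for a :: real
            using that by simp
          from this[OF zero_le_dist[of w z]] have "e * dist w z < e * (2 * (dist w z + 1))" using \<open>e > 0\<close> by simp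
          then show ?thesis by (simp add: pos_divide_less_eq add_nonneg_pos)
        qed
        finally show ?thesis .
      qed
      ultimately show "\<exists>y\<in>?D. dist y z < e" by blast
    qed
    moreover have "z \<notin> ?D" "z \<notin> flat_part R y0"
      using z(1) by (auto simp: half_ball_def flat_part_def)
    ultimately have "z \<in> frontier ?D - flat_part R y0"
      using oD by (simp add: frontier_def interior_open)
    then show ?thesis using U by blast
  qed
  define C where "C = cball y0 R \<inter> {z. 0 \<le> z $ idx1} - U"
  have "closed {z :: 'd pt. 0 \<le> z $ idx1}"
    using closed_halfspace_component_ge_cart[of 0 idx1] by simp
  then have C: "compact C"
    unfolding C_def by (intro compact_diff compact_Int_closed compact_cball U(1))
  have Clt: "dist y0 z < R" if "z \<in> C" for z
    using that sph[of z] by (force simp: C_def)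
  obtain r where r: "0 \<le> r" "r < R" "\<And>z. z \<in> C \<Longrightarrow> dist y0 z \<le> r"
  proof (cases "C = {}")
    case True
    then show ?thesis using that[of 0] R by simp
  next
    case False
    have "continuous_on C (dist y0)" by (intro continuous_intros)
    from continuous_attains_sup[OF C False this]
    obtain z where "z \<in> C" "\<And>x. x \<in> C \<Longrightarrow> dist y0 x \<le> dist y0 z"
      by auto
    then show ?thesis using that[of "dist y0 z"] Clt by simp
  qed
  have "x \<in> ?D \<inter> U" if "x \<in> ?D - cball y0 r" for x
  proof -
    have "x \<notin> C" using r(3)[of x] that by auto
    then show ?thesis using that by (auto simp: C_def half_ball_def upper_half_def)
  qed
  moreover have "AE x in lebesgue. x \<in> ?D \<inter> U \<longrightarrow> \<phi> x = 0"
    using ae by (simp add: AE_lebesgue_on_iff open_lebesgue oD U(1) open_Int)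
  ultimately have "AE x in lebesgue. x \<in> ?D - cball y0 r \<longrightarrow> \<phi> x = 0"
    by (auto elim!: eventually_mono)
  then show ?thesis using that[of r] r by blast
qed

lemma frontier_half_space_ball:
  fixes \<Omega> :: "'a::euclidean_space set"
  assumes "open \<Omega>"
  shows "frontier (\<Omega> \<inter> ball y0 R) - (frontier \<Omega> \<inter> ball y0 R) \<subseteq> - ball y0 R"
proof
  fix z assume z: "z \<in> frontier (\<Omega> \<inter> ball y0 R) - (frontier \<Omega> \<inter> ball y0 R)"
  then have "z \<in> closure \<Omega>" "z \<notin> \<Omega> \<inter> ball y0 R"
    using closure_mono[of "\<Omega> \<inter> ball y0 R" \<Omega>] assms
    by (auto simp: frontier_def interior_open open_Int)
  then show "z \<in> - ball y0 R"
    using z assms by (auto simp: frontier_def interior_open)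
qed

text \<open>
  With \<open>t = - 1 / k\<close> the coefficient \<open>c\<^sub>\<alpha>\<^sub>,\<^sub>k\<close> equals \<open>c k * k * t ^ \<alpha> idx1\<close>, where \<open>k\<close> is the
  Jacobian of the stretching by \<open>- k\<close>. The operation \<open>f_tilde\<close> is thus the transpose of
  \<open>reflect_ext\<close>.
\<close>

lemma f_tilde_eq_sum:
  fixes P :: "'d::{finite,linorder} pt \<Rightarrow> complex ^ 'n::finite"
  assumes z: "0 < z $ idx1" "z \<in> G"
  shows "f_tilde m c ({y. y $ idx1 < 0} \<inter> G) (\<lambda>_. P) \<alpha> z =
    (\<Sum>k\<le>m. (refl_weight c k * \<bar>inverse (refl_factor k)\<bar> * refl_factor k ^ \<alpha> idx1) *\<^sub>R
       (indicator G (stretch (inverse (refl_factor k)) z) *\<^sub>R P (stretch (inverse (refl_factor k)) z)))"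
proof -
  let ?g = "\<lambda>k. (refl_weight c k * \<bar>inverse (refl_factor k)\<bar> * refl_factor k ^ \<alpha> idx1) *\<^sub>R
       (indicator G (stretch (inverse (refl_factor k)) z) *\<^sub>R P (stretch (inverse (refl_factor k)) z))"
  have "{..m} = insert 0 {1..m}" by auto
  then have "sum ?g {..m} = ?g 0 + sum ?g {1..m}" by simp
  also have "?g 0 = P z"
    using z(2) by (simp add: refl_weight_def refl_factor_def stretch_one)
  also have "sum ?g {1..m} =
      (\<Sum>k = 1..m. (refl_coeff c \<alpha> k * indicator ({y. y $ idx1 < 0} \<inter> G) (refl k z)) *\<^sub>R P (refl k z))"
  proof (rule sum.cong)
    fix k assume "k \<in> {1..m}"
    then have k: "0 < k" by simp
    have inv: "inverse (refl_factor k) = - real k" using k by (simp add: refl_factor_def)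
    have neg: "stretch (- real k) z $ idx1 < 0" using k z by (simp add: stretch_nth mult_neg_pos)
    have "refl_coeff c \<alpha> k = c k * real k * (- 1 / real k) ^ \<alpha> idx1"
    proof -
      have "(- 1 / real k) ^ \<alpha> idx1 = (- 1) ^ \<alpha> idx1 / real k ^ \<alpha> idx1" by (rule power_divide)
      then show ?thesis using k by (simp add: refl_coeff_def power_int_diff)
    qed
    then show "?g k = (refl_coeff c \<alpha> k * indicator ({y. y $ idx1 < 0} \<inter> G) (refl k z)) *\<^sub>R P (refl k z)"
      using k neg unfolding inv refl_eq_stretch
      by (simp add: refl_weight_def refl_factor_def indicator_def)
  qed simp
  finally show ?thesis by (simp add: f_tilde_def)
qed

lemma sq_integrable_f_tilde:
  fixes P :: "'d::{finite,linorder} pt \<Rightarrow> complex ^ 'n::finite"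
  assumes G: "G \<in> sets lebesgue" and D: "D \<in> sets lebesgue" "D \<subseteq> G \<inter> upper_half"
    and P: "sq_integrable (lebesgue_on G) P"
  shows "sq_integrable (lebesgue_on D) (f_tilde m c ({y. y $ idx1 < 0} \<inter> G) (\<lambda>_. P) \<alpha>)"
proof -
  let ?P = "\<lambda>x. indicator G x *\<^sub>R P x"
  let ?Q = "\<lambda>z. \<Sum>k\<le>m. (refl_weight c k * \<bar>inverse (refl_factor k)\<bar> * refl_factor k ^ \<alpha> idx1) *\<^sub>R
       ?P (stretch (inverse (refl_factor k)) z)"
  have P0: "sq_integrable lebesgue ?P" using P G by (simp only: sq_integrable_lebesgue_on)
  have "sq_integrable lebesgue ?Q"
    by (intro sq_integrable_sum sq_integrable_scaleR sq_integrable_stretch[OF _ P0]) (simp add: refl_factor_nz)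
  then have "sq_integrable (lebesgue_on UNIV) ?Q" by (simp add: lebesgue_on_UNIV_eq)
  then have "sq_integrable (lebesgue_on D) ?Q"
    by (rule sq_integrable_mono) (use D(1) in auto)
  moreover have "AE x in lebesgue_on D. ?Q x = f_tilde m c ({y. y $ idx1 < 0} \<inter> G) (\<lambda>_. P) \<alpha> x"
    using D(2) by (intro AE_I2 f_tilde_eq_sum[symmetric]) (auto simp: upper_half_def)
  ultimately show ?thesis by (rule sq_integrable_AE_lebesgue_on[OF D(1)])
qed

text \<open>
  The change of variables behind the reflected data: pairing with the extension of \<open>w\<close> over the
  large set is pairing with \<open>w\<close> over the half ball after folding the data by \<open>f_tilde\<close>.
\<close>

lemma integral_reflect_ext_dotp:
  fixes P w :: "'d::{finite,linorder} pt \<Rightarrow> complex ^ 'n::finite"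
  assumes G: "G \<in> sets lebesgue" and D: "D \<in> sets lebesgue" "D \<subseteq> G \<inter> upper_half"
    and P: "sq_integrable (lebesgue_on G) P"
    and w: "sq_integrable lebesgue w" "\<And>y. y \<notin> D \<Longrightarrow> w y = 0"
  shows "(LINT y|lebesgue_on G. dotp (reflect_ext c m (\<alpha> idx1) w y) (P y)) =
    (LINT y|lebesgue_on D. dotp (w y) (f_tilde m c ({y. y $ idx1 < 0} \<inter> G) (\<lambda>_. P) \<alpha> y))"
proof -
  interpret dotp: bounded_bilinear "dotp :: complex ^ 'n \<Rightarrow> _" by (rule bounded_bilinear_dotp)
  define P0 where "P0 x = indicator G x *\<^sub>R P x" for x
  have P0: "sq_integrable lebesgue P0"
    using P G unfolding P0_def by (simp only: sq_integrable_lebesgue_on)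
  let ?t = refl_factor and ?s = "\<lambda>k. inverse (refl_factor k)"
  have s_nz: "?s k \<noteq> 0" for k by (simp add: refl_factor_nz)
  have i1: "integrable lebesgue (\<lambda>x. dotp (w (stretch (?t k) x)) (P0 x))" for k
    by (intro integrable_dotp sq_integrable_stretch refl_factor_nz w(1) P0)
  have i2: "integrable lebesgue (\<lambda>x. dotp (w x) (P0 (stretch (?s k) x)))" for k
    by (intro integrable_dotp sq_integrable_stretch s_nz w(1) P0)
  have one: "(LINT x|lebesgue. dotp (w (stretch (?t k) x)) (P0 x)) =
      \<bar>?s k\<bar> *\<^sub>R (LINT x|lebesgue. dotp (w x) (P0 (stretch (?s k) x)))" for k
    using integral_stretch(1)[OF s_nz borel_measurable_integrable[OF i1], of k k]
    by (simp add: stretch_stretch refl_factor_nz stretch_one)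
  have "(LINT y|lebesgue_on G. dotp (reflect_ext c m (\<alpha> idx1) w y) (P y)) =
      (LINT y|lebesgue. (\<Sum>k\<le>m. (refl_weight c k * ?t k ^ \<alpha> idx1) *\<^sub>R dotp (w (stretch (?t k) y)) (P0 y)))"
    unfolding lebesgue_on_integral(1)[OF G]
    by (intro Bochner_Integration.integral_cong)
       (auto simp: P0_def reflect_ext_def dotp.sum_left dotp.scaleR_left dotp.scaleR_right indicator_def)
  also have "\<dots> = (\<Sum>k\<le>m. (refl_weight c k * ?t k ^ \<alpha> idx1) *\<^sub>R (LINT y|lebesgue. dotp (w (stretch (?t k) y)) (P0 y)))"
    by (subst Bochner_Integration.integral_sum)
       (intro integrable_scaleR_right i1, intro sum.cong refl integral_scaleR_right i1)
  also have "\<dots> = (\<Sum>k\<le>m. (refl_weight c k * \<bar>?s k\<bar> * ?t k ^ \<alpha> idx1) *\<^sub>R (LINT x|lebesgue. dotp (w x) (P0 (stretch (?s k) x))))"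
    by (simp only: one scaleR_scaleR mult_ac)
  also have "\<dots> = (LINT x|lebesgue. (\<Sum>k\<le>m. (refl_weight c k * \<bar>?s k\<bar> * ?t k ^ \<alpha> idx1) *\<^sub>R dotp (w x) (P0 (stretch (?s k) x))))"
    by (subst Bochner_Integration.integral_sum)
       (intro integrable_scaleR_right i2, intro sum.cong refl integral_scaleR_right[symmetric] i2)
  also have "\<dots> = (LINT x|lebesgue. indicator D x *\<^sub>R
      dotp (w x) (f_tilde m c ({y. y $ idx1 < 0} \<inter> G) (\<lambda>_. P) \<alpha> x))"
  proof (intro Bochner_Integration.integral_cong refl)
    fix x :: "'d pt"
    show "(\<Sum>k\<le>m. (refl_weight c k * \<bar>?s k\<bar> * ?t k ^ \<alpha> idx1) *\<^sub>R dotp (w x) (P0 (stretch (?s k) x))) =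
        indicator D x *\<^sub>R dotp (w x) (f_tilde m c ({y. y $ idx1 < 0} \<inter> G) (\<lambda>_. P) \<alpha> x)"
    proof (cases "x \<in> D")
      case True
      then have "0 < x $ idx1" "x \<in> G" using D(2) by (auto simp: upper_half_def)
      from f_tilde_eq_sum[OF this, of m c P \<alpha>] True show ?thesis
        by (simp only: P0_def[symmetric] dotp.sum_right dotp.scaleR_right indicator_simps scaleR_one)
    next
      case False
      then show ?thesis by (simp add: w(2) dotp.zero_left)
    qed
  qed
  also have "\<dots> = (LINT y|lebesgue_on D. dotp (w y) (f_tilde m c ({y. y $ idx1 < 0} \<inter> G) (\<lambda>_. P) \<alpha> y))"
    by (rule lebesgue_on_integral(1)[symmetric, OF D(1)])
  finally show ?thesis .
qed

section \<open>Extending a test function from the half ball\<close>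

lemma sq_integrable_restrict:
  fixes f :: "'a::euclidean_space \<Rightarrow> 'b::{banach,second_countable_topology}"
  assumes "sq_integrable lebesgue f" "S \<in> sets lebesgue"
  shows "sq_integrable (lebesgue_on S) f"
proof -
  have "sq_integrable (lebesgue_on UNIV) f" using assms(1) by (simp add: lebesgue_on_UNIV_eq)
  then show ?thesis by (rule sq_integrable_mono) (simp_all add: assms(2))
qed

lemma sobolev_wderiv:
  fixes u :: "'d::{finite,linorder} pt \<Rightarrow> 'b::euclidean_space"
  assumes "open S" "in_sobolev m 2 S u" "mdeg \<alpha> \<le> m"
  shows "has_weak_deriv S \<alpha> u (wderiv S \<alpha> u)"
    and "sq_integrable (lebesgue_on S) (wderiv S \<alpha> u)"
proof -
  obtain v where v: "has_weak_deriv S \<alpha> u v" "sq_integrable (lebesgue_on S) v"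
    using assms(2,3) unfolding in_sobolev_def in_Lp_2_iff by blast
  show "has_weak_deriv S \<alpha> u (wderiv S \<alpha> u)"
    by (rule has_weak_deriv_wderiv[OF v(1)])
  have "AE x in lebesgue_on S. v x = wderiv S \<alpha> u x"
    using wderiv_AE_eq[OF assms(1) v(1)] by (auto elim!: eventually_mono)
  then show "sq_integrable (lebesgue_on S) (wderiv S \<alpha> u)"
    by (rule sq_integrable_AE_lebesgue_on[OF open_lebesgue[OF assms(1)] v(2)])
qed

lemma in_sobolev_restrict:
  fixes u :: "'d::{finite,linorder} pt \<Rightarrow> 'b::euclidean_space"
  assumes S: "open S" "open T" "S \<subseteq> T" and u: "in_sobolev m 2 T u"
  shows "in_sobolev m 2 S u"
  unfolding in_sobolev_def in_Lp_2_iff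
proof (intro conjI allI impI)
  show "sq_integrable (lebesgue_on S) u"
    using u by (intro sq_integrable_mono[OF _ S(3)] open_lebesgue S) (simp add: in_sobolev_def in_Lp_2_iff)
  fix \<alpha> :: "'d mindex" assume "mdeg \<alpha> \<le> m"
  note w = sobolev_wderiv[OF S(2) u this]
  show "\<exists>v. has_weak_deriv S \<alpha> u v \<and> sq_integrable (lebesgue_on S) v"
    using weak_deriv_restrict[OF S w(1)] sq_integrable_mono[OF w(2) S(3)] S
    by (auto intro: open_lebesgue)
qed

lemma weak_deriv_zero_on_open_subset:
  fixes u v :: "'d::{finite,linorder} pt \<Rightarrow> 'b::{banach,second_countable_topology}"
  assumes "open D" "open E" "E \<subseteq> D" "has_weak_deriv D \<alpha> u v"
    and "AE x in lebesgue. x \<in> E \<longrightarrow> u x = 0"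
  shows "AE x in lebesgue. x \<in> E \<longrightarrow> v x = 0"
  using weak_deriv_zero_AE[OF assms(2) weak_deriv_restrict[OF assms(2,1,3,4)]] assms(5)
  by (simp add: AE_lebesgue_on_iff[OF open_lebesgue[OF assms(2)]])

lemma finite_mindex_le: "finite {\<alpha> :: 'd::finite mindex. mdeg \<alpha> \<le> m}"
proof (rule finite_subset)
  show "{\<alpha> :: 'd mindex. mdeg \<alpha> \<le> m} \<subseteq> PiE UNIV (\<lambda>_. {..m})"
  proof
    fix \<alpha> :: "'d mindex" assume "\<alpha> \<in> {\<alpha>. mdeg \<alpha> \<le> m}"
    then have "\<alpha> i \<le> m" for i
      using member_le_sum[of i UNIV \<alpha>] by (simp add: mdeg_def)
    then show "\<alpha> \<in> PiE UNIV (\<lambda>_. {..m})" by (auto simp: PiE_def extensional_def)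
  qed
  show "finite (PiE (UNIV :: 'd set) (\<lambda>_. {..m}))" by (intro finite_PiE) auto
qed

lemma finite_mindex_eq: "finite {\<alpha> :: 'd::finite mindex. mdeg \<alpha> = m}"
  by (rule finite_subset[OF _ finite_mindex_le[of m]]) auto

lemma mdeg_eq_0_iff: "mdeg \<alpha> = 0 \<longleftrightarrow> \<alpha> = (\<lambda>_. 0)"
  by (auto simp: mdeg_def)

text \<open>
  Square integrability of all factors allows the weak form to be split into single pairings, which
  are then moved between the two domains one by one.
\<close>

lemma integral_dotp_form:
  fixes W :: "'i \<Rightarrow> 'a \<Rightarrow> complex ^ 'n::finite"
  assumes "finite A" "finite B"
    and W: "\<And>\<alpha>. \<alpha> \<in> A \<Longrightarrow> sq_integrable M (W \<alpha>)"
    and V: "\<And>\<alpha> \<beta>. \<alpha> \<in> A \<Longrightarrow> \<beta> \<in> B \<Longrightarrow> sq_integrable M (V \<alpha> \<beta>)"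
    and pq: "sq_integrable M p" "sq_integrable M q"
  shows "(LINT y|M. (\<Sum>\<alpha>\<in>A. \<Sum>\<beta>\<in>B. dotp (W \<alpha> y) (V \<alpha> \<beta> y)) + z * dotp (p y) (q y)) =
    (\<Sum>\<alpha>\<in>A. \<Sum>\<beta>\<in>B. LINT y|M. dotp (W \<alpha> y) (V \<alpha> \<beta> y)) + z * (LINT y|M. dotp (p y) (q y))"
proof -
  have i: "integrable M (\<lambda>y. dotp (W \<alpha> y) (V \<alpha> \<beta> y))" if "\<alpha> \<in> A" "\<beta> \<in> B" for \<alpha> \<beta>
    by (intro integrable_dotp W V that)
  have i': "integrable M (\<lambda>y. \<Sum>\<beta>\<in>B. dotp (W \<alpha> y) (V \<alpha> \<beta> y))" if "\<alpha> \<in> A" for \<alpha>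
    by (intro Bochner_Integration.integrable_sum i that)
  have "(LINT y|M. (\<Sum>\<alpha>\<in>A. \<Sum>\<beta>\<in>B. dotp (W \<alpha> y) (V \<alpha> \<beta> y)) + z * dotp (p y) (q y)) =
      (LINT y|M. (\<Sum>\<alpha>\<in>A. \<Sum>\<beta>\<in>B. dotp (W \<alpha> y) (V \<alpha> \<beta> y))) + (LINT y|M. z * dotp (p y) (q y))"
    by (intro Bochner_Integration.integral_add Bochner_Integration.integrable_sum i
        integrable_mult_right integrable_dotp pq)
  also have "(LINT y|M. (\<Sum>\<alpha>\<in>A. \<Sum>\<beta>\<in>B. dotp (W \<alpha> y) (V \<alpha> \<beta> y))) =
      (\<Sum>\<alpha>\<in>A. LINT y|M. (\<Sum>\<beta>\<in>B. dotp (W \<alpha> y) (V \<alpha> \<beta> y)))"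
    by (rule Bochner_Integration.integral_sum) (rule i')
  also have "\<dots> = (\<Sum>\<alpha>\<in>A. \<Sum>\<beta>\<in>B. LINT y|M. dotp (W \<alpha> y) (V \<alpha> \<beta> y))"
    by (intro sum.cong refl Bochner_Integration.integral_sum i)
  finally show ?thesis by simp
qed

text \<open>
  Turns a test function for the half ball into one for the half space \<open>\<Omega>\<close>, with a rule that
  transfers every pairing. Zero extension followed by reflection gives \<open>\<Phi>\<close> in the Sobolev space.
  It still vanishes near the sphere: if \<open>\<Phi>\<close> is not zero at a point \<open>y\<close> below the hyperplane,
  then \<open>\<phi>\<close> is not zero at some reflected point, and this is at least as far from the centre as
  \<open>y\<close> is.
\<close>

lemma reflected_test_function:
  fixes \<phi> :: "'d::{finite,linorder} pt \<Rightarrow> complex ^ 'n::finite"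
  assumes R: "0 < R" and \<Omega>: "\<Omega> = {y. b < nrm \<bullet> y}" and y0: "nrm \<bullet> y0 = b"
    and incl: "half_ball R y0 \<subseteq> \<Omega> \<inter> ball y0 R" and ne: "half_ball R y0 \<noteq> {}"
    and c: "\<And>j. j < m \<Longrightarrow> (\<Sum>k = 1..m. (- 1 / real k) ^ j * c k) = 1"
    and \<phi>: "in_sobolev m 2 (half_ball R y0) \<phi>"
    and van: "vanishes_near (half_ball R y0) (frontier (half_ball R y0) - flat_part R y0) \<phi>"
  obtains \<Phi> :: "'d pt \<Rightarrow> complex ^ 'n"
  where "in_sobolev m 2 (\<Omega> \<inter> ball y0 R) \<Phi>"
    and "vanishes_near (\<Omega> \<inter> ball y0 R) (frontier (\<Omega> \<inter> ball y0 R) - (frontier \<Omega> \<inter> ball y0 R)) \<Phi>"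
    and "\<And>\<alpha> P. mdeg \<alpha> \<le> m \<Longrightarrow> sq_integrable (lebesgue_on (\<Omega> \<inter> ball y0 R)) P \<Longrightarrow>
      (LINT y|lebesgue_on (\<Omega> \<inter> ball y0 R). dotp (wderiv (\<Omega> \<inter> ball y0 R) \<alpha> \<Phi> y) (P y)) =
      (LINT y|lebesgue_on (half_ball R y0). dotp (wderiv (half_ball R y0) \<alpha> \<phi> y)
         (f_tilde m c ({y. y $ idx1 < 0} \<inter> (\<Omega> \<inter> ball y0 R)) (\<lambda>_. P) \<alpha> y))"
proof -
  let ?G = "\<Omega> \<inter> ball y0 R" and ?D = "half_ball R y0"
  have oG: "open ?G" unfolding \<Omega> by (intro open_Int open_ball open_halfspace_gt)
  have oD: "open ?D" unfolding half_ball_def by (intro open_Int open_ball open_upper_half)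
  have lG: "?G \<in> sets lebesgue" and lD: "?D \<in> sets lebesgue"
    by (intro open_lebesgue oG, intro open_lebesgue oD)
  have mD: "?D \<in> lmeasurable"
    unfolding half_ball_def by (intro bounded_set_imp_lmeasurable bounded_Int disjI1 bounded_ball)
      (rule lD[unfolded half_ball_def])
  have DG: "?D \<subseteq> ?G \<inter> upper_half" using incl by (auto simp: half_ball_def)
  obtain r where r: "0 \<le> r" "r < R" "AE x in lebesgue. x \<in> ?D - cball y0 r \<longrightarrow> \<phi> x = 0"
    using vanishes_outside_smaller_ball[OF R ne van] by blast
  let ?N = "?D \<inter> cball y0 r"
  have lN: "?N \<in> sets lebesgue" by (rule sets.Int[OF lD compact_lebesgue[OF compact_cball]])
  define cut where "cut g x = (indicator ?N x *\<^sub>R g x :: complex ^ 'n)" for g :: "'d pt \<Rightarrow> complex ^ 'n" and x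
  have cut0: "cut g x = 0" if "x \<notin> ?D \<or> x \<notin> cball y0 r" for g x using that by (auto simp: cut_def)
  have sq_cut: "sq_integrable lebesgue (cut g)" if "sq_integrable (lebesgue_on ?D) g" for g
  proof -
    have "sq_integrable (lebesgue_on ?N) g"
      by (rule sq_integrable_mono[OF that _ lN lD]) simp
    then show ?thesis unfolding cut_def[abs_def] sq_integrable_lebesgue_on[OF lN] .
  qed
  have int_cut: "integrable lebesgue (cut g)" if "sq_integrable (lebesgue_on ?D) g" for g
  proof -
    have "sq_integrable (lebesgue_on ?N) g"
      by (rule sq_integrable_mono[OF that _ lN lD]) simp
    moreover have "?N \<in> lmeasurable"
      by (rule fmeasurableI2[OF mD _ lN]) simp
    ultimately have "integrable (lebesgue_on ?N) g" by (rule sq_integrable_integrable)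
    then show ?thesis unfolding cut_def[abs_def] lebesgue_on_integral(2)[OF lN] .
  qed
  have sq\<phi>: "sq_integrable (lebesgue_on ?D) \<phi>" using \<phi> by (simp add: in_sobolev_def in_Lp_2_iff)
  note w = sobolev_wderiv[OF oD \<phi>]
  define \<Phi> where "\<Phi> = reflect_ext c m 0 (cut \<phi>)"
  define E where "E \<alpha> = reflect_ext c m (\<alpha> idx1) (cut (wderiv ?D \<alpha> \<phi>))" for \<alpha>
  have idx_le: "\<alpha> idx1 \<le> mdeg \<alpha>" for \<alpha> :: "'d mindex"
    unfolding mdeg_def by (rule member_le_sum) auto
  have wE: "has_weak_deriv ?G \<alpha> \<Phi> (E \<alpha>)" if \<alpha>: "mdeg \<alpha> \<le> m" for \<alpha>
  proof -
    have "has_weak_deriv upper_half \<alpha> (cut \<phi>) (cut (wderiv ?D \<alpha> \<phi>))"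
      unfolding cut_def[abs_def]
      by (rule weak_deriv_zero_extension[OF open_upper_half half_ball_def r(1,2) w(1)[OF \<alpha>] r(3)])
         (intro sq_integrable_integrable[OF _ mD] sq\<phi> w(2) \<alpha>)+
    then have "has_weak_deriv UNIV \<alpha> \<Phi> (E \<alpha>)"
      unfolding \<Phi>_def E_def using idx_le[of \<alpha>] \<alpha>
      by (intro weak_deriv_reflect_ext int_cut sq\<phi> w(2) c) (auto intro!: cut0 simp: half_ball_def)
    then show ?thesis by (rule weak_deriv_restrict[OF oG open_UNIV subset_UNIV])
  qed
  have sq_on_G: "sq_integrable (lebesgue_on ?G) (reflect_ext c m n (cut g))"
    if "sq_integrable (lebesgue_on ?D) g" for g n
    by (rule sq_integrable_restrict[OF sq_integrable_reflect_ext[OF sq_cut[OF that]] lG])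
  show ?thesis
  proof (rule that[of \<Phi>])
    show "in_sobolev m 2 ?G \<Phi>"
      unfolding in_sobolev_def in_Lp_2_iff
    proof (intro conjI allI impI)
      show "sq_integrable (lebesgue_on ?G) \<Phi>" unfolding \<Phi>_def by (rule sq_on_G[OF sq\<phi>])
      show "\<exists>v. has_weak_deriv ?G \<alpha> \<Phi> v \<and> sq_integrable (lebesgue_on ?G) v" if "mdeg \<alpha> \<le> m" for \<alpha>
        using wE[OF that] sq_on_G[OF w(2)[OF that]] unfolding E_def by blast
    qed
    show "vanishes_near ?G (frontier ?G - (frontier \<Omega> \<inter> ball y0 R)) \<Phi>"
      unfolding vanishes_near_def
    proof (intro exI[of _ "- cball y0 r"] conjI)
      show "frontier ?G - (frontier \<Omega> \<inter> ball y0 R) \<subseteq> - cball y0 r"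
        using frontier_half_space_ball[of \<Omega> y0 R] r(2) open_halfspace_gt[of b nrm] unfolding \<Omega> by force
      have "\<Phi> x = 0" if x: "x \<in> ?G \<inter> - cball y0 r" for x
      proof -
        have "cut \<phi> (stretch (refl_factor k) x) = 0" for k
        proof (cases "k = 0")
          case True
          then show ?thesis using x by (intro cut0) (auto simp: refl_factor_def stretch_one)
        next
          case False
          show ?thesis
          proof (cases "x $ idx1 \<le> 0")
            case True
            have "2 * y0 $ idx1 \<le> x $ idx1"
              using half_space_below_bound[of R y0 b nrm x] incl x y0 unfolding \<Omega> by auto
            with True False have "dist y0 x \<le> dist y0 (stretch (refl_factor k) x)"
              by (intro closer_after_reflection) auto
            then show ?thesis using x by (intro cut0) auto
          next
            case False
            then have "stretch (refl_factor k) x \<notin> ?D" using \<open>k \<noteq> 0\<close>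
              by (simp add: half_ball_def upper_half_def stretch_nth refl_factor_def divide_le_0_iff not_less)
            then show ?thesis by (intro cut0) auto
          qed
        qed
        then show ?thesis by (simp add: \<Phi>_def reflect_ext_def)
      qed
      then show "AE x in lebesgue_on (?G \<inter> - cball y0 r). \<Phi> x = 0" by (intro AE_I2) auto
    qed auto
    fix \<alpha> :: "'d mindex" and P :: "'d pt \<Rightarrow> complex ^ 'n"
    assume \<alpha>: "mdeg \<alpha> \<le> m" and P: "sq_integrable (lebesgue_on ?G) P"
    let ?T = "f_tilde m c ({y. y $ idx1 < 0} \<inter> ?G) (\<lambda>_. P) \<alpha>"
    have sqE: "sq_integrable (lebesgue_on ?G) (E \<alpha>)" unfolding E_def by (rule sq_on_G[OF w(2)[OF \<alpha>]])
    note ae = wderiv_AE_eq[OF oG wE[OF \<alpha>]]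
    have sqw: "sq_integrable (lebesgue_on ?G) (wderiv ?G \<alpha> \<Phi>)"
      by (rule sq_integrable_AE_lebesgue_on[OF lG sqE]) (use ae in \<open>auto elim!: eventually_mono\<close>)
    have "(LINT y|lebesgue_on ?G. dotp (wderiv ?G \<alpha> \<Phi> y) (P y)) =
        (LINT y|lebesgue_on ?G. dotp (E \<alpha> y) (P y))"
      by (intro integral_cong_AE borel_measurable_integrable integrable_dotp P sqE sqw)
         (use ae in \<open>auto elim!: eventually_mono\<close>)
    also have "\<dots> = (LINT y|lebesgue_on ?D. dotp (cut (wderiv ?D \<alpha> \<phi>) y) (?T y))"
      unfolding E_def by (rule integral_reflect_ext_dotp[OF lG lD DG P sq_cut[OF w(2)[OF \<alpha>]]]) (rule cut0, simp)
    also have "\<dots> = (LINT y|lebesgue_on ?D. dotp (wderiv ?D \<alpha> \<phi> y) (?T y))"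
    proof (intro integral_cong_AE borel_measurable_integrable integrable_dotp w(2) \<alpha>
          sq_integrable_f_tilde[OF lG lD DG P])
      show "sq_integrable (lebesgue_on ?D) (cut (wderiv ?D \<alpha> \<phi>))"
        by (rule sq_integrable_restrict[OF sq_cut[OF w(2)[OF \<alpha>]] lD])
      have "AE x in lebesgue. x \<in> ?D - cball y0 r \<longrightarrow> wderiv ?D \<alpha> \<phi> x = 0"
        by (rule weak_deriv_zero_on_open_subset[OF oD _ _ w(1)[OF \<alpha>] r(3)]) (use oD in auto)
      then show "AE y in lebesgue_on ?D. dotp (cut (wderiv ?D \<alpha> \<phi>) y) (?T y) = dotp (wderiv ?D \<alpha> \<phi> y) (?T y)"
        unfolding AE_lebesgue_on_iff[OF lD] by eventually_elim (auto simp: cut_def)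
    qed
    finally show "(LINT y|lebesgue_on ?G. dotp (wderiv ?G \<alpha> \<Phi> y) (P y)) =
        (LINT y|lebesgue_on ?D. dotp (wderiv ?D \<alpha> \<phi> y) (?T y))" .
  qed
qed

section \<open>The equation in the half ball\<close>

theorem lemma4p2:
  fixes \<gamma> R lam \<nu> \<delta> :: real
    and m :: nat
    and \<Omega> \<Omega>star :: "'d::{finite,linorder} pt set"
    and nrm y0 :: "'d pt"
    and b :: real
    and a :: "'d mindex \<Rightarrow> 'd mindex \<Rightarrow> 'd pt \<Rightarrow> complex ^ 'n::finite ^ 'n"
    and abar :: "'d mindex \<Rightarrow> 'd mindex \<Rightarrow> real \<Rightarrow> complex ^ 'n ^ 'n"
    and f :: "'d mindex \<Rightarrow> 'd pt \<Rightarrow> complex ^ 'n"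
    and u :: "'d pt \<Rightarrow> complex ^ 'n"
    and c :: "nat \<Rightarrow> real"
  assumes m: "1 \<le> m"
    and gamma: "0 < \<gamma>" "\<gamma> < 1 / 4"
    and R: "0 < R"
    and lam: "0 \<le> lam"
    and nu: "2 < \<nu>"
    and half_space: "norm nrm = 1" "\<Omega> = {y. b < nrm \<bullet> y}"
    and normal: "cos (\<gamma> / 2) \<le> nrm \<bullet> axis idx1 1"
    and y0: "y0 \<in> frontier \<Omega>"
    and incl: "half_ball R y0 \<subseteq> \<Omega> \<inter> ball y0 R"
      "\<Omega> \<inter> ball y0 R \<subseteq> {y. - 2 * \<gamma> * R < y $ idx1} \<inter> ball y0 R"
    and delta: "0 < \<delta>" "\<delta> < 1"
    and a_meas: "\<And>\<alpha> \<beta>. mdeg \<alpha> = m \<Longrightarrow> mdeg \<beta> = m \<Longrightarrow> a \<alpha> \<beta> \<in> borel_measurable lebesgue"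
    and a_ell: "\<And>y. elliptic m \<delta> (\<lambda>\<alpha> \<beta>. a \<alpha> \<beta> y)"
    and abar_smooth: "\<And>\<alpha> \<beta>. mdeg \<alpha> = m \<Longrightarrow> mdeg \<beta> = m \<Longrightarrow> smooth (abar \<alpha> \<beta>)"
    and abar_ell: "\<And>t. elliptic m \<delta> (\<lambda>\<alpha> \<beta>. abar \<alpha> \<beta> t)"
    and osc: "(SUP (\<alpha>, \<beta>) \<in> {\<alpha>. mdeg \<alpha> = m} \<times> {\<beta>. mdeg \<beta> = m}.
        LINT y|lebesgue_on (ball y0 R). norm (a \<alpha> \<beta> y - abar \<alpha> \<beta> (y $ idx1)))
      \<le> \<gamma> * measure lebesgue (ball y0 R)"
    and f: "\<And>\<alpha>. mdeg \<alpha> \<le> m \<Longrightarrow> in_Lp 2 (\<Omega> \<inter> ball y0 R) (f \<alpha>)"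
    and u: "in_sobolev m \<nu> (\<Omega> \<inter> ball y0 R) u"
    and sol: "conormal_solution (\<Omega> \<inter> ball y0 R) (frontier \<Omega> \<inter> ball y0 R) m a lam f u"
    and \<Omega>star: "\<Omega>star = {y. y $ idx1 < 0} \<inter> \<Omega> \<inter> ball y0 R"
    and c: "\<And>j. j < m \<Longrightarrow> (\<Sum>k = 1..m. (- 1 / real k) ^ j * c k) = 1"
  shows "conormal_solution (half_ball R y0) (flat_part R y0) m (\<lambda>\<alpha> \<beta> y. abar \<alpha> \<beta> (y $ idx1)) lam
    (\<lambda>\<alpha> y.
       if mdeg \<alpha> = m then
         (-1) ^ m *\<^sub>R (\<Sum>\<beta> | mdeg \<beta> = m.
            (abar \<alpha> \<beta> (y $ idx1) - a \<alpha> \<beta> y) *v wderiv (half_ball R y0) \<beta> u y)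
         + f_tilde m c \<Omega>star f \<alpha> y
         + g_refl m c \<Omega>star a (\<lambda>\<beta>. wderiv (\<Omega> \<inter> ball y0 R) \<beta> u) \<alpha> y
       else if mdeg \<alpha> = 0 then f_tilde m c \<Omega>star f \<alpha> y - lam *\<^sub>R h_refl m c \<Omega>star u y
       else f_tilde m c \<Omega>star f \<alpha> y)
    u"
proof -
  let ?G = "\<Omega> \<inter> ball y0 R" and ?D = "half_ball R y0"
  have oG: "open ?G" unfolding half_space by (intro open_Int open_ball open_halfspace_gt)
  have oD: "open ?D" unfolding half_ball_def by (intro open_Int open_ball open_upper_half)
  have lG: "?G \<in> sets lebesgue" and lD: "?D \<in> sets lebesgue"
    by (intro open_lebesgue oG, intro open_lebesgue oD)
  have DG: "?D \<subseteq> ?G" "?D \<subseteq> ?G \<inter> upper_half" using incl(1) by (auto simp: half_ball_def)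
  have star: "\<Omega>star = {y. y $ idx1 < 0} \<inter> ?G" unfolding \<Omega>star by auto
  have nz: "nrm \<noteq> 0" using half_space(1) by auto
  have y0b: "nrm \<bullet> y0 = b"
    using y0 nz by (simp add: half_space(2) frontier_halfspace_gt)
  \<comment> \<open>A quarter of the radius inwards along the normal, the bound \<open>- 2 \<gamma> R < y\<^sub>1\<close> shows that \<open>y0\<close> lies
    less than \<open>3 R / 4\<close> below the hyperplane.\<close>
  have ne: "?D \<noteq> {}"
  proof -
    have e: "norm (axis idx1 1 :: 'd pt) = 1" by (simp add: norm_axis_1)
    have "nrm \<bullet> nrm = 1" using half_space(1) by (simp add: dot_square_norm)
    then have "y0 + (R / 4) *\<^sub>R nrm \<in> ?G"
      using R y0b half_space(1) by (simp add: half_space(2) inner_add_right dist_norm)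
    then have "- 2 * \<gamma> * R < (y0 + (R / 4) *\<^sub>R nrm) $ idx1" using incl(2) by blast
    moreover have "R / 4 * nrm $ idx1 \<le> R / 4"
      using component_le_norm_cart[of nrm idx1] half_space(1) R by simp
    moreover have "\<gamma> * R < 1 / 4 * R" using gamma R by simp
    ultimately have "- (3 / 4) * R < y0 $ idx1" by simp
    then have "y0 + (3 / 4 * R) *\<^sub>R axis idx1 1 \<in> ?D"
      using R e by (simp add: half_ball_def upper_half_def dist_norm axis_def)
    then show ?thesis by blast
  qed
  have usob: "in_sobolev m 2 ?G u" and fsq: "\<And>\<alpha>. mdeg \<alpha> \<le> m \<Longrightarrow> sq_integrable (lebesgue_on ?G) (f \<alpha>)"
    using sol by (auto simp: conormal_solution_def in_Lp_2_iff)
  have usobD: "in_sobolev m 2 ?D u" by (rule in_sobolev_restrict[OF oD oG DG(1) usob])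
  have usq: "sq_integrable (lebesgue_on ?G) u" "sq_integrable (lebesgue_on ?D) u"
    using usob usobD by (simp_all add: in_sobolev_def in_Lp_2_iff)
  define Du where "Du \<beta> = wderiv ?G \<beta> u" for \<beta>
  define DuD where "DuD \<beta> = wderiv ?D \<beta> u" for \<beta>
  have Du: "has_weak_deriv ?G \<beta> u (Du \<beta>)" "sq_integrable (lebesgue_on ?G) (Du \<beta>)" if "mdeg \<beta> \<le> m" for \<beta>
    unfolding Du_def by (rule sobolev_wderiv[OF oG usob that])+
  have DuD: "sq_integrable (lebesgue_on ?D) (DuD \<beta>)" "AE y in lebesgue_on ?D. DuD \<beta> y = Du \<beta> y"
    if "mdeg \<beta> \<le> m" for \<beta>
    unfolding DuD_def
    by (rule sobolev_wderiv(2)[OF oD usobD that],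
        rule wderiv_AE_eq[OF oD weak_deriv_restrict[OF oD oG DG(1) Du(1)[OF that]]])
  let ?A = "{\<alpha> :: 'd mindex. mdeg \<alpha> = m}"
  have a_bound: "norm (a \<alpha> \<beta> y) \<le> inverse \<delta>" and abar_bound: "norm (abar \<alpha> \<beta> t) \<le> inverse \<delta>"
    if "mdeg \<alpha> = m" "mdeg \<beta> = m" for \<alpha> \<beta> y t
    using a_ell[of y] abar_ell[of t] that by (auto simp: elliptic_def)
  have abar_meas: "(\<lambda>y. abar \<alpha> \<beta> (y $ idx1)) \<in> borel_measurable lebesgue"
    if "mdeg \<alpha> = m" "mdeg \<beta> = m" for \<alpha> \<beta>
    by (rule continuous_lebesgue_measurable, rule continuous_on_compose2[OF
        smooth_continuous_on[OF abar_smooth[OF that], of UNIV] smooth_continuous_on[OF smooth_nth]]) auto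
  have asq: "sq_integrable (lebesgue_on S) (\<lambda>y. a \<alpha> \<beta> y *v v y)"
    and abarsq: "sq_integrable (lebesgue_on S) (\<lambda>y. abar \<alpha> \<beta> (y $ idx1) *v v y)"
    if "mdeg \<alpha> = m" "mdeg \<beta> = m" "sq_integrable (lebesgue_on S) v" for S \<alpha> \<beta> v
    using that by (auto intro!: sq_integrable_mv[where C = "inverse \<delta>"] measurable_restrict_space1
        a_meas abar_meas a_bound abar_bound)
  define aDu where "aDu \<alpha> \<beta> y = a \<alpha> \<beta> y *v Du \<beta> y" for \<alpha> \<beta> y
  \<comment> \<open>Folding does not mix the data of different multi-indices, so it is an operation on single
    functions.\<close>
  define T where "T \<alpha> P = f_tilde m c \<Omega>star (\<lambda>_. P) \<alpha>" for \<alpha> and P :: "'d pt \<Rightarrow> complex ^ 'n"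
  have Tsq: "sq_integrable (lebesgue_on ?D) (T \<alpha> P)" if "sq_integrable (lebesgue_on ?G) P" for \<alpha> P
    unfolding T_def star by (rule sq_integrable_f_tilde[OF lG lD DG(2) that])
  have aDu_sq: "sq_integrable (lebesgue_on ?G) (aDu \<alpha> \<beta>)" if "\<alpha> \<in> ?A" "\<beta> \<in> ?A" for \<alpha> \<beta>
    unfolding aDu_def using that by (intro asq Du(2)) auto
  have aDu_sqD: "sq_integrable (lebesgue_on ?D) (aDu \<alpha> \<beta>)" if "\<alpha> \<in> ?A" "\<beta> \<in> ?A" for \<alpha> \<beta>
    by (rule sq_integrable_mono[OF aDu_sq[OF that] DG(1) lD lG])
  define X where "X \<alpha> \<beta> y = abar \<alpha> \<beta> (y $ idx1) *v DuD \<beta> y" for \<alpha> \<beta> y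
  define Y where "Y \<alpha> \<beta> y = a \<alpha> \<beta> y *v DuD \<beta> y" for \<alpha> \<beta> y
  have Xsq: "sq_integrable (lebesgue_on ?D) (X \<alpha> \<beta>)" and Ysq: "sq_integrable (lebesgue_on ?D) (Y \<alpha> \<beta>)"
    if "\<alpha> \<in> ?A" "\<beta> \<in> ?A" for \<alpha> \<beta>
    unfolding X_def Y_def using that by (intro asq abarsq DuD(1); auto)+
  let ?F = "\<lambda>\<alpha> y.
       if mdeg \<alpha> = m then
         (-1) ^ m *\<^sub>R (\<Sum>\<beta> | mdeg \<beta> = m.
            (abar \<alpha> \<beta> (y $ idx1) - a \<alpha> \<beta> y) *v wderiv (half_ball R y0) \<beta> u y)
         + f_tilde m c \<Omega>star f \<alpha> y
         + g_refl m c \<Omega>star a (\<lambda>\<beta>. wderiv (\<Omega> \<inter> ball y0 R) \<beta> u) \<alpha> y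
       else if mdeg \<alpha> = 0 then f_tilde m c \<Omega>star f \<alpha> y - lam *\<^sub>R h_refl m c \<Omega>star u y
       else f_tilde m c \<Omega>star f \<alpha> y"
  have F_top: "?F \<alpha> = (\<lambda>y. (-1) ^ m *\<^sub>R (\<Sum>\<beta>\<in>?A. X \<alpha> \<beta> y - Y \<alpha> \<beta> y) + T \<alpha> (f \<alpha>) y +
      (-1) ^ (m + 1) *\<^sub>R (\<Sum>\<beta>\<in>?A. T \<alpha> (aDu \<alpha> \<beta>) y - aDu \<alpha> \<beta> y))" if "mdeg \<alpha> = m" for \<alpha>
    using that by (intro ext) (simp add: X_def Y_def T_def aDu_def f_tilde_def g_refl_def DuD_def Du_def
        matrix_vector_mult_diff_rdistrib)
  have F_zero: "?F \<alpha> = (\<lambda>y. T \<alpha> (f \<alpha>) y - lam *\<^sub>R (T \<alpha> u y - u y))" if "mdeg \<alpha> = 0" for \<alpha>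
  proof -
    have "\<alpha> idx1 = 0" using that by (simp add: mdeg_eq_0_iff)
    then show ?thesis using that m
      by (intro ext) (simp add: T_def f_tilde_def h_refl_def refl_coeff_def mult_ac)
  qed
  have F_mid: "?F \<alpha> = T \<alpha> (f \<alpha>)" if "mdeg \<alpha> \<noteq> m" "mdeg \<alpha> \<noteq> 0" for \<alpha>
    using that by (intro ext) (simp add: T_def f_tilde_def)
  have Fsq: "sq_integrable (lebesgue_on ?D) (?F \<alpha>)" if "mdeg \<alpha> \<le> m" for \<alpha>
  proof -
    consider "mdeg \<alpha> = m" | "mdeg \<alpha> = 0" | "mdeg \<alpha> \<noteq> m" "mdeg \<alpha> \<noteq> 0" by blast
    then show ?thesis
    proof cases
      case 1
      show ?thesis unfolding F_top[OF 1] using 1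
        by (intro sq_integrable_add sq_integrable_scaleR sq_integrable_sum sq_integrable_diff
            Xsq Ysq Tsq aDu_sq aDu_sqD fsq) auto
    next
      case 2
      show ?thesis unfolding F_zero[OF 2] using that
        by (intro sq_integrable_scaleR sq_integrable_diff Tsq usq fsq)
    next
      case 3
      show ?thesis unfolding F_mid[OF 3] using that by (intro Tsq fsq)
    qed
  qed
  have goal: "(LINT y|lebesgue_on ?D.
           (\<Sum>\<alpha> | mdeg \<alpha> = m. \<Sum>\<beta> | mdeg \<beta> = m.
              dotp (wderiv ?D \<alpha> \<phi> y) (abar \<alpha> \<beta> (y $ idx1) *v wderiv ?D \<beta> u y))
           + complex_of_real lam * dotp (\<phi> y) (u y)) =
        (\<Sum>\<alpha> | mdeg \<alpha> \<le> m.
           LINT y|lebesgue_on ?D. (-1) ^ mdeg \<alpha> * dotp (wderiv ?D \<alpha> \<phi> y) (?F \<alpha> y))"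
    if \<phi>: "in_sobolev m 2 ?D \<phi>" and van: "vanishes_near ?D (frontier ?D - flat_part R y0) \<phi>"
    for \<phi> :: "'d pt \<Rightarrow> complex ^ 'n"
  proof -
    interpret dotp: bounded_bilinear "dotp :: complex ^ 'n \<Rightarrow> _" by (rule bounded_bilinear_dotp)
    show ?thesis
    proof (rule reflected_test_function[OF R half_space(2) y0b incl(1) ne c \<phi> van])
      fix \<Phi> :: "'d pt \<Rightarrow> complex ^ 'n"
      assume \<Phi>: "in_sobolev m 2 ?G \<Phi>" "vanishes_near ?G (frontier ?G - (frontier \<Omega> \<inter> ball y0 R)) \<Phi>"
        and transfer_raw: "\<And>\<alpha> P. mdeg \<alpha> \<le> m \<Longrightarrow> sq_integrable (lebesgue_on ?G) P \<Longrightarrow>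
          (LINT y|lebesgue_on ?G. dotp (wderiv ?G \<alpha> \<Phi> y) (P y)) =
          (LINT y|lebesgue_on ?D. dotp (wderiv ?D \<alpha> \<phi> y)
            (f_tilde m c ({y. y $ idx1 < 0} \<inter> ?G) (\<lambda>_. P) \<alpha> y))"
      have transfer: "(LINT y|lebesgue_on ?G. dotp (wderiv ?G \<alpha> \<Phi> y) (P y)) =
          (LINT y|lebesgue_on ?D. dotp (wderiv ?D \<alpha> \<phi> y) (T \<alpha> P y))"
        if "mdeg \<alpha> \<le> m" "sq_integrable (lebesgue_on ?G) P" for \<alpha> P
        unfolding T_def star by (rule transfer_raw[OF that])
      note w = sobolev_wderiv(2)[OF oD \<phi>] and W = sobolev_wderiv(2)[OF oG \<Phi>(1)]
      define I where "I \<alpha> P = (LINT y|lebesgue_on ?D. dotp (wderiv ?D \<alpha> \<phi> y) (P y))" for \<alpha> P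
      have I_add: "I \<alpha> (\<lambda>y. P y + Q y) = I \<alpha> P + I \<alpha> Q"
        and I_diff: "I \<alpha> (\<lambda>y. P y - Q y) = I \<alpha> P - I \<alpha> Q"
        if "mdeg \<alpha> \<le> m" "sq_integrable (lebesgue_on ?D) P" "sq_integrable (lebesgue_on ?D) Q" for \<alpha> P Q
        unfolding I_def dotp.add_right dotp.diff_right
        by (intro Bochner_Integration.integral_add Bochner_Integration.integral_diff integrable_dotp w that)+
      have I_scale: "I \<alpha> (\<lambda>y. z *\<^sub>R P y) = complex_of_real z * I \<alpha> P" for \<alpha> P z
        unfolding I_def dotp.scaleR_right by (simp add: scaleR_conv_of_real)
      have I_sum: "I \<alpha> (\<lambda>y. \<Sum>\<beta>\<in>B. P \<beta> y) = (\<Sum>\<beta>\<in>B. I \<alpha> (P \<beta>))"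
        if "mdeg \<alpha> \<le> m" "\<And>\<beta>. \<beta> \<in> B \<Longrightarrow> sq_integrable (lebesgue_on ?D) (P \<beta>)" for \<alpha> P and B :: "'d mindex set"
        unfolding I_def dotp.sum_right
        by (intro Bochner_Integration.integral_sum integrable_dotp w that)
      have I_Y: "I \<alpha> (Y \<alpha> \<beta>) = I \<alpha> (aDu \<alpha> \<beta>)" if "\<alpha> \<in> ?A" "\<beta> \<in> ?A" for \<alpha> \<beta>
        unfolding I_def
      proof (intro integral_cong_AE borel_measurable_integrable integrable_dotp w Ysq aDu_sqD that)
        show "AE y in lebesgue_on ?D. dotp (wderiv ?D \<alpha> \<phi> y) (Y \<alpha> \<beta> y) = dotp (wderiv ?D \<alpha> \<phi> y) (aDu \<alpha> \<beta> y)"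
          using DuD(2)[of \<beta>] that by (auto simp: Y_def aDu_def elim!: eventually_mono)
      qed (use that in auto)
      let ?o = "\<lambda>_ :: 'd. 0 :: nat"
      have o: "mdeg ?o = 0" by (simp add: mdeg_def)
      have \<phi>sq: "sq_integrable (lebesgue_on ?D) \<phi>" and \<Phi>sq: "sq_integrable (lebesgue_on ?G) \<Phi>"
        using \<phi> \<Phi>(1) by (simp_all add: in_sobolev_def in_Lp_2_iff)
      have I_o: "(LINT y|lebesgue_on ?D. dotp (\<phi> y) (P y)) = I ?o P"
        if "sq_integrable (lebesgue_on ?D) P" for P
        unfolding I_def
      proof (intro integral_cong_AE borel_measurable_integrable integrable_dotp \<phi>sq w that)
        show "AE y in lebesgue_on ?D. dotp (\<phi> y) (P y) = dotp (wderiv ?D ?o \<phi> y) (P y)"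
          using wderiv_AE_eq[OF oD weak_deriv_zero_index[OF o sq_integrable_loc_integrable[OF \<phi>sq lD]]]
          by (auto elim!: eventually_mono)
      qed (simp add: o)
      have \<Phi>_o: "(LINT y|lebesgue_on ?G. dotp (\<Phi> y) (u y)) = I ?o (T ?o u)"
      proof -
        have "(LINT y|lebesgue_on ?G. dotp (\<Phi> y) (u y)) =
            (LINT y|lebesgue_on ?G. dotp (wderiv ?G ?o \<Phi> y) (u y))"
        proof (intro integral_cong_AE borel_measurable_integrable integrable_dotp \<Phi>sq W usq)
          show "AE y in lebesgue_on ?G. dotp (\<Phi> y) (u y) = dotp (wderiv ?G ?o \<Phi> y) (u y)"
            using wderiv_AE_eq[OF oG weak_deriv_zero_index[OF o sq_integrable_loc_integrable[OF \<Phi>sq lG]]]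
            by (auto elim!: eventually_mono)
        qed (simp add: o)
        also have "\<dots> = I ?o (T ?o u)" unfolding I_def by (rule transfer) (simp_all add: o usq)
        finally show ?thesis .
      qed
      define J where "J \<alpha> = (-1) ^ mdeg \<alpha> * I \<alpha> (T \<alpha> (f \<alpha>))" for \<alpha>
      define S1 where "S1 \<alpha> = (\<Sum>\<beta>\<in>?A. I \<alpha> (X \<alpha> \<beta>))" for \<alpha>
      define S2 where "S2 \<alpha> = (\<Sum>\<beta>\<in>?A. I \<alpha> (T \<alpha> (aDu \<alpha> \<beta>)))" for \<alpha>
      define K where "K = I ?o (T ?o u)"
      define L where "L = I ?o u"
      \<comment> \<open>The given equation tested with the extension, all integrals folded to the half ball.\<close>
      have eq: "(\<Sum>\<alpha>\<in>?A. S2 \<alpha>) + complex_of_real lam * K = (\<Sum>\<alpha> | mdeg \<alpha> \<le> m. J \<alpha>)"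
      proof -
        have "(LINT y|lebesgue_on ?G. (\<Sum>\<alpha>\<in>?A. \<Sum>\<beta>\<in>?A. dotp (wderiv ?G \<alpha> \<Phi> y) (aDu \<alpha> \<beta> y))
            + complex_of_real lam * dotp (\<Phi> y) (u y)) =
            (\<Sum>\<alpha> | mdeg \<alpha> \<le> m. LINT y|lebesgue_on ?G. (-1) ^ mdeg \<alpha> * dotp (wderiv ?G \<alpha> \<Phi> y) (f \<alpha> y))"
          using sol \<Phi> unfolding conormal_solution_def aDu_def Du_def by blast
        also have "(LINT y|lebesgue_on ?G. (\<Sum>\<alpha>\<in>?A. \<Sum>\<beta>\<in>?A. dotp (wderiv ?G \<alpha> \<Phi> y) (aDu \<alpha> \<beta> y))
            + complex_of_real lam * dotp (\<Phi> y) (u y)) =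
            (\<Sum>\<alpha>\<in>?A. \<Sum>\<beta>\<in>?A. LINT y|lebesgue_on ?G. dotp (wderiv ?G \<alpha> \<Phi> y) (aDu \<alpha> \<beta> y))
            + complex_of_real lam * K"
          unfolding K_def \<Phi>_o[symmetric]
          by (intro integral_dotp_form finite_mindex_eq W aDu_sq \<Phi>sq usq) auto
        also have "(\<Sum>\<alpha>\<in>?A. \<Sum>\<beta>\<in>?A. LINT y|lebesgue_on ?G. dotp (wderiv ?G \<alpha> \<Phi> y) (aDu \<alpha> \<beta> y)) =
            (\<Sum>\<alpha>\<in>?A. S2 \<alpha>)"
          unfolding S2_def I_def by (intro sum.cong refl transfer aDu_sq) auto
        also have "(\<Sum>\<alpha> | mdeg \<alpha> \<le> m. LINT y|lebesgue_on ?G. (-1) ^ mdeg \<alpha> * dotp (wderiv ?G \<alpha> \<Phi> y) (f \<alpha> y)) =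
            (\<Sum>\<alpha> | mdeg \<alpha> \<le> m. J \<alpha>)"
        proof (intro sum.cong refl)
          fix \<alpha> :: "'d mindex" assume "\<alpha> \<in> {\<alpha>. mdeg \<alpha> \<le> m}"
          then show "(LINT y|lebesgue_on ?G. (-1) ^ mdeg \<alpha> * dotp (wderiv ?G \<alpha> \<Phi> y) (f \<alpha> y)) = J \<alpha>"
            using transfer[OF _ fsq, of \<alpha> \<alpha>] by (simp add: J_def I_def)
        qed
        finally show ?thesis .
      qed
      \<comment> \<open>The pairing with the new data differs from that with the folded \<open>f\<close> by exactly the terms that
        exchange the leading coefficients and replace the folded \<open>u\<close> by \<open>u\<close>. The
        integrals of \<open>a D\<^sup>\<beta> u\<close> over the half ball cancel.\<close>
      have F_I: "(LINT y|lebesgue_on ?D. (-1) ^ mdeg \<alpha> * dotp (wderiv ?D \<alpha> \<phi> y) (?F \<alpha> y)) =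
          J \<alpha> + (if mdeg \<alpha> = m then S1 \<alpha> - S2 \<alpha> else 0) +
          (if \<alpha> = ?o then - complex_of_real lam * (K - L) else 0)" if \<alpha>: "mdeg \<alpha> \<le> m" for \<alpha>
      proof -
        have "(LINT y|lebesgue_on ?D. (-1) ^ mdeg \<alpha> * dotp (wderiv ?D \<alpha> \<phi> y) (?F \<alpha> y)) =
            (-1) ^ mdeg \<alpha> * I \<alpha> (?F \<alpha>)"
          unfolding I_def by (rule integral_mult_right_zero)
        also consider "mdeg \<alpha> = m" | "mdeg \<alpha> = 0" | "mdeg \<alpha> \<noteq> m" "mdeg \<alpha> \<noteq> 0" by blast
        then have "(-1) ^ mdeg \<alpha> * I \<alpha> (?F \<alpha>) = J \<alpha> + (if mdeg \<alpha> = m then S1 \<alpha> - S2 \<alpha> else 0) +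
          (if \<alpha> = ?o then - complex_of_real lam * (K - L) else 0)"
        proof cases
          case 1
          have mem: "\<alpha> \<in> ?A" using 1 by simp
          have no: "\<alpha> \<noteq> ?o" using 1 m o by auto
          have fs: "sq_integrable (lebesgue_on ?D) (T \<alpha> (f \<alpha>))" by (rule Tsq[OF fsq[OF \<alpha>]])
          have d1: "sq_integrable (lebesgue_on ?D) (\<lambda>y. X \<alpha> \<beta> y - Y \<alpha> \<beta> y)"
            and d2: "sq_integrable (lebesgue_on ?D) (\<lambda>y. T \<alpha> (aDu \<alpha> \<beta>) y - aDu \<alpha> \<beta> y)" if "\<beta> \<in> ?A" for \<beta>
            by (rule sq_integrable_diff[OF Xsq[OF mem that] Ysq[OF mem that]],
              rule sq_integrable_diff[OF Tsq[OF aDu_sq[OF mem that]] aDu_sqD[OF mem that]])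
          have "I \<alpha> (?F \<alpha>) = complex_of_real ((-1) ^ m) * (\<Sum>\<beta>\<in>?A. I \<alpha> (\<lambda>y. X \<alpha> \<beta> y - Y \<alpha> \<beta> y)) + I \<alpha> (T \<alpha> (f \<alpha>)) +
              complex_of_real ((-1) ^ (m + 1)) * (\<Sum>\<beta>\<in>?A. I \<alpha> (\<lambda>y. T \<alpha> (aDu \<alpha> \<beta>) y - aDu \<alpha> \<beta> y))"
            unfolding F_top[OF 1]
            by (simp only: I_add[OF \<alpha>] I_scale I_sum[OF \<alpha>] d1 d2 fs sq_integrable_add sq_integrable_scaleR sq_integrable_sum)
          also have "(\<Sum>\<beta>\<in>?A. I \<alpha> (\<lambda>y. X \<alpha> \<beta> y - Y \<alpha> \<beta> y)) = S1 \<alpha> - (\<Sum>\<beta>\<in>?A. I \<alpha> (aDu \<alpha> \<beta>))"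
            unfolding S1_def sum_subtractf[symmetric]
            by (intro sum.cong refl) (simp only: I_diff[OF \<alpha> Xsq[OF mem] Ysq[OF mem]] I_Y[OF mem])
          also have "(\<Sum>\<beta>\<in>?A. I \<alpha> (\<lambda>y. T \<alpha> (aDu \<alpha> \<beta>) y - aDu \<alpha> \<beta> y)) = S2 \<alpha> - (\<Sum>\<beta>\<in>?A. I \<alpha> (aDu \<alpha> \<beta>))"
            unfolding S2_def sum_subtractf[symmetric]
            by (intro sum.cong refl I_diff[OF \<alpha>] Tsq aDu_sq aDu_sqD mem)
          finally have I_F: "I \<alpha> (?F \<alpha>) =
              complex_of_real ((-1) ^ m) * (S1 \<alpha> - (\<Sum>\<beta>\<in>?A. I \<alpha> (aDu \<alpha> \<beta>))) + I \<alpha> (T \<alpha> (f \<alpha>)) +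
              complex_of_real ((-1) ^ (m + 1)) * (S2 \<alpha> - (\<Sum>\<beta>\<in>?A. I \<alpha> (aDu \<alpha> \<beta>)))" .
          have "(-1) ^ mdeg \<alpha> * I \<alpha> (?F \<alpha>) = ((-1) ^ m * (-1) ^ m) * (S1 \<alpha> - S2 \<alpha>) + J \<alpha>"
            unfolding I_F by (simp add: J_def 1 algebra_simps)
          also have "(-1) ^ m * (-1) ^ m = (1 :: complex)"
            by (simp add: power_mult_distrib[symmetric])
          finally show ?thesis using 1 no by simp
        next
          case 2
          then have \<alpha>0: "\<alpha> = ?o" by (simp only: mdeg_eq_0_iff)
          have Tu: "sq_integrable (lebesgue_on ?D) (T \<alpha> u)" by (rule Tsq[OF usq(1)])
          have "I \<alpha> (?F \<alpha>) = I \<alpha> (T \<alpha> (f \<alpha>)) - complex_of_real lam * (I \<alpha> (T \<alpha> u) - I \<alpha> u)"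
            unfolding F_zero[OF 2]
            by (simp only: I_diff[OF \<alpha>] I_scale Tu usq(2) Tsq[OF fsq[OF \<alpha>]] sq_integrable_diff sq_integrable_scaleR)
          then show ?thesis using 2 m unfolding J_def K_def L_def \<alpha>0
            by (simp add: o algebra_simps)
        next
          case 3
          then have "\<alpha> \<noteq> ?o" using o by auto
          then show ?thesis using 3 unfolding F_mid[OF 3] by (simp add: J_def)
        qed
        finally show ?thesis .
      qed
      have "(LINT y|lebesgue_on ?D. (\<Sum>\<alpha>\<in>?A. \<Sum>\<beta>\<in>?A. dotp (wderiv ?D \<alpha> \<phi> y) (X \<alpha> \<beta> y))
          + complex_of_real lam * dotp (\<phi> y) (u y)) =
          (\<Sum>\<alpha>\<in>?A. S1 \<alpha>) + complex_of_real lam * L"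
        unfolding S1_def L_def I_o[OF usq(2), symmetric] unfolding I_def
        by (intro integral_dotp_form finite_mindex_eq w Xsq \<phi>sq usq) auto
      also have "\<dots> = (\<Sum>\<alpha> | mdeg \<alpha> \<le> m. J \<alpha>) + (\<Sum>\<alpha>\<in>?A. S1 \<alpha> - S2 \<alpha>) + (- complex_of_real lam * (K - L))"
        unfolding eq[symmetric] by (simp add: sum_subtractf algebra_simps)
      also have "(\<Sum>\<alpha>\<in>?A. S1 \<alpha> - S2 \<alpha>) = (\<Sum>\<alpha> | mdeg \<alpha> \<le> m. if mdeg \<alpha> = m then S1 \<alpha> - S2 \<alpha> else 0)"
        by (rule sum.mono_neutral_cong_left[OF finite_mindex_le]) auto
      also have "- complex_of_real lam * (K - L) =
          (\<Sum>\<alpha> | mdeg \<alpha> \<le> m. if \<alpha> = ?o then - complex_of_real lam * (K - L) else 0)"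
        by (subst sum.delta[OF finite_mindex_le]) (simp add: o)
      also have "(\<Sum>\<alpha> | mdeg \<alpha> \<le> m. J \<alpha>) + (\<Sum>\<alpha> | mdeg \<alpha> \<le> m. if mdeg \<alpha> = m then S1 \<alpha> - S2 \<alpha> else 0) +
          (\<Sum>\<alpha> | mdeg \<alpha> \<le> m. if \<alpha> = ?o then - complex_of_real lam * (K - L) else 0) =
          (\<Sum>\<alpha> | mdeg \<alpha> \<le> m. LINT y|lebesgue_on ?D. (-1) ^ mdeg \<alpha> * dotp (wderiv ?D \<alpha> \<phi> y) (?F \<alpha> y))"
        unfolding sum.distrib[symmetric] by (intro sum.cong refl F_I[symmetric]) simp
      finally show ?thesis unfolding X_def DuD_def .
    qed
  qed
  show ?thesis
    unfolding conormal_solution_def in_Lp_2_iff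
    using usobD Fsq goal by blast
qed

end
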